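(* Consider the reach-avoid game described in the context, with speed ratio $\alpha=v_E/v_P\in(0,1)$. Assume all players have pairwise distinct initial positions, the pursuers' initial positions lie in $\Omega_{\rm play}\cup\mathcal T$, and the evaders' initial positions lie in $\Omega_{\rm play}$. Let $k$ be a full-active pursuit coalition with $n_k$ pursuers and joint initial position $\mathcal X_k^0$, and let $P_{\hat m_1},\dots,P_{\hat m_{n_k}}$ be its members listed so that $x^0_{P_{\hat m_1}}<\dots<x^0_{P_{\hat m_{n_k}}}$. Then its barrier against one evader is $\mathcal B^{n_k}(\mathcal X_k^0)=\breve{\mathcal B}^{n_k}\cap\Omega_{\rm play}$, where $\breve{\mathcal B}^{n_k}$ (the barrier when the boundary of $\Omega_{\rm play}$ is ignored) is given by: (i) if $n_k=1$, $\breve{\mathcal B}^{1}=\bigcup_{s=1}^3F^1_s(\mathbf x^0_{P_{\hat m_1}})$; if $n_k=2$, $\breve{\mathcal B}^{2}=\bigcup_{s=1}^5F^2_s(\mathbf x^0_{P_{\hat m_1}},\mathbf x^0_{P_{\hat m_2}})$; (ii) if $3\le n_k\le N_p$, $$\breve{\mathcal B}^{n_k}=\bigcup_{i=1}^2F^2_i(\mathbf x^0_{P_{\hat m_1}},\mathbf x^0_{P_{\hat m_2}})\ \cup\ \bigcup_{i=1}^{n_k-1}F^2_3(\mathbf x^0_{P_{\hat m_i}},\mathbf x^0_{P_{\hat m_{i+1}}})\ \cup\ \bigcup_{i=2}^{n_k-1}F^3(\mathbf x^0_{P_{\hat m_{i-1}}},\mathbf x^0_{P_{\hat m_i}},\mathbf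 x^0_{P_{\hat m_{i+1}}})\ \cup\ \bigcup_{i=4}^5F^2_i(\mathbf x^0_{P_{\hat m_{n_k-1}}},\mathbf x^0_{P_{\hat m_{n_k}}}).$$
   Context: Domain. $\Omega\subset\mathbb R^2$ is a bounded convex domain. A straight segment $\mathcal T\subset\Omega$ (the target line) with endpoints $\bm m=(0,0)$ and $\bm n=(l,0)$, $l>0$, both on $\partial\Omega$, cuts $\Omega$ into the compact target region $\Omega_{\rm tar}\supset\mathcal T$ (the part in $y\ge 0$) and the play region $\Omega_{\rm play}=\Omega\setminus\Omega_{\rm tar}$ (the part in $y<0$). Players. There are pursuers $P_1,\dots,P_{N_p}$ and evaders $E_1,\dots,E_{N_e}$, which are points moving in $\Omega$ with $\dot{\mathbf x}_{P_i}=v_P\mathbf u_{P_i}$, $\dot{\mathbf x}_{E_j}=v_E\mathbf u_{E_j}$, controls in $\mathcal U=\{\mathbf u\in\mathbb R^2:\|\mathbf u\|_2=1\}$, and initial positions $\mathbf x^0_{P_i}=(x^0_{P_i},y^0_{P_i})$, $\mathbf x^0_{E_j}$; $\alpha=v_E/v_P$. An evader is captured when its position in $\Omega_{\rm play}$ coincides with that of a pursuer; once it enters $\Omega_{\rm tar}$ it can no longer be captured. Information structure: the evader uses state feedback; the pursuit team uses state feedback together with the evader's current input (non-anticipative strategies). Winning regions and barrier. A pursuit coalition $k$ is a nonempty set of $n_k$ pursuers with joint initial position $\mathcal X_k^0$. For a game between coalition $k$ and one evader: $\mathcal W_P^{n_k}(\mathcal X_k^0)\subset\Omega_{\rm play}$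 is the set of initial evader positions from which the coalition can guarantee capture before the evader enters $\Omega_{\rm tar}$, whatever the evader does; $\mathcal W_E^{n_k}(\mathcal X_k^0)\subset\Omega_{\rm play}$ is the set of initial evader positions from which the evader can guarantee entering $\Omega_{\rm tar}$ without being captured, whatever the coalition does. The barrier $\mathcal B^{n_k}(\mathcal X_k^0)\subset\Omega_{\rm play}$ is the curve separating these two regions, i.e. the set of positions from which neither side can guarantee its own winning (under optimal play capture and arrival at $\mathcal T$ happen simultaneously), with $\mathcal B^{n_k}\cup\mathcal W_P^{n_k}\cup\mathcal W_E^{n_k}=\Omega_{\rm play}$. $\breve{\mathcal B}^{n_k}$ denotes the barrier of the same game when the boundary of $\Omega_{\rm play}$ is ignored (players move in $\mathbb R^2$, the evader starts in $\{y<0\}$ and wants to reach $\mathcal T$). Full-active coalitions. Coalition $k$ is full-active if for every $P_i$ in $k$ there is a point of $\mathcal T$ that $P_i$ reaches before all other pursuers of $k$, i.e. there is $\bm p\in\mathcal T$ with $\|\mathbf x^0_{P_i}-\bm p\|_2<\|\mathbf x^0_{P_j}-\bm p\|_2$ for every other $P_j$ in $k$. (Members of a full-active coalition have pairwise different $x$-coordinates, so the ordering in the claim exists and is unique.) Base curves. Let $\bm h_i=(x_i,y_i)$, $y_i\le0$, $x_1<x_2<x_3$, and write $\mathbf z=(x,y)\in\mathbb R^2$. One pursuer: with $k_1=\alpha^2x_1$, $k_2=(1-\alpha^2)l+\alpha^2x_1$, $$F^1_1(\bm h_1)=\{\mathbf z:\|\mathbf z-\bm m\|_2=\alpha\|\bm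 h_1-\bm m\|_2,\ x\le k_1,\ y<0\},$$ $$F^1_2(\bm h_1)=\{\mathbf z:(x-x_1)^2+(1-1/\alpha^2)y^2+(1-\alpha^2)y_1^2=0,\ x\in(k_1,k_2),\ y<0\},$$ $$F^1_3(\bm h_1)=\{\mathbf z:\|\mathbf z-\bm n\|_2=\alpha\|\bm h_1-\bm n\|_2,\ x\ge k_2,\ y<0\}.$$ Two pursuers: let $\bm p_c=(x_c,0)$ be the unique point of the $x$-axis with $\|\bm p_c-\bm h_1\|_2=\|\bm p_c-\bm h_2\|_2$, $k_3=\alpha^2x_1$, $k_4=(1-\alpha^2)x_c+\alpha^2x_1$, $k_5=(1-\alpha^2)x_c+\alpha^2x_2$, $k_6=(1-\alpha^2)l+\alpha^2x_2$; $$F^2_1(\bm h_1,\bm h_2)=F^1_1(\bm h_1),\qquad F^2_5(\bm h_1,\bm h_2)=F^1_3(\bm h_2),$$ $$F^2_2(\bm h_1,\bm h_2)=\{\mathbf z:(x-x_1)^2+(1-1/\alpha^2)y^2+(1-\alpha^2)y_1^2=0,\ x\in(k_3,k_4),\ y<0\},$$ $$F^2_3(\bm h_1,\bm h_2)=\{\mathbf z:\|\mathbf z-\bm p_c\|_2=\alpha\|\bm h_1-\bm p_c\|_2,\ x\in[k_4,k_5],\ y<0\},$$ $$F^2_4(\bm h_1,\bm h_2)=\{\mathbf z:(x-x_2)^2+(1-1/\alpha^2)y^2+(1-\alpha^2)y_2^2=0,\ x\in(k_5,k_6),\ y<0\}.$$ Three pursuers: let $\bm p_{c1}=(x_{c1},0)$,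 $\bm p_{c2}=(x_{c2},0)$ satisfy $\|\bm h_1-\bm p_{c1}\|_2=\|\bm h_2-\bm p_{c1}\|_2$ and $\|\bm h_2-\bm p_{c2}\|_2=\|\bm h_3-\bm p_{c2}\|_2$, $k_7=(1-\alpha^2)x_{c1}+\alpha^2x_2$, $k_8=(1-\alpha^2)x_{c2}+\alpha^2x_2$; $$F^3(\bm h_1,\bm h_2,\bm h_3)=\{\mathbf z:(x-x_2)^2+(1-1/\alpha^2)y^2+(1-\alpha^2)y_2^2=0,\ x\in(k_7,k_8),\ y<0\}.$$ *)

theory Defs
  imports "HOL-Analysis.Analysis"
begin

definition pt :: "real \<Rightarrow> real \<Rightarrow> real^2" where
  "pt x y = vector [x, y]"

definition target_line :: "real \<Rightarrow> (real^2) set" where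
  "target_line l = closed_segment (pt 0 0) (pt l 0)"

definition tar_region :: "(real^2) set \<Rightarrow> (real^2) set" where
  "tar_region \<Omega> = {z \<in> \<Omega>. z $ 2 \<ge> 0}"

definition play_region :: "(real^2) set \<Rightarrow> (real^2) set" where
  "play_region \<Omega> = \<Omega> - tar_region \<Omega>"

text \<open>
  The game is parametrised by the set \<open>D\<close> in which all players move and by the set \<open>R\<close> the evader
  wants to reach; capture is possible in \<open>D - R\<close>.  The original game has \<open>D = \<Omega>\<close> and
  \<open>R = tar_region \<Omega>\<close>; ignoring the boundary of the play region means \<open>D = UNIV\<close> and
  \<open>R = target_line l\<close>.
\<close>

text \<open>The solution of \<open>x' = v u\<close>, \<open>x(0) = x0\<close>.\<close>

definition traj :: "real \<Rightarrow> real^2 \<Rightarrow> (real \<Rightarrow> real^2) \<Rightarrow> real \<Rightarrow> real^2" where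
  "traj v x0 u t = x0 + v *\<^sub>R integral {0..t} u"

definition admissible :: "(real^2) set \<Rightarrow> real \<Rightarrow> real^2 \<Rightarrow> (real \<Rightarrow> real^2) set" where
  "admissible D v x0 = {u. u \<in> borel_measurable lebesgue \<and> (\<forall>t. norm (u t) = 1)
                            \<and> (\<forall>t\<ge>0. traj v x0 u t \<in> D)}"

text \<open>
  Non-anticipative strategies of the coalition \<open>K\<close> with initial positions \<open>X\<close> against an evader
  starting at \<open>z\<close>: the controls of the pursuers up to time \<open>t\<close> depend only on the control of the
  evader up to and including time \<open>t\<close> (as usual, controls are identified if equal a.e.).
\<close>

definition coalition_strategies ::
  "(real^2) set \<Rightarrow> real \<Rightarrow> real \<Rightarrow> nat set \<Rightarrow> (nat \<Rightarrow> real^2) \<Rightarrow> real^2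
    \<Rightarrow> ((real \<Rightarrow> real^2) \<Rightarrow> nat \<Rightarrow> real \<Rightarrow> real^2) set" where
  "coalition_strategies D vP vE K X z = {\<beta>.
     (\<forall>a \<in> admissible D vE z. \<forall>i\<in>K. \<beta> a i \<in> admissible D vP (X i)) \<and>
     (\<forall>a \<in> admissible D vE z. \<forall>a' \<in> admissible D vE z. \<forall>t\<ge>0.
        (AE s in lebesgue. s \<in> {0..t} \<longrightarrow> a s = a' s) \<longrightarrow>
        (\<forall>i\<in>K. AE s in lebesgue. s \<in> {0..t} \<longrightarrow> \<beta> a i s = \<beta> a' i s))}"

text \<open>
  The evader at \<open>xE\<close> meets a pursuer of \<open>K\<close>.  In the definitions below \<open>xE\<close> and \<open>xP i\<close> are
  trajectories.
\<close>

definition caught_at :: "nat set \<Rightarrow> (nat \<Rightarrow> real \<Rightarrow> real^2) \<Rightarrow> (real \<Rightarrow> real^2) \<Rightarrow> real \<Rightarrow> bool" where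
  "caught_at K xP xE t \<longleftrightarrow> (\<exists>i\<in>K. xP i t = xE t)"

definition pursuers_win ::
  "(real^2) set \<Rightarrow> (real^2) set \<Rightarrow> nat set \<Rightarrow> (nat \<Rightarrow> real \<Rightarrow> real^2) \<Rightarrow> (real \<Rightarrow> real^2) \<Rightarrow> bool" where
  "pursuers_win D R K xP xE \<longleftrightarrow>
     (\<exists>t\<ge>0. caught_at K xP xE t \<and> (\<forall>s\<in>{0..t}. xE s \<in> D - R))"

text \<open>Meeting a pursuer exactly on arrival in \<open>R\<close> is a win for neither side.\<close>

definition evader_wins ::
  "(real^2) set \<Rightarrow> nat set \<Rightarrow> (nat \<Rightarrow> real \<Rightarrow> real^2) \<Rightarrow> (real \<Rightarrow> real^2) \<Rightarrow> bool" where
  "evader_wins R K xP xE \<longleftrightarrow>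
     (\<exists>t\<ge>0. xE t \<in> R \<and> (\<forall>s\<in>{0..t}. \<not> caught_at K xP xE s))"

text \<open>
  The control \<open>a\<close> follows the state feedback law \<open>\<sigma>\<close> as long as the game is running, i.e. until the
  evader is captured or has entered \<open>R\<close>.  Feedback laws may be discontinuous, so solutions of the
  closed loop are understood in the sense of Caratheodory and need neither exist nor be unique.
\<close>

definition follows_feedback ::
  "(real^2) set \<Rightarrow> nat set \<Rightarrow> (real^2 \<Rightarrow> (nat \<Rightarrow> real^2) \<Rightarrow> real^2)
    \<Rightarrow> (nat \<Rightarrow> real \<Rightarrow> real^2) \<Rightarrow> (real \<Rightarrow> real^2) \<Rightarrow> (real \<Rightarrow> real^2) \<Rightarrow> bool" where
  "follows_feedback R K \<sigma> xP xE a \<longleftrightarrow>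
     (AE t in lebesgue. t \<ge> 0 \<longrightarrow> (\<forall>s\<in>{0..t}. xE s \<notin> R \<and> \<not> caught_at K xP xE s) \<longrightarrow>
        a t = \<sigma> (xE t) (\<lambda>i\<in>K. xP i t))"

definition pursuit_winning_region ::
  "(real^2) set \<Rightarrow> (real^2) set \<Rightarrow> real \<Rightarrow> real \<Rightarrow> nat set \<Rightarrow> (nat \<Rightarrow> real^2) \<Rightarrow> (real^2) set" where
  "pursuit_winning_region D R vP vE K X = {z \<in> D - R.
     \<exists>\<beta> \<in> coalition_strategies D vP vE K X z. \<forall>a \<in> admissible D vE z.
       pursuers_win D R K (\<lambda>i. traj vP (X i) (\<beta> a i)) (traj vE z a)}"

text \<open>
  A state feedback law guarantees the win of the evader if, against every coalition strategy, the
  closed loop has a solution and every solution is won by the evader.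
\<close>

definition evasion_winning_region ::
  "(real^2) set \<Rightarrow> (real^2) set \<Rightarrow> real \<Rightarrow> real \<Rightarrow> nat set \<Rightarrow> (nat \<Rightarrow> real^2) \<Rightarrow> (real^2) set" where
  "evasion_winning_region D R vP vE K X = {z \<in> D - R.
     \<exists>\<sigma>. (\<forall>x p. norm (\<sigma> x p) = 1) \<and>
       (\<forall>\<beta> \<in> coalition_strategies D vP vE K X z.
          (\<exists>a \<in> admissible D vE z.
             follows_feedback R K \<sigma> (\<lambda>i. traj vP (X i) (\<beta> a i)) (traj vE z a) a) \<and>
          (\<forall>a \<in> admissible D vE z.
             follows_feedback R K \<sigma> (\<lambda>i. traj vP (X i) (\<beta> a i)) (traj vE z a) a \<longrightarrow>
             evader_wins R K (\<lambda>i. traj vP (X i) (\<beta> a i)) (traj vE z a)))}"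

definition barrier :: "(real^2) set \<Rightarrow> real \<Rightarrow> real \<Rightarrow> nat set \<Rightarrow> (nat \<Rightarrow> real^2) \<Rightarrow> (real^2) set" where
  "barrier \<Omega> vP vE K X = play_region \<Omega>
     - (pursuit_winning_region \<Omega> (tar_region \<Omega>) vP vE K X
        \<union> evasion_winning_region \<Omega> (tar_region \<Omega>) vP vE K X)"

definition free_barrier :: "real \<Rightarrow> real \<Rightarrow> real \<Rightarrow> nat set \<Rightarrow> (nat \<Rightarrow> real^2) \<Rightarrow> (real^2) set" where
  "free_barrier l vP vE K X = {z. z $ 2 < 0}
     - (pursuit_winning_region UNIV (target_line l) vP vE K X
        \<union> evasion_winning_region UNIV (target_line l) vP vE K X)"

definition full_active :: "real \<Rightarrow> nat set \<Rightarrow> (nat \<Rightarrow> real^2) \<Rightarrow> bool" where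
  "full_active l K X \<longleftrightarrow>
     (\<forall>i\<in>K. \<exists>p\<in>target_line l. \<forall>j\<in>K - {i}. norm (X i - p) < norm (X j - p))"

text \<open>\<open>axis_equidist h h'\<close> is the abscissa of the point of the x-axis equidistant from \<open>h\<close>, \<open>h'\<close>.\<close>

definition axis_equidist :: "real^2 \<Rightarrow> real^2 \<Rightarrow> real" where
  "axis_equidist h h' = (THE x. norm (pt x 0 - h) = norm (pt x 0 - h'))"

text \<open>\<open>circ_arc \<alpha> c h I\<close> and \<open>conic_arc \<alpha> h I\<close> are the two shapes occurring in the base curves, restricted to
  abscissae in \<open>I\<close>.\<close>

definition circ_arc :: "real \<Rightarrow> real^2 \<Rightarrow> real^2 \<Rightarrow> real set \<Rightarrow> (real^2) set" where
  "circ_arc \<alpha> c h I = {z. norm (z - c) = \<alpha> * norm (h - c) \<and> z $ 1 \<in> I \<and> z $ 2 < 0}"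

definition conic_arc :: "real \<Rightarrow> real^2 \<Rightarrow> real set \<Rightarrow> (real^2) set" where
  "conic_arc \<alpha> h I =
     {z. (z $ 1 - h $ 1)\<^sup>2 + (1 - 1 / \<alpha>\<^sup>2) * (z $ 2)\<^sup>2 + (1 - \<alpha>\<^sup>2) * (h $ 2)\<^sup>2 = 0
         \<and> z $ 1 \<in> I \<and> z $ 2 < 0}"

definition F1_1 :: "real \<Rightarrow> real^2 \<Rightarrow> (real^2) set" where
  "F1_1 \<alpha> h1 = circ_arc \<alpha> (pt 0 0) h1 {..\<alpha>\<^sup>2 * h1 $ 1}"

definition F1_2 :: "real \<Rightarrow> real \<Rightarrow> real^2 \<Rightarrow> (real^2) set" where
  "F1_2 \<alpha> l h1 = conic_arc \<alpha> h1 {\<alpha>\<^sup>2 * h1 $ 1 <..< (1 - \<alpha>\<^sup>2) * l + \<alpha>\<^sup>2 * h1 $ 1}"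

definition F1_3 :: "real \<Rightarrow> real \<Rightarrow> real^2 \<Rightarrow> (real^2) set" where
  "F1_3 \<alpha> l h1 = circ_arc \<alpha> (pt l 0) h1 {(1 - \<alpha>\<^sup>2) * l + \<alpha>\<^sup>2 * h1 $ 1..}"

definition F2_1 :: "real \<Rightarrow> real^2 \<Rightarrow> real^2 \<Rightarrow> (real^2) set" where
  "F2_1 \<alpha> h1 h2 = F1_1 \<alpha> h1"

definition F2_2 :: "real \<Rightarrow> real^2 \<Rightarrow> real^2 \<Rightarrow> (real^2) set" where
  "F2_2 \<alpha> h1 h2 = conic_arc \<alpha> h1
     {\<alpha>\<^sup>2 * h1 $ 1 <..< (1 - \<alpha>\<^sup>2) * axis_equidist h1 h2 + \<alpha>\<^sup>2 * h1 $ 1}"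

definition F2_3 :: "real \<Rightarrow> real^2 \<Rightarrow> real^2 \<Rightarrow> (real^2) set" where
  "F2_3 \<alpha> h1 h2 = circ_arc \<alpha> (pt (axis_equidist h1 h2) 0) h1
     {(1 - \<alpha>\<^sup>2) * axis_equidist h1 h2 + \<alpha>\<^sup>2 * h1 $ 1 ..
      (1 - \<alpha>\<^sup>2) * axis_equidist h1 h2 + \<alpha>\<^sup>2 * h2 $ 1}"

definition F2_4 :: "real \<Rightarrow> real \<Rightarrow> real^2 \<Rightarrow> real^2 \<Rightarrow> (real^2) set" where
  "F2_4 \<alpha> l h1 h2 = conic_arc \<alpha> h2
     {(1 - \<alpha>\<^sup>2) * axis_equidist h1 h2 + \<alpha>\<^sup>2 * h2 $ 1 <..< (1 - \<alpha>\<^sup>2) * l + \<alpha>\<^sup>2 * h2 $ 1}"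

definition F2_5 :: "real \<Rightarrow> real \<Rightarrow> real^2 \<Rightarrow> real^2 \<Rightarrow> (real^2) set" where
  "F2_5 \<alpha> l h1 h2 = F1_3 \<alpha> l h2"

definition F3 :: "real \<Rightarrow> real^2 \<Rightarrow> real^2 \<Rightarrow> real^2 \<Rightarrow> (real^2) set" where
  "F3 \<alpha> h1 h2 h3 = conic_arc \<alpha> h2
     {(1 - \<alpha>\<^sup>2) * axis_equidist h1 h2 + \<alpha>\<^sup>2 * h2 $ 1 <..<
      (1 - \<alpha>\<^sup>2) * axis_equidist h2 h3 + \<alpha>\<^sup>2 * h2 $ 1}"

end

theory Submission
  imports Defs
begin

text \<open>
  The evader at \<open>z\<close> wins if for some \<open>q \<in> T\<close> it is closer to \<open>q\<close>, in the sense
  \<open>\<bar>z - q\<bar> < \<alpha> \<bar>X i - q\<bar>\<close>, than every pursuer: it runs straight to \<open>q\<close>. Conversely, under parallel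
  pursuit (each pursuer keeps its line of sight parallel to the initial one) the Apollonius discs
  are nested, so the evader cannot reach a point \<open>q\<close> with \<open>\<bar>z - q\<bar> \<ge> \<alpha> \<bar>X i - q\<bar>\<close> without being met by
  pursuer \<open>i\<close>. In the bounded game parallel pursuit may leave \<open>\<Omega>\<close>; its metric projection onto the
  triangle spanned by the pursuer and \<open>T\<close> stays in \<open>\<Omega>\<close> and is no farther from any point of \<open>T\<close>, but it
  may be too slow for an admissible pursuer. The pursuer therefore moves on the segment between the
  evader and this guide, as close to the evader as its speed bound permits; by minimality it then
  runs at full speed until capture.

  Hence the barrier consists of the \<open>z\<close> for which the maximum over \<open>i\<close> of the quadratics
  \<open>\<bar>z - q\<bar>\<^sup>2 - \<alpha>\<^sup>2 \<bar>X i - q\<bar>\<^sup>2\<close> has minimum \<open>0\<close> on \<open>T\<close>. The minimum lies at an endpoint of \<open>T\<close>, at a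
  boundary point between two Voronoi cells, or at the vertex of one of the parabolas; this gives the
  circular arcs and the conic arcs.
\<close>

text \<open>Two features of the model shape the proof. Controls have norm exactly 1 at every time
  and must keep the player in the domain for ever: a pursuer can neither wait nor slow down, and it
  has to go on moving after the capture. And the projection makes the guide merely Lipschitz, so a
  path must first be turned into a measurable control before it can serve in a strategy. The two
  winning conditions ask for different strength. Capture at the very moment of arrival already
  denies the evader its win, whereas the pursuers win only by capturing strictly earlier. Nested
  discs alone do not give this strictness once projections intervene. It comes from the reserve
  \<open>vP - vE\<close>: after the end of parallel pursuit the guide is the projection of the
  evader and no faster than it, and the reserve closes the remaining gap before the guide
  does.\<close>

section \<open>Lipschitz paths as integrals\<close>

text \<open>By Henstock's lemma the Riemann sums of \<open>norm \<circ> f\<close> tend to \<open>0\<close>.\<close>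

lemma AE_zero_of_integral_zero:
  fixes f :: "real \<Rightarrow> 'a::euclidean_space"
  assumes int: "f integrable_on {a..b}" and zero: "\<And>s. s \<in> {a..b} \<Longrightarrow> integral {a..s} f = 0"
  shows "AE s in lebesgue. s \<in> {a..b} \<longrightarrow> f s = 0"
proof -
  have sub: "integral {r..s} f = 0" if "a \<le> r" "r \<le> s" "s \<le> b" for r s
  proof -
    have "integral {a..r} f + integral {r..s} f = integral {a..s} f"
      by (rule Henstock_Kurzweil_Integration.integral_combine)
        (use that int in \<open>auto intro: integrable_on_subinterval\<close>)
    then show ?thesis using zero that by simp
  qed
  have hi: "((\<lambda>x. norm (f x)) has_integral 0) (cbox a b)"
    unfolding has_integral
  proof (intro allI impI)
    fix e :: real assume e: "e > 0"
    obtain \<gamma> where g: "gauge \<gamma>"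
      and \<gamma>: "\<And>p. \<lbrakk>p tagged_partial_division_of (cbox a b); \<gamma> fine p\<rbrakk> \<Longrightarrow>
             sum (\<lambda>(x,k). norm(measure lborel k *\<^sub>R f x - integral k f)) p < e"
      by (rule Henstock_lemma[OF int[unfolded cbox_interval[symmetric]] e]) blast
    show "\<exists>\<gamma>. gauge \<gamma> \<and> (\<forall>\<D>. \<D> tagged_division_of (cbox a b) \<and> \<gamma> fine \<D> \<longrightarrow>
        norm ((\<Sum>(x, k)\<in>\<D>. measure lborel k *\<^sub>R norm (f x)) - 0) < e)"
    proof (intro exI conjI allI impI, rule g)
      fix p assume p: "p tagged_division_of cbox a b \<and> \<gamma> fine p"
      then have pp: "p tagged_partial_division_of cbox a b" unfolding tagged_division_of_def by blast
      have "(\<Sum>(x, k)\<in>p. measure lborel k *\<^sub>R norm (f x)) = sum (\<lambda>(x,k). norm(measure lborel k *\<^sub>R f x - integral k f)) p"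
      proof (rule sum.cong, rule refl, clarify)
        fix x k assume xk: "(x,k) \<in> p"
        obtain c d where k: "k = cbox c d" using tagged_division_ofD(4) p xk by blast
        have "k \<subseteq> cbox a b" using tagged_division_ofD(3) p xk by blast
        moreover have "x \<in> k" using tagged_division_ofD(2) p xk by blast
        ultimately have "a \<le> c" "c \<le> d" "d \<le> b" using k by auto
        then have "integral k f = 0" using sub k by simp
        then show "measure lborel k *\<^sub>R norm (f x) = norm(measure lborel k *\<^sub>R f x - integral k f)" by simp
      qed
      then have "(\<Sum>(x, k)\<in>p. measure lborel k *\<^sub>R norm (f x)) < e" using \<gamma>[OF pp] p by simp
      moreover have "(\<Sum>(x, k)\<in>p. measure lborel k *\<^sub>R norm (f x)) \<ge> 0" by (rule sum_nonneg) auto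
      ultimately show "norm ((\<Sum>(x, k)\<in>p. measure lborel k *\<^sub>R norm (f x)) - 0) < e" by simp
    qed
  qed
  have nn: "(\<lambda>x. norm (f x)) absolutely_integrable_on {a..b}"
    using hi by (intro nonnegative_absolutely_integrable_1) (auto simp: integrable_on_def)
  have "integral\<^sup>L lebesgue (\<lambda>x. indicat_real {a..b} x *\<^sub>R norm (f x)) = 0"
    using set_lebesgue_integral_eq_integral(2)[OF nn] hi
    by (simp add: set_lebesgue_integral_def integral_unique)
  then have "AE x in lebesgue. indicat_real {a..b} x *\<^sub>R norm (f x) = 0"
    using nn by (subst (asm) integral_nonneg_eq_0_iff_AE) (auto simp: set_integrable_def)
  then show ?thesis by eventually_elim (auto simp: indicator_def split: if_splits)
qed

text \<open>\<open>k\<close> is the Radon-Nikodym density of the image of Lebesgue measure under the inverse of \<open>G\<close>.\<close>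

lemma bilipschitz_density:
  fixes G :: "real \<Rightarrow> real"
  assumes c: "0 < c" and lo: "\<And>a b. a \<le> b \<Longrightarrow> c * (b - a) \<le> G b - G a"
    and hi: "\<And>a b. a \<le> b \<Longrightarrow> G b - G a \<le> M * (b - a)"
  obtains k :: "real \<Rightarrow> real" where "k \<in> borel_measurable borel" "\<And>x. 0 \<le> k x"
    "\<And>a b. a \<le> b \<Longrightarrow> (k has_integral (G b - G a)) {a..b}"
proof -
  have absG: "\<bar>G b - G a\<bar> \<le> M * \<bar>b - a\<bar>" for a b
  proof (cases "a \<le> b")
    case True
    have "0 \<le> c * (b - a)" using c True by simp
    then show ?thesis using lo[OF True] hi[OF True] True by simp
  next
    case False
    then have "0 \<le> c * (a - b)" using c by simp
    then show ?thesis using lo[of b a] hi[of b a] False by (simp add: abs_if)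
  qed
  have absG2: "c * \<bar>b - a\<bar> \<le> \<bar>G b - G a\<bar>" for a b
    using lo[of a b] lo[of b a] by (cases "a \<le> b") auto
  have M: "0 \<le> M" using absG[of 1 0] by (auto intro: order_trans[rotated])
  have contG: "continuous_on UNIV G"
  proof -
    have "M-lipschitz_on UNIV G" using absG M by (intro lipschitz_onI) (auto simp: dist_real_def)
    then show ?thesis by (rule lipschitz_on_continuous_on)
  qed
  have inj: "inj G"
  proof (rule injI)
    fix x y assume "G x = G y"
    then have "c * \<bar>x - y\<bar> \<le> 0" using absG2[of x y] by simp
    then show "x = y" using c by (simp add: mult_le_0_iff)
  qed
  have surj: "\<exists>x. G x = y" for y
  proof -
    define d where "d = \<bar>y - G 0\<bar> / c"
    have d: "d \<ge> 0" "c * d = \<bar>y - G 0\<bar>" using c by (auto simp: d_def)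
    have "G (-d) \<le> y" using lo[of "-d" 0] d by (auto simp: abs_if split: if_splits)
    moreover have "y \<le> G d" using lo[of 0 d] d by (auto simp: abs_if split: if_splits)
    ultimately show ?thesis using IVT'[of G "-d" y d] d contG
      by (auto intro: continuous_on_subset)
  qed
  define H where "H = inv G"
  have GH: "G (H y) = y" for y unfolding H_def using surj[of y] by (metis f_inv_into_f rangeI)
  have HG: "H (G x) = x" for x unfolding H_def using inj by simp
  have contH: "continuous_on UNIV H"
  proof -
    have "(1/c)-lipschitz_on UNIV H"
      using absG2[of "H x" "H y" for x y] c
      by (intro lipschitz_onI) (auto simp: dist_real_def GH field_simps)
    then show ?thesis by (rule lipschitz_on_continuous_on)
  qed
  have mH[measurable]: "H \<in> borel_measurable borel" using contH by (rule borel_measurable_continuous_onI)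
  define N where "N = distr lborel borel H"
  have vimH: "H -` A = G ` A" for A using GH HG by (auto simp: image_iff) (metis GH)
  \<comment> \<open>Preimages under \<open>H\<close> are images under the Lipschitz map
    \<open>G\<close>, which keeps null sets null.\<close>
  have "absolutely_continuous lborel N"
    unfolding absolutely_continuous_def
  proof
    fix A :: "real set" assume A: "A \<in> null_sets lborel"
    then have Ab[measurable]: "A \<in> sets borel" by (auto simp: null_sets_def)
    have "A \<in> null_sets lebesgue" using A by (auto intro: null_sets_completionI)
    then have "negligible A" by (simp add: negligible_iff_null_sets)
    then have "negligible (G ` A)"
      by (rule negligible_locally_Lipschitz_image[rotated])
        (use absG in \<open>auto intro!: exI[of _ UNIV] exI[of _ M]\<close>)
    then have "emeasure lebesgue (G ` A) = 0" by (auto simp: negligible_iff_null_sets)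
    moreover have "G ` A \<in> sets borel" unfolding vimH[symmetric] using measurable_sets[OF mH Ab] by simp
    ultimately have "emeasure lborel (H -` A) = 0" by (simp add: vimH)
    then show "A \<in> null_sets N" by (auto simp: N_def null_sets_def emeasure_distr)
  qed
  moreover have "sets N = sets lborel" by (simp add: N_def)
  ultimately obtain f where f: "f \<in> borel_measurable lborel" and fN: "density lborel f = N"
    using sigma_finite_measure.Radon_Nikodym[OF sigma_finite_lborel] by blast
  have fb[measurable]: "f \<in> borel_measurable borel" using f by simp
  have I: "(\<integral>\<^sup>+x. f x * indicator {a..b} x \<partial>lborel) = ennreal (G b - G a)" if "a \<le> b" for a b
  proof -
    have "(\<integral>\<^sup>+x. f x * indicator {a..b} x \<partial>lborel) = emeasure N {a..b}"
      unfolding fN[symmetric] by (subst emeasure_density) auto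
    also have "\<dots> = emeasure lborel (H -` {a..b})" by (simp add: N_def emeasure_distr)
    also have "H -` {a..b} = {G a..G b}"
    proof (intro set_eqI)
      fix y
      have mono: "x \<le> x' \<longleftrightarrow> G x \<le> G x'" for x x'
      proof
        assume h: "x \<le> x'"
        have "0 \<le> c * (x' - x)" using c h by simp
        then show "G x \<le> G x'" using lo[OF h] by simp
      next
        assume h: "G x \<le> G x'"
        show "x \<le> x'"
        proof (rule ccontr)
          assume n: "\<not> x \<le> x'"
          then have "0 < c * (x - x')" using c by simp
          then show False using lo[of x' x] n h by simp
        qed
      qed
      show "y \<in> H -` {a..b} \<longleftrightarrow> y \<in> {G a..G b}" using mono[of a "H y"] mono[of "H y" b] by (simp add: GH)
    qed
    also have "emeasure lborel {G a..G b} = ennreal (G b - G a)"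
      using lo[OF that] c that by (intro emeasure_lborel_Icc) (smt (verit) mult_nonneg_nonneg)
    finally show ?thesis .
  qed
  have fin: "AE x in lborel. f x \<noteq> \<infinity>"
  proof -
    have "AE x in lborel. f x * indicator {- real n..real n} x \<noteq> \<infinity>" for n :: nat
      by (rule nn_integral_PInf_AE) (auto simp: I)
    then have "AE x in lborel. \<forall>n. f x * indicator {- real n..real n} x \<noteq> \<infinity>" by (simp add: AE_all_countable)
    then show ?thesis
    proof eventually_elim
      case (elim x)
      obtain n :: nat where "\<bar>x\<bar> \<le> real n" using real_arch_simple by blast
      then have "x \<in> {- real n..real n}" by auto
      then show ?case using elim[rule_format, of n] by simp
    qed
  qed
  define k where "k x = enn2real (f x)" for x
  have "(k has_integral (G b - G a)) {a..b}" if "a \<le> b" for a b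
  proof -
    have eq: "(\<integral>\<^sup>+x. ennreal (k x * indicator {a..b} x) \<partial>lborel) = (\<integral>\<^sup>+x. f x * indicator {a..b} x \<partial>lborel)"
    proof (rule nn_integral_cong_AE)
      show "AE x in lborel. ennreal (k x * indicator {a..b} x) = f x * indicator {a..b} x"
        using fin by eventually_elim (auto simp: k_def indicator_def less_top)
    qed
    have "((\<lambda>x. k x * indicator {a..b} x) has_integral (G b - G a)) UNIV"
    proof (rule nn_integral_has_integral)
      show "(\<lambda>x. k x * indicator {a..b} x) \<in> borel_measurable borel" unfolding k_def by measurable
      show "0 \<le> G b - G a" using lo[OF that] c that by (smt (verit) mult_nonneg_nonneg)
    qed (use eq I[OF that] in \<open>auto simp: k_def\<close>)
    then have "((\<lambda>x. if x \<in> {a..b} then k x else 0) has_integral (G b - G a)) UNIV"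
      by (rule has_integral_eq[rotated]) (auto simp: indicator_def)
    then show ?thesis by (subst (asm) has_integral_restrict_UNIV)
  qed
  moreover have "k \<in> borel_measurable borel" unfolding k_def by measurable
  ultimately show ?thesis using that[of k] by (simp add: k_def)
qed


text \<open>For a direction \<open>e\<close> the function
  \<open>(v * norm e + \<eta>) * t - Q t \<bullet> e\<close> is increasing and bi-Lipschitz, so it
  has a nonnegative density. Subtraction yields the components of \<open>g\<close>; nonnegativity
  yields the speed bound, first for one direction and one \<open>\<eta>\<close>, then for countably
  many at once.\<close>

lemma lipschitz_density:
  fixes Q :: "real \<Rightarrow> 'a::euclidean_space"
  assumes lip: "v-lipschitz_on {0..} Q"
  obtains g where "g \<in> borel_measurable borel" "\<And>t. norm (g t) \<le> v"
    "\<And>s t. 0 \<le> s \<Longrightarrow> s \<le> t \<Longrightarrow> (g has_integral (Q t - Q s)) {s..t}"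
proof -
  have v: "0 \<le> v" using lip by (rule lipschitz_on_nonneg)
  have L: "norm (Q t - Q s) \<le> v * (t - s)" if "0 \<le> s" "s \<le> t" for s t
    using lipschitz_on_normD[OF lip, of t s] that by simp
  have ex: "\<exists>k\<in>borel_measurable borel. (\<forall>x. 0 \<le> k x) \<and> (\<forall>s t. 0 \<le> s \<longrightarrow> s \<le> t \<longrightarrow>
       (k has_integral ((v * norm e + \<eta>) * (t - s) - (Q t - Q s) \<bullet> e)) {s..t})"
    if \<eta>: "\<eta> > 0" for e :: 'a and \<eta> :: real
  proof -
    \<comment> \<open>\<open>Q\<close> is continued to negative times as a constant, because
      \<open>bilipschitz_density\<close> asks for a function on the whole line.\<close>
    define G where "G t = (v * norm e + \<eta>) * t - Q (max 0 t) \<bullet> e" for t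
    have D: "\<bar>(Q (max 0 b) - Q (max 0 a)) \<bullet> e\<bar> \<le> v * norm e * (b - a)" if "a \<le> b" for a b
    proof -
      have "\<bar>(Q (max 0 b) - Q (max 0 a)) \<bullet> e\<bar> \<le> norm (Q (max 0 b) - Q (max 0 a)) * norm e"
        by (rule Cauchy_Schwarz_ineq2)
      also have "\<dots> \<le> (v * (max 0 b - max 0 a)) * norm e" using that by (intro mult_right_mono L) auto
      also have "\<dots> \<le> (v * (b - a)) * norm e" using that v by (intro mult_right_mono mult_left_mono) auto
      finally show ?thesis by (simp add: algebra_simps)
    qed
    have GG: "G b - G a = (v * norm e + \<eta>) * (b - a) - (Q (max 0 b) - Q (max 0 a)) \<bullet> e" for a b
      by (simp add: G_def algebra_simps)
    obtain k where k: "k \<in> borel_measurable borel" "\<And>x. 0 \<le> k x"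
      "\<And>a b. a \<le> b \<Longrightarrow> (k has_integral (G b - G a)) {a..b}"
    proof (rule bilipschitz_density[of \<eta> G "2 * v * norm e + \<eta>"])
      show "\<eta> * (b - a) \<le> G b - G a" if "a \<le> b" for a b
        using D[OF that] by (simp add: GG algebra_simps)
      show "G b - G a \<le> (2 * v * norm e + \<eta>) * (b - a)" if "a \<le> b" for a b
        using D[OF that] by (simp add: GG algebra_simps)
    qed (use \<eta> in auto)
    have "(k has_integral ((v * norm e + \<eta>) * (t - s) - (Q t - Q s) \<bullet> e)) {s..t}" if "0 \<le> s" "s \<le> t" for s t
      using k(3)[OF that(2)] that by (simp add: GG)
    then show ?thesis using k(1,2) by blast
  qed
  have "\<exists>f\<in>borel_measurable borel. \<forall>s t. 0 \<le> s \<longrightarrow> s \<le> t \<longrightarrow> (f has_integral ((Q t - Q s) \<bullet> e)) {s..t}" for e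
  proof -
    obtain k where k: "k \<in> borel_measurable borel" "\<And>s t. 0 \<le> s \<Longrightarrow> s \<le> t \<Longrightarrow>
       (k has_integral ((v * norm e + 1) * (t - s) - (Q t - Q s) \<bullet> e)) {s..t}"
      using ex[of 1 e] by auto
    have "((\<lambda>x. (v * norm e + 1) - k x) has_integral ((Q t - Q s) \<bullet> e)) {s..t}" if "0 \<le> s" "s \<le> t" for s t
      using has_integral_diff[OF has_integral_const_real[of "v * norm e + 1" s t] k(2)[OF that]] that
      by (simp add: algebra_simps)
    then show ?thesis using k(1) by (intro bexI[of _ "\<lambda>x. (v * norm e + 1) - k x"]) auto
  qed
  then obtain f where f: "\<And>e. f e \<in> borel_measurable borel"
    "\<And>e s t. 0 \<le> s \<Longrightarrow> s \<le> t \<Longrightarrow> (f e has_integral ((Q t - Q s) \<bullet> e)) {s..t}" by metis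
  define g where "g t = (\<Sum>b\<in>Basis. f b t *\<^sub>R b)" for t
  have gm[measurable]: "g \<in> borel_measurable borel" unfolding g_def using f(1) by measurable
  have gi: "(g has_integral (Q t - Q s)) {s..t}" if "0 \<le> s" "s \<le> t" for s t
  proof -
    have "(g has_integral (\<Sum>b\<in>Basis. ((Q t - Q s) \<bullet> b) *\<^sub>R b)) {s..t}"
      unfolding g_def by (intro has_integral_sum has_integral_scaleR_left f that) auto
    then show ?thesis by (simp add: euclidean_representation)
  qed
  \<comment> \<open>\<open>h\<close> below is the difference of two densities of the same function,
    hence 0 almost everywhere; the sign of \<open>k\<close> then bounds
    \<open>g t \<bullet> e\<close>.\<close>
  have ae1: "AE t in lebesgue. t \<in> {0..real m} \<longrightarrow> g t \<bullet> e \<le> v * norm e + 1 / real (Suc n)" for e m n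
  proof -
    obtain k where k: "\<And>x. 0 \<le> k x" "\<And>s t. 0 \<le> s \<Longrightarrow> s \<le> t \<Longrightarrow>
       (k has_integral ((v * norm e + 1 / real (Suc n)) * (t - s) - (Q t - Q s) \<bullet> e)) {s..t}"
      using ex[of "1 / real (Suc n)" e] by auto
    define h where "h t = (v * norm e + 1 / real (Suc n)) - g t \<bullet> e - k t" for t
    have hi: "(h has_integral 0) {0..s}" if "0 \<le> s" for s
    proof -
      have "((\<lambda>t. g t \<bullet> e) has_integral ((Q s - Q 0) \<bullet> e)) {0..s}"
        using has_integral_linear[OF gi[of 0 s] bounded_linear_inner_left[of e]] that by (simp add: o_def)
      from has_integral_diff[OF has_integral_diff[OF has_integral_const_real[of "v * norm e + 1 / real (Suc n)" 0 s] this] k(2)[of 0 s]]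
      show ?thesis unfolding h_def using that by (simp add: algebra_simps)
    qed
    have "AE s in lebesgue. s \<in> {0..real m} \<longrightarrow> h s = 0"
      by (rule AE_zero_of_integral_zero) (use hi in \<open>auto simp: integrable_on_def integral_unique intro!: exI[of _ 0]\<close>)
    then show ?thesis
    proof eventually_elim
      case (elim t)
      then show ?case using k(1)[of t] by (auto simp: h_def)
    qed
  qed
  obtain D :: "'a set" where D: "countable D" "\<And>X. open X \<Longrightarrow> X \<noteq> {} \<Longrightarrow> \<exists>d\<in>D. d \<in> X"
    by (rule countable_dense_setE) blast
  have "AE t in lebesgue. \<forall>e\<in>D. \<forall>m n. t \<in> {0..real m} \<longrightarrow> g t \<bullet> e \<le> v * norm e + 1 / real (Suc n)"
    by (intro AE_ball_countable[OF D(1), THEN iffD2] ballI AE_all_countable[THEN iffD2] allI ae1)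
  then have bd: "AE t in lebesgue. 0 \<le> t \<longrightarrow> norm (g t) \<le> v"
  proof eventually_elim
    case (elim t)
    show ?case
    proof
      assume t: "0 \<le> t"
      obtain m where m: "t \<le> real m" using real_arch_simple by blast
      have 1: "g t \<bullet> e \<le> v * norm e" if "e \<in> D" for e
      proof (rule field_le_epsilon)
        fix d :: real assume "d > 0"
        then obtain n where "1 / real (Suc n) < d" using nat_approx_posE by blast
        moreover have "g t \<bullet> e \<le> v * norm e + 1 / real (Suc n)" using elim that t m by auto
        ultimately show "g t \<bullet> e \<le> v * norm e + d" by linarith
      qed
      have "closed {e. g t \<bullet> e \<le> v * norm e}" by (intro closed_Collect_le continuous_intros)
      moreover have "closure D = UNIV"
      proof -
        have "\<exists>y\<in>D. dist y x < r" if "0 < r" for x r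
          using D(2)[of "ball x r"] that by (auto simp: dist_commute)
        then show ?thesis unfolding set_eq_iff closure_approachable by blast
      qed
      \<comment> \<open>By density the bound holds for all \<open>e\<close>, in particular for
        \<open>e = g t\<close>.\<close>
      ultimately have "g t \<in> {e. g t \<bullet> e \<le> v * norm e}" using 1 closure_minimal[of D "{e. g t \<bullet> e \<le> v * norm e}"] by blast
      then have "norm (g t) * norm (g t) \<le> v * norm (g t)" by (simp add: dot_square_norm power2_eq_square)
      then show "norm (g t) \<le> v" using v by (cases "g t = 0") auto
    qed
  qed
  define g' where "g' t = (if norm (g t) \<le> v then g t else 0)" for t
  have "g' \<in> borel_measurable borel" unfolding g'_def by measurable
  moreover have "norm (g' t) \<le> v" for t using v by (simp add: g'_def)
  moreover have "(g' has_integral (Q t - Q s)) {s..t}" if "0 \<le> s" "s \<le> t" for s t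
  proof (rule has_integral_spike)
    show "negligible {t. \<not> (0 \<le> t \<longrightarrow> norm (g t) \<le> v)}"
      using bd unfolding eventually_ae_filter_negligible by (blast intro: negligible_subset)
  qed (use gi[OF that] that in \<open>auto simp: g'_def\<close>)
  ultimately show ?thesis by (rule that)
qed

section \<open>Trajectories and controls\<close>

lemma integrable_on_unit_control:
  fixes u :: "real \<Rightarrow> 'a::euclidean_space"
  assumes "u \<in> borel_measurable lebesgue" "\<And>t. norm (u t) = 1"
  shows "u integrable_on {a..b}"
  by (rule measurable_bounded_by_integrable_imp_integrable[where g = "\<lambda>_. 1"])
    (use assms in \<open>auto simp: measurable_restrict_space1\<close>)

lemma admissible_integrable:
  assumes "u \<in> admissible D v x0"
  shows "u integrable_on {a..b}"
  using assms by (intro integrable_on_unit_control) (auto simp: admissible_def)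

lemma traj_0 [simp]: "traj v x0 u 0 = x0"
  by (simp add: traj_def)

lemma traj_diff:
  assumes "u integrable_on {0..t}" "0 \<le> s" "s \<le> t"
  shows "traj v x0 u t - traj v x0 u s = v *\<^sub>R integral {s..t} u"
proof -
  have "integral {0..s} u + integral {s..t} u = integral {0..t} u"
    by (rule Henstock_Kurzweil_Integration.integral_combine) (use assms in auto)
  then show ?thesis by (simp add: traj_def algebra_simps flip: scaleR_add_right)
qed

lemma traj_lipschitz:
  assumes u: "u \<in> borel_measurable lebesgue" "\<And>t. norm (u t) = 1" and v: "0 \<le> v"
  shows "v-lipschitz_on {0..} (traj v x0 u)"
proof (rule lipschitz_on_leI)
  fix s t :: real assume st: "s \<in> {0..}" "t \<in> {0..}" "s \<le> t"
  have "norm (integral {s..t} u) \<le> integral {s..t} (\<lambda>_. 1)"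
    by (rule integral_norm_bound_integral) (use u in \<open>auto intro: integrable_on_unit_control\<close>)
  then have "norm (traj v x0 u t - traj v x0 u s) \<le> v * (t - s)"
    using st v by (subst traj_diff) (auto intro: integrable_on_unit_control u mult_left_mono)
  then show "dist (traj v x0 u s) (traj v x0 u t) \<le> v * dist s t"
    using st by (simp add: dist_norm norm_minus_commute)
qed (use v in auto)

lemma traj_cong_AE:
  assumes "AE r in lebesgue. r \<in> {0..t} \<longrightarrow> u r = u' r" "s \<le> t"
  shows "traj v x0 u s = traj v x0 u' s"
proof -
  obtain N where N: "negligible N" "{r. \<not> (r \<in> {0..t} \<longrightarrow> u r = u' r)} \<subseteq> N"
    using assms(1) unfolding eventually_ae_filter_negligible by blast
  have "integral {0..s} u = integral {0..s} u'"
    by (rule integral_spike[OF N(1)]) (use N(2) assms(2) in force)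
  then show ?thesis by (simp add: traj_def)
qed

text \<open>Converse of \<open>traj_cong_AE\<close>. The pursuers' controls are picked by choice
  from their paths, so non-anticipativity is proved for paths and has to be carried back to
  controls.\<close>

lemma AE_eq_of_traj_eq:
  assumes u: "u integrable_on {0..t}" "u' integrable_on {0..t}" and v: "v \<noteq> 0"
    and eq: "\<And>s. s \<in> {0..t} \<Longrightarrow> traj v x0 u s = traj v x0 u' s"
  shows "AE r in lebesgue. r \<in> {0..t} \<longrightarrow> u r = u' r"
proof -
  have "AE r in lebesgue. r \<in> {0..t} \<longrightarrow> u r - u' r = 0"
  proof (rule AE_zero_of_integral_zero)
    fix s assume s: "s \<in> {0..t}"
    have "integral {0..s} u = integral {0..s} u'" using eq[OF s] v by (simp add: traj_def)
    then show "integral {0..s} (\<lambda>r. u r - u' r) = 0"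
      using u s by (subst integral_diff) (auto intro: integrable_on_subinterval)
  qed (use u in \<open>auto intro: integrable_diff\<close>)
  then show ?thesis by eventually_elim auto
qed

section \<open>Switching, realizing and prolonging controls\<close>

definition splice :: "real \<Rightarrow> (real \<Rightarrow> 'a) \<Rightarrow> (real \<Rightarrow> 'a) \<Rightarrow> real \<Rightarrow> 'a" where
  "splice \<tau> u c t = (if t < \<tau> then u t else c (t - \<tau>))"

lemma splice_measurable:
  fixes u :: "real \<Rightarrow> 'a::euclidean_space"
  assumes "u \<in> borel_measurable lebesgue" "c \<in> borel_measurable lebesgue"
  shows "splice \<tau> u c \<in> borel_measurable lebesgue"
proof -
  have "(\<lambda>t. c (t - \<tau>)) \<in> borel_measurable lebesgue"
  proof -
    have "(\<lambda>t::real. (-\<tau>) + t) \<in> lebesgue \<rightarrow>\<^sub>M lebesgue"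
      using lebesgue_affine_measurable[where c = "\<lambda>_::real. 1" and t = "-\<tau>"] by simp
    from measurable_compose[OF this assms(2)] show ?thesis by simp
  qed
  moreover have "{t. t < \<tau>} \<in> sets lebesgue" by simp
  ultimately show ?thesis unfolding splice_def using assms(1)
    by (intro measurable_If) (auto simp: lessThan_def[symmetric])
qed

lemma traj_splice_before:
  assumes "s \<le> \<tau>"
  shows "traj v x0 (splice \<tau> u c) s = traj v x0 u s"
proof -
  have "integral {0..s} (splice \<tau> u c) = integral {0..s} u"
    by (rule integral_spike[of "{\<tau>}"]) (use assms in \<open>auto simp: splice_def\<close>)
  then show ?thesis by (simp add: traj_def)
qed

lemma traj_splice_after:
  assumes u: "u integrable_on {0..\<tau>}" and c: "c integrable_on {0..t - \<tau>}" and t: "0 \<le> \<tau>" "\<tau> \<le> t"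
  shows "traj v x0 (splice \<tau> u c) t = traj v (traj v x0 u \<tau>) c (t - \<tau>)"
proof -
  have 1: "(splice \<tau> u c has_integral integral {0..\<tau>} u) {0..\<tau>}"
    by (rule has_integral_spike[of "{\<tau>}" _ _ u]) (use u in \<open>auto simp: splice_def\<close>)
  have "((\<lambda>x. c (x + - \<tau>)) has_integral integral {0..t-\<tau>} c) {0 - (-\<tau>)..(t - \<tau>) - (-\<tau>)}"
    by (rule has_integral_shift_real_ivl) (use c in auto)
  then have "((\<lambda>x. c (x + - \<tau>)) has_integral integral {0..t-\<tau>} c) {\<tau>..t}" by simp
  then have 2: "(splice \<tau> u c has_integral integral {0..t-\<tau>} c) {\<tau>..t}"
    by (rule has_integral_eq[of _ "\<lambda>x. c (x + - \<tau>)", rotated]) (auto simp: splice_def)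
  have "(splice \<tau> u c has_integral integral {0..\<tau>} u + integral {0..t-\<tau>} c) {0..t}"
    by (rule has_integral_combine[OF t 1 2])
  then show ?thesis by (simp add: traj_def integral_unique scaleR_add_right)
qed

lemma splice_admissible:
  assumes u: "u \<in> borel_measurable lebesgue" "\<And>t. norm (u t) = 1"
    and D: "\<And>t. t \<in> {0..\<tau>} \<Longrightarrow> traj v x0 u t \<in> D"
    and c: "c \<in> admissible D v (traj v x0 u \<tau>)" and \<tau>: "0 \<le> \<tau>"
  shows "splice \<tau> u c \<in> admissible D v x0"
proof -
  have "traj v x0 (splice \<tau> u c) t \<in> D" if "t \<ge> 0" for t
  proof (cases "t \<le> \<tau>")
    case True
    then show ?thesis using D that by (simp add: traj_splice_before)
  next
    case False
    then show ?thesis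
      using c \<tau> u admissible_integrable[OF c]
      by (subst traj_splice_after) (auto simp: admissible_def integrable_on_unit_control)
  qed
  moreover have "norm (splice \<tau> u c t) = 1" for t
    using u c by (auto simp: splice_def admissible_def)
  moreover have "splice \<tau> u c \<in> borel_measurable lebesgue"
    using u c by (intro splice_measurable) (auto simp: admissible_def)
  ultimately show ?thesis by (simp add: admissible_def)
qed

lemma realize_unit_speed:
  fixes Q :: "real \<Rightarrow> real^2"
  assumes g: "g \<in> borel_measurable borel"
    and gi: "\<And>t. t \<in> {0..\<tau>} \<Longrightarrow> (g has_integral (Q t - Q 0)) {0..t}"
    and sp: "AE t in lebesgue. t \<in> {0..\<tau>} \<longrightarrow> norm (g t) = v" and v: "0 < v"
  shows "\<exists>u. u \<in> borel_measurable lebesgue \<and> (\<forall>t. norm (u t) = 1) \<and> (\<forall>t\<in>{0..\<tau>}. traj v (Q 0) u t = Q t)"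
proof -
  \<comment> \<open>\<open>axis 1 1\<close> is an arbitrary unit vector for the times with another
    speed, a null set within \<open>{0..\<tau>}\<close>: \<open>admissible\<close> asks for norm 1
    at every time.\<close>
  define u :: "real \<Rightarrow> real^2" where "u t = (if norm (g t) = v then (1/v) *\<^sub>R g t else axis 1 1)" for t
  have gm: "g \<in> borel_measurable lebesgue" using g by (simp add: borel_measurable_if_D measurable_completion)
  have "u \<in> borel_measurable lebesgue" unfolding u_def using gm by measurable
  moreover have "norm (u t) = 1" for t using v by (simp add: u_def)
  moreover have "traj v (Q 0) u t = Q t" if "t \<in> {0..\<tau>}" for t
  proof -
    obtain N where N: "negligible N" "{t. \<not> (t \<in> {0..\<tau>} \<longrightarrow> norm (g t) = v)} \<subseteq> N"
      using sp unfolding eventually_ae_filter_negligible by blast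
    have "((\<lambda>t. (1/v) *\<^sub>R g t) has_integral (1/v) *\<^sub>R (Q t - Q 0)) {0..t}"
      by (rule has_integral_cmul[OF gi[OF that]])
    then have "(u has_integral (1/v) *\<^sub>R (Q t - Q 0)) {0..t}"
      by (rule has_integral_spike[OF N(1), rotated]) (use N(2) that in \<open>force simp: u_def\<close>)
    then show ?thesis using v by (simp add: traj_def integral_unique)
  qed
  ultimately show ?thesis by blast
qed

text \<open>Unit speed forbids standing still, so the player runs to and fro on the segment. Its
  position is a triangle wave, written as \<open>arccos (cos (b * t)) / b\<close>, whose derivative
  is the sign of \<open>sin (b * t)\<close>.\<close>

lemma keep_moving_segment:
  fixes y e :: "real^2"
  assumes ye: "y \<noteq> e" and v: "0 < v"
  shows "\<exists>c. c \<in> admissible (closed_segment y e) v y"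
proof -
  define L where "L = norm (e - y)"
  have L: "L > 0" using ye by (simp add: L_def)
  define w where "w = (1/L) *\<^sub>R (e - y)"
  have w: "norm w = 1" "L *\<^sub>R w = e - y" using L by (auto simp: w_def L_def)
  \<comment> \<open>One traversal takes the time \<open>pi / b\<close>, which is
    \<open>L / v\<close>.\<close>
  define b where "b = v * pi / L"
  have b: "b > 0" using v L by (simp add: b_def)
  define c where "c t = (if sin (b * t) \<ge> 0 then w else - w)" for t
  have int: "((\<lambda>t. if sin (b * t) \<ge> 0 then 1 else -1) has_integral (arccos (cos (b * t)) / b)) {0..t}" if t: "t \<ge> 0" for t
  proof -
    have "((\<lambda>t. if sin (b * t) \<ge> 0 then 1 else -1) has_integral (arccos (cos (b * t)) / b - arccos (cos (b * 0)) / b)) {0..t}"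
    proof (rule fundamental_theorem_of_calculus_interior_strong)
      \<comment> \<open>The kinks of the wave: all zeros of \<open>sin (b * t)\<close> inside the
        interval have this form.\<close>
      show "finite ((\<lambda>i. real_of_int i * pi / b) ` {0..\<lceil>b * t / pi\<rceil>})" by simp
      show "continuous_on {0..t} (\<lambda>t. arccos (cos (b * t)) / b)"
        using b by (intro continuous_intros) auto
      fix x assume x: "x \<in> {0<..<t} - (\<lambda>i. real_of_int i * pi / b) ` {0..\<lceil>b * t / pi\<rceil>}"
      have nz: "sin (b * x) \<noteq> 0"
      proof
        assume "sin (b * x) = 0"
        then obtain i :: int where i: "b * x = real_of_int i * pi" by (auto simp: sin_zero_iff_int2)
        then have xi: "x = real_of_int i * pi / b" using b by (simp add: field_simps)
        have "0 < x" "x < t" using x by auto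
        then have "0 < b * x" "b * x < b * t" using b by auto
        then have "0 < real_of_int i * pi" "real_of_int i * pi < b * t" by (simp_all only: i)
        then have "0 < real_of_int i" "real_of_int i < b * t / pi" using pi_gt_zero
          by (auto simp: pos_less_divide_eq zero_less_mult_iff)
        then have "i \<in> {0..\<lceil>b * t / pi\<rceil>}" by (auto simp: le_ceiling_iff intro: less_imp_le)
        then show False using x xi by blast
      qed
      have cs: "\<bar>cos (b * x)\<bar> < 1" unfolding abs_square_less_1[symmetric] cos_squared_eq using nz by simp
      have s: "sqrt (1 - (cos (b * x))\<^sup>2) = \<bar>sin (b * x)\<bar>" by (simp add: flip: sin_squared_eq)
      have "((\<lambda>t. arccos (cos (b * t)) / b) has_real_derivative (inverse (- sqrt (1 - (cos (b * x))\<^sup>2)) * (- sin (b * x) * b)) / b) (at x)"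
        using cs b by (auto intro!: derivative_eq_intros)
      also have "(inverse (- sqrt (1 - (cos (b * x))\<^sup>2)) * (- sin (b * x) * b)) / b = (if sin (b * x) \<ge> 0 then 1 else -1)"
        using nz b unfolding s by (auto simp: field_simps)
      finally show "((\<lambda>t. arccos (cos (b * t)) / b) has_vector_derivative (if sin (b * x) \<ge> 0 then 1 else -1)) (at x)"
        by (simp add: has_real_derivative_iff_has_vector_derivative)
    qed (use t in auto)
    then show ?thesis by simp
  qed
  have "traj v y c t \<in> closed_segment y e" if t: "t \<ge> 0" for t
  proof -
    have "((\<lambda>t. (if sin (b * t) \<ge> 0 then 1 else -1) *\<^sub>R w) has_integral (arccos (cos (b * t)) / b) *\<^sub>R w) {0..t}"
      by (rule has_integral_scaleR_left[OF int[OF t]])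
    then have "(c has_integral (arccos (cos (b * t)) / b) *\<^sub>R w) {0..t}"
      by (rule has_integral_eq[rotated]) (simp add: c_def)
    then have "traj v y c t = y + (v * (arccos (cos (b * t)) / b)) *\<^sub>R w" by (simp add: traj_def integral_unique)
    also have "v * (arccos (cos (b * t)) / b) = (arccos (cos (b * t)) / pi) * L" using v L by (simp add: b_def)
    also have "y + ((arccos (cos (b * t)) / pi) * L) *\<^sub>R w = (1 - arccos (cos (b * t)) / pi) *\<^sub>R y + (arccos (cos (b * t)) / pi) *\<^sub>R e"
    proof -
      have "e = y + L *\<^sub>R w" using w(2) by simp
      then show ?thesis by (simp add: algebra_simps)
    qed
    finally show ?thesis
      by (auto simp: closed_segment_def arccos_lbound arccos_ubound intro!: exI[of _ "arccos (cos (b * t)) / pi"])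
  qed
  moreover have "c \<in> borel_measurable borel" unfolding c_def by measurable
  then have "c \<in> borel_measurable lebesgue" by (simp add: measurable_completion)
  moreover have "norm (c t) = 1" for t using w by (simp add: c_def)
  ultimately show ?thesis by (auto simp: admissible_def)
qed

lemma keep_moving:
  assumes D: "convex D" "e0 \<in> D" "e1 \<in> D" "e0 \<noteq> e1" and y: "y \<in> D" and v: "0 < v"
  shows "\<exists>c. c \<in> admissible D v y"
proof -
  obtain e where e: "e \<in> D" "y \<noteq> e" using D by blast
  obtain c where "c \<in> admissible (closed_segment y e) v y" using keep_moving_segment[OF e(2) v] by blast
  moreover have "closed_segment y e \<subseteq> D" using D(1) y e(1) by (rule closed_segment_subset[rotated 2])
  ultimately show ?thesis by (auto simp: admissible_def)
qed

section \<open>Turning a Lipschitz guide into a full-speed pursuer\<close>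

text \<open>\<open>leads v E \<gamma> t\<close> are the factors by which a pursuer can shrink its distance to the evader \<open>E\<close>, compared
  with the guide \<open>\<gamma>\<close>, up to time \<open>t\<close> without exceeding the speed \<open>v\<close>; \<open>lead\<close> is the best of them. As
  \<open>lead v E \<gamma> t\<close> depends only on the paths up to time \<open>t\<close>, the resulting strategy is non-anticipative.\<close>

definition shrink :: "(real \<Rightarrow> 'a::euclidean_space) \<Rightarrow> (real \<Rightarrow> 'a) \<Rightarrow> (real \<Rightarrow> real) \<Rightarrow> real \<Rightarrow> 'a" where
  "shrink E \<gamma> m t = E t + m t *\<^sub>R (\<gamma> t - E t)"

definition leads :: "real \<Rightarrow> (real \<Rightarrow> 'a::euclidean_space) \<Rightarrow> (real \<Rightarrow> 'a) \<Rightarrow> real \<Rightarrow> (real \<Rightarrow> real) set" where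
  "leads v E \<gamma> t = {m. m 0 = 1 \<and> (\<forall>s\<in>{0..t}. 0 \<le> m s \<and> m s \<le> 1) \<and> v-lipschitz_on {0..t} (shrink E \<gamma> m)}"

definition lead :: "real \<Rightarrow> (real \<Rightarrow> 'a::euclidean_space) \<Rightarrow> (real \<Rightarrow> 'a) \<Rightarrow> real \<Rightarrow> real" where
  "lead v E \<gamma> t = (INF m\<in>leads v E \<gamma> t. m t)"

lemma lead_cong:
  assumes "\<And>s. s \<in> {0..t} \<Longrightarrow> E s = E' s" "\<And>s. s \<in> {0..t} \<Longrightarrow> \<gamma> s = \<gamma>' s"
  shows "lead v E \<gamma> t = lead v E' \<gamma>' t"
proof -
  have "v-lipschitz_on {0..t} (shrink E \<gamma> m) \<longleftrightarrow> v-lipschitz_on {0..t} (shrink E' \<gamma>' m)" for m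
    by (rule lipschitz_on_cong) (auto simp: shrink_def assms)
  then have "leads v E \<gamma> t = leads v E' \<gamma>' t" by (simp add: leads_def)
  then show ?thesis by (simp add: lead_def)
qed

text \<open>Concavity of the logarithm. The smaller argument appears because
  \<open>tail_in_leads\<close> weighs a change of the factor with the smaller of two gaps.\<close>

lemma ln_diff_mult_min:
  fixes x y :: real
  assumes "0 < x" "0 < y"
  shows "\<bar>ln x - ln y\<bar> * min x y \<le> \<bar>x - y\<bar>"
proof (cases "x \<le> y")
  case True
  have "ln y - ln x \<le> (y - x) / x" using assms by (intro ln_diff_le) auto
  then have "(ln y - ln x) * x \<le> y - x" using assms by (simp add: pos_le_divide_eq)
  then show ?thesis using True assms by (simp add: min_def abs_if)
next
  case False
  have "ln x - ln y \<le> (x - y) / y" using assms by (intro ln_diff_le) auto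
  then have "(ln x - ln y) * y \<le> x - y" using assms by (simp add: pos_le_divide_eq)
  then show ?thesis using False assms by (simp add: min_def abs_if)
qed

locale tracking =
  fixes E \<gamma> :: "real \<Rightarrow> 'a::euclidean_space" and w v :: real
  assumes w: "0 \<le> w" "w < v"
    and E_lip: "w-lipschitz_on {0..} E" and \<gamma>_lip: "v-lipschitz_on {0..} \<gamma>"
begin

abbreviation "Q \<equiv> shrink E \<gamma> (lead v E \<gamma>)"

lemma E_norm: "norm (E s - E r) \<le> w * (s - r)" if "0 \<le> r" "r \<le> s" for r s
  using lipschitz_on_normD[OF E_lip, of s r] that by simp

lemma \<gamma>_norm: "norm (\<gamma> s - \<gamma> r) \<le> v * (s - r)" if "0 \<le> r" "r \<le> s" for r s
  using lipschitz_on_normD[OF \<gamma>_lip, of s r] that by simp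

lemma one_in_leads: "(\<lambda>_. 1) \<in> leads v E \<gamma> t"
proof -
  have "v-lipschitz_on {0..t} \<gamma>" using \<gamma>_lip by (rule lipschitz_on_subset) auto
  then show ?thesis by (simp add: leads_def shrink_def cong: lipschitz_on_cong)
qed

lemma bdd_leads: "0 \<le> t \<Longrightarrow> bdd_below ((\<lambda>m. m t) ` leads v E \<gamma> t)"
  by (rule bdd_belowI[of _ 0]) (auto simp: leads_def)

lemma lead_le: "m \<in> leads v E \<gamma> t \<Longrightarrow> 0 \<le> t \<Longrightarrow> lead v E \<gamma> t \<le> m t"
  unfolding lead_def by (rule cINF_lower[OF bdd_leads]) auto

lemma lead_nonneg: "0 \<le> t \<Longrightarrow> 0 \<le> lead v E \<gamma> t"
  unfolding lead_def by (rule cINF_greatest) (use one_in_leads in \<open>auto simp: leads_def\<close>)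

lemma lead_le_1: "0 \<le> t \<Longrightarrow> lead v E \<gamma> t \<le> 1"
  using lead_le[OF one_in_leads] .

lemma lead_0: "lead v E \<gamma> 0 = 1"
proof -
  have "(\<lambda>m. m 0) ` leads v E \<gamma> 0 = {1::real}" using one_in_leads[of 0] by (auto simp: leads_def)
  then show ?thesis by (simp add: lead_def)
qed

lemma leads_near:
  assumes "0 \<le> t" "0 < e"
  obtains m where "m \<in> leads v E \<gamma> t" "m t < lead v E \<gamma> t + e"
proof -
  have "(INF m\<in>leads v E \<gamma> t. m t) < lead v E \<gamma> t + e" using assms by (simp add: lead_def)
  then show ?thesis using that one_in_leads bdd_leads[OF assms(1)] by (subst (asm) cINF_less_iff) auto
qed

lemma leads_mono: "m \<in> leads v E \<gamma> t \<Longrightarrow> s \<le> t \<Longrightarrow> m \<in> leads v E \<gamma> s"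
  unfolding leads_def by (auto intro: lipschitz_on_subset)

text \<open>With a frozen factor the path is a fixed convex combination of \<open>E\<close> and
  \<open>\<gamma>\<close>, neither of them faster than \<open>v\<close>.\<close>

lemma leads_extend:
  assumes m: "m \<in> leads v E \<gamma> s" and st: "0 \<le> s" "s \<le> t"
  shows "(\<lambda>r. m (min r s)) \<in> leads v E \<gamma> t"
proof -
  have ms: "0 \<le> m s" "m s \<le> 1" using m st by (auto simp: leads_def)
  have "v-lipschitz_on {s..t} (\<lambda>r. E r + m s *\<^sub>R (\<gamma> r - E r))"
  proof (rule lipschitz_on_leI)
    fix p q assume pq: "p \<in> {s..t}" "q \<in> {s..t}" "p \<le> q"
    have "(E q + m s *\<^sub>R (\<gamma> q - E q)) - (E p + m s *\<^sub>R (\<gamma> p - E p)) = (1 - m s) *\<^sub>R (E q - E p) + m s *\<^sub>R (\<gamma> q - \<gamma> p)"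
      by (simp add: algebra_simps)
    also have "norm \<dots> \<le> (1 - m s) * norm (E q - E p) + m s * norm (\<gamma> q - \<gamma> p)"
      using ms by (intro order_trans[OF norm_triangle_ineq]) auto
    also have "\<dots> \<le> (1 - m s) * (v * (q - p)) + m s * (v * (q - p))"
    proof (intro add_mono mult_left_mono)
      have "w * (q - p) \<le> v * (q - p)" using w pq by (intro mult_right_mono) auto
      then show "norm (E q - E p) \<le> v * (q - p)" using E_norm[of p q] pq st by auto
    qed (use ms \<gamma>_norm pq st in auto)
    finally show "dist (E p + m s *\<^sub>R (\<gamma> p - E p)) (E q + m s *\<^sub>R (\<gamma> q - E q)) \<le> v * dist p q"
      using pq by (simp add: dist_norm norm_minus_commute algebra_simps)
  qed (use w in auto)
  moreover have "v-lipschitz_on {0..s} (shrink E \<gamma> m)" using m by (simp add: leads_def)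
  ultimately have "v-lipschitz_on {0..t} (\<lambda>r. if r \<le> s then shrink E \<gamma> m r else E r + m s *\<^sub>R (\<gamma> r - E r))"
    by (intro lipschitz_on_concat) (auto simp: shrink_def)
  moreover have "(\<lambda>r. if r \<le> s then shrink E \<gamma> m r else E r + m s *\<^sub>R (\<gamma> r - E r)) = shrink E \<gamma> (\<lambda>r. m (min r s))"
    by (auto simp: shrink_def min_def)
  ultimately have "v-lipschitz_on {0..t} (shrink E \<gamma> (\<lambda>r. m (min r s)))" by (simp only:)
  then show ?thesis using m st by (auto simp: leads_def)
qed

text \<open>Between two times at which different factors are the smaller one, the two paths meet on
  the segment from \<open>E\<close> to \<open>\<gamma>\<close>; the Lipschitz estimate is split at
  that moment.\<close>

lemma leads_min:
  assumes m1: "m1 \<in> leads v E \<gamma> t" and m2: "m2 \<in> leads v E \<gamma> t"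
  shows "(\<lambda>r. min (m1 r) (m2 r)) \<in> leads v E \<gamma> t"
proof -
  let ?m = "\<lambda>r. min (m1 r) (m2 r)"
  have Ec: "continuous_on {0..t} E"
    using lipschitz_on_continuous_on[OF E_lip] by (rule continuous_on_subset) auto
  have key: "norm (shrink E \<gamma> b s - shrink E \<gamma> a r) \<le> v * (s - r)"
    if a: "a \<in> leads v E \<gamma> t" and b: "b \<in> leads v E \<gamma> t" and rs: "0 \<le> r" "r \<le> s" "s \<le> t"
      and c: "a r \<le> b r" "b s \<le> a s" for a b r s
  proof -
    have La: "v-lipschitz_on {0..t} (shrink E \<gamma> a)" and Lb: "v-lipschitz_on {0..t} (shrink E \<gamma> b)"
      using a b by (auto simp: leads_def)
    have ab: "0 \<le> a q" "0 \<le> b q" if "q \<in> {0..t}" for q using a b that by (auto simp: leads_def)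
    \<comment> \<open>Distances to \<open>E\<close> are compared, not the factors: only the paths
      are known to be continuous.\<close>
    define f where "f q = norm (shrink E \<gamma> b q - E q) - norm (shrink E \<gamma> a q - E q)" for q
    have f: "f q = (b q - a q) * norm (\<gamma> q - E q)" if "q \<in> {0..t}" for q
      using ab[OF that] by (simp add: f_def shrink_def left_diff_distrib)
    have "continuous_on {r..s} f" unfolding f_def
      using rs by (intro continuous_intros continuous_on_subset[OF lipschitz_on_continuous_on[OF La]]
         continuous_on_subset[OF lipschitz_on_continuous_on[OF Lb]] continuous_on_subset[OF Ec]) auto
    moreover have "f s \<le> 0" "0 \<le> f r" using f[of s] f[of r] rs c by (auto intro: mult_nonpos_nonneg)
    ultimately obtain q where q: "r \<le> q" "q \<le> s" "f q = 0" using IVT2'[of f s 0 r] rs by auto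
    then have "shrink E \<gamma> a q = shrink E \<gamma> b q" using f[of q] rs by (auto simp: shrink_def)
    then have "norm (shrink E \<gamma> b s - shrink E \<gamma> a r) \<le>
       norm (shrink E \<gamma> b s - shrink E \<gamma> b q) + norm (shrink E \<gamma> a q - shrink E \<gamma> a r)"
      by (metis norm_triangle_sub norm_triangle_ineq diff_add_cancel add_diff_eq)
    also have "\<dots> \<le> v * (s - q) + v * (q - r)"
      using lipschitz_on_normD[OF Lb, of s q] lipschitz_on_normD[OF La, of q r] q rs by auto
    finally show ?thesis by (simp add: algebra_simps)
  qed
  have "v-lipschitz_on {0..t} (shrink E \<gamma> ?m)"
  proof (rule lipschitz_on_leI)
    fix r s assume rs: "r \<in> {0..t}" "s \<in> {0..t}" "r \<le> s"
    have sh: "shrink E \<gamma> ?m q = (if m1 q \<le> m2 q then shrink E \<gamma> m1 q else shrink E \<gamma> m2 q)" for q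
      by (simp add: shrink_def min_def)
    have same: "norm (shrink E \<gamma> a s - shrink E \<gamma> a r) \<le> v * (s - r)" if "a \<in> leads v E \<gamma> t" for a
      using that rs lipschitz_on_normD[of v "{0..t}" "shrink E \<gamma> a" s r] by (auto simp: leads_def)
    have "norm (shrink E \<gamma> ?m s - shrink E \<gamma> ?m r) \<le> v * (s - r)"
      using same[OF m1] same[OF m2] key[OF m1 m2, of r s] key[OF m2 m1, of r s] rs
      unfolding sh by auto
    then show "dist (shrink E \<gamma> ?m r) (shrink E \<gamma> ?m s) \<le> v * dist r s"
      using rs by (simp add: dist_norm norm_minus_commute)
  qed (use w in auto)
  then show ?thesis using m1 m2 by (auto simp: leads_def min_def)
qed

text \<open>The infimum is taken separately at each time. For two given times one competitor is
  nearly optimal at both: the minimum of one that is good at \<open>t\<close> and one that is good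
  at \<open>s\<close> and frozen afterwards.\<close>

lemma Q_lip: "v-lipschitz_on {0..} Q"
proof (rule lipschitz_on_leI)
  fix s t :: real assume st: "s \<in> {0..}" "t \<in> {0..}" "s \<le> t"
  let ?l = "lead v E \<gamma>"
  have "norm (Q t - Q s) \<le> v * (t - s)"
  proof (rule field_le_epsilon)
    fix d :: real assume d: "0 < d"
    \<comment> \<open>\<open>B\<close> turns an error of the factor into an error of position; the
      summand 1 keeps it positive.\<close>
    define B where "B = norm (\<gamma> t - E t) + norm (\<gamma> s - E s) + 1"
    have B: "0 < B" by (simp add: B_def add_nonneg_pos)
    define e where "e = d / B"
    have e: "0 < e" using d B by (simp add: e_def)
    obtain m1 where m1: "m1 \<in> leads v E \<gamma> s" "m1 s < ?l s + e" using leads_near[of s e] st e by auto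
    obtain m2 where m2: "m2 \<in> leads v E \<gamma> t" "m2 t < ?l t + e" using leads_near[of t e] st e by auto
    define m where "m r = min (m1 (min r s)) (m2 r)" for r
    have m: "m \<in> leads v E \<gamma> t"
      unfolding m_def using st by (intro leads_min leads_extend m1 m2) auto
    have bs: "\<bar>m s - ?l s\<bar> \<le> e" using lead_le[OF leads_mono[OF m, of s]] st m1(2) by (auto simp: m_def)
    have bt: "\<bar>m t - ?l t\<bar> \<le> e" using lead_le[OF m] st m2(2) by (auto simp: m_def)
    have "Q t - Q s = (shrink E \<gamma> m t - shrink E \<gamma> m s) + (- ((m t - ?l t) *\<^sub>R (\<gamma> t - E t)) + (m s - ?l s) *\<^sub>R (\<gamma> s - E s))"
      by (simp add: shrink_def algebra_simps)
    also have "norm \<dots> \<le> norm (shrink E \<gamma> m t - shrink E \<gamma> m s) + (\<bar>m t - ?l t\<bar> * norm (\<gamma> t - E t) + \<bar>m s - ?l s\<bar> * norm (\<gamma> s - E s))"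
      by (intro order_trans[OF norm_triangle_ineq] add_mono order_refl) (auto intro: order_trans[OF norm_triangle_ineq])
    also have "\<dots> \<le> v * (t - s) + (e * norm (\<gamma> t - E t) + e * norm (\<gamma> s - E s))"
      using m st bs bt lipschitz_on_normD[of v "{0..t}" "shrink E \<gamma> m" t s]
      by (intro add_mono mult_right_mono) (auto simp: leads_def)
    also have "\<dots> \<le> v * (t - s) + e * B" using e by (simp add: B_def algebra_simps)
    finally show "norm (Q t - Q s) \<le> v * (t - s) + d" using B by (simp add: e_def)
  qed
  then show "dist (Q s) (Q t) \<le> v * dist s t" using st by (simp add: dist_norm norm_minus_commute)
qed (use w in auto)

lemma Q_0: "Q 0 = \<gamma> 0"
  by (simp add: shrink_def lead_0)

lemma Q_captured: "m \<in> leads v E \<gamma> t \<Longrightarrow> 0 \<le> t \<Longrightarrow> m t = 0 \<Longrightarrow> Q t = E t"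
  using lead_le[of m t] lead_nonneg[of t] by (simp add: shrink_def)

text \<open>If \<open>Q\<close> were slower than \<open>v - \<epsilon>\<close> on a set of positive measure, then shrinking its distance to \<open>E\<close> by
  the further factor \<open>\<kappa> t = 1 - \<eta> F t\<close>, where \<open>F t\<close> is the time spent in this set up to \<open>t\<close>, would still
  respect the speed bound for small \<open>\<eta>\<close>, contradicting the minimality of \<open>lead\<close>.\<close>

lemma Q_speed:
  assumes g: "g \<in> borel_measurable borel" "\<And>t. norm (g t) \<le> v"
    and gi: "\<And>s t. 0 \<le> s \<Longrightarrow> s \<le> t \<Longrightarrow> (g has_integral (Q t - Q s)) {s..t}"
    and free: "\<And>s. 0 \<le> s \<Longrightarrow> s < \<tau> \<Longrightarrow> Q s \<noteq> E s"
  shows "AE t in lebesgue. t \<in> {0..\<tau>} \<longrightarrow> norm (g t) = v"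
proof -
  let ?l = "lead v E \<gamma>"
  have slow: "AE t in lebesgue. t \<in> {0..\<tau>} \<longrightarrow> v - \<epsilon> < norm (g t)" if \<epsilon>: "0 < \<epsilon>" for \<epsilon>
  proof -
    define ind :: "real \<Rightarrow> real" where "ind t = (if norm (g t) \<le> v - \<epsilon> then 1 else 0)" for t
    have ind01: "0 \<le> ind t" "ind t \<le> 1" for t by (auto simp: ind_def)
    have "ind \<in> borel_measurable borel" unfolding ind_def using g(1) by measurable
    then have indm: "ind \<in> borel_measurable lebesgue" by (simp add: measurable_completion)
    have indi: "ind integrable_on {a..b}" for a b
      by (rule measurable_bounded_by_integrable_imp_integrable[where g = "\<lambda>_. 1"])
        (use indm ind01 in \<open>auto simp: measurable_restrict_space1\<close>)
    have \<epsilon>i: "(\<lambda>x. \<epsilon> * ind x) integrable_on {a..b}" for a b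
      using integrable_cmul[OF indi, of \<epsilon> a b] by simp
    define F where "F t = integral {0..t} ind" for t
    have Fd: "F s - F r = integral {r..s} ind" if "0 \<le> r" "r \<le> s" for r s
      using Henstock_Kurzweil_Integration.integral_combine[OF that indi] by (simp add: F_def)
    have Fmono: "0 \<le> F s - F r" "F s - F r \<le> s - r" if "0 \<le> r" "r \<le> s" for r s
    proof -
      show "0 \<le> F s - F r" unfolding Fd[OF that] by (rule Henstock_Kurzweil_Integration.integral_nonneg[OF indi]) (rule ind01)
      have "integral {r..s} ind \<le> integral {r..s} (\<lambda>_. 1)" by (rule integral_le[OF indi]) (use ind01 in auto)
      then show "F s - F r \<le> s - r" unfolding Fd[OF that] using that by simp
    qed
    have F0: "F 0 = 0" by (simp add: F_def)
    have Qd: "norm (Q s - Q r) \<le> v * (s - r) - \<epsilon> * (F s - F r)" if "0 \<le> r" "r \<le> s" for r s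
    proof -
      have "norm (integral {r..s} g) \<le> integral {r..s} (\<lambda>t. v - \<epsilon> * ind t)"
      proof (rule integral_norm_bound_integral)
        show "g integrable_on {r..s}" using gi[OF that] by blast
        show "(\<lambda>t. v - \<epsilon> * ind t) integrable_on {r..s}"
          by (intro integrable_diff integrable_const_ivl \<epsilon>i)
      qed (use g(2) in \<open>auto simp: ind_def\<close>)
      also have "\<dots> = v * (s - r) - \<epsilon> * integral {r..s} ind"
        by (subst integral_diff) (use that in \<open>auto intro!: \<epsilon>i\<close>)
      finally show ?thesis using gi[OF that] by (simp add: Fd[OF that] integral_unique)
    qed
    have Fb: "F b = 0" if b: "0 \<le> b" "b < \<tau>" for b
    proof (rule ccontr)
      assume "F b \<noteq> 0"
      then have Fpos: "0 < F b" using Fmono(1)[of 0 b] b F0 by simp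
      have "compact ((\<lambda>t. Q t - E t) ` {0..b})"
        by (intro compact_continuous_image continuous_intros)
          (auto intro: continuous_on_subset[OF lipschitz_on_continuous_on[OF Q_lip]]
             continuous_on_subset[OF lipschitz_on_continuous_on[OF E_lip]])
      then obtain M where M: "0 < M" "\<And>t. t \<in> {0..b} \<Longrightarrow> norm (Q t - E t) \<le> M"
        using compact_imp_bounded bounded_pos by (metis (no_types, lifting) image_eqI)
      define \<eta> where "\<eta> = min (\<epsilon> / (2 * M)) (1 / (2 * b + 2))"
      have \<eta>: "0 < \<eta>" "\<eta> * M \<le> \<epsilon> / 2" "\<eta> * b \<le> 1 / 2"
      proof -
        show "0 < \<eta>" using \<epsilon> M b by (simp add: \<eta>_def)
        have "\<eta> * M \<le> \<epsilon> / (2 * M) * M" using M by (intro mult_right_mono) (auto simp: \<eta>_def)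
        then show "\<eta> * M \<le> \<epsilon> / 2" using M by simp
        have "\<eta> * b \<le> 1 / (2 * b + 2) * b" using b by (intro mult_right_mono) (auto simp: \<eta>_def)
        also have "\<dots> \<le> 1 / 2" using b by (simp add: field_simps)
        finally show "\<eta> * b \<le> 1 / 2" .
      qed
      define \<kappa> where "\<kappa> t = 1 - \<eta> * F t" for t
      have \<kappa>: "1 / 2 \<le> \<kappa> t" "\<kappa> t \<le> 1" if "t \<in> {0..b}" for t
      proof -
        have "\<eta> * F t \<le> \<eta> * b" using Fmono(2)[of 0 t] F0 that \<eta> by (intro mult_left_mono) auto
        then show "1 / 2 \<le> \<kappa> t" using \<eta>(3) unfolding \<kappa>_def by linarith
        have "0 \<le> \<eta> * F t" using Fmono(1)[of 0 t] F0 that \<eta> by auto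
        then show "\<kappa> t \<le> 1" by (simp add: \<kappa>_def)
      qed
      have "v-lipschitz_on {0..b} (shrink E \<gamma> (\<lambda>t. \<kappa> t * ?l t))"
      proof (rule lipschitz_on_leI)
        fix r s assume rs: "r \<in> {0..b}" "s \<in> {0..b}" "r \<le> s"
        define \<mu> where "\<mu> = F s - F r"
        have \<mu>: "0 \<le> \<mu>" using Fmono(1)[of r s] rs by (simp add: \<mu>_def)
        have k: "1 / 2 \<le> \<kappa> r" "\<kappa> r \<le> 1" using \<kappa> rs by auto
        have sh: "shrink E \<gamma> (\<lambda>t. \<kappa> t * ?l t) t = E t + \<kappa> t *\<^sub>R (Q t - E t)" for t
          by (simp add: shrink_def)
        have split: "(E s + \<kappa> s *\<^sub>R (Q s - E s)) - (E r + \<kappa> r *\<^sub>R (Q r - E r)) =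
          (1 - \<kappa> r) *\<^sub>R (E s - E r) + \<kappa> r *\<^sub>R (Q s - Q r) + (\<kappa> s - \<kappa> r) *\<^sub>R (Q s - E s)"
          by (simp add: algebra_simps)
        have "norm ((E s + \<kappa> s *\<^sub>R (Q s - E s)) - (E r + \<kappa> r *\<^sub>R (Q r - E r))) \<le> (1 - \<kappa> r) * norm (E s - E r) + \<kappa> r * norm (Q s - Q r) + \<bar>\<kappa> s - \<kappa> r\<bar> * norm (Q s - E s)"
        proof -
          have "\<bar>1 - \<kappa> r\<bar> = 1 - \<kappa> r" "\<bar>\<kappa> r\<bar> = \<kappa> r" using k by auto
          then show ?thesis
            using norm_triangle_mono[OF norm_triangle_ineq order_refl, of "(1 - \<kappa> r) *\<^sub>R (E s - E r)"
                "\<kappa> r *\<^sub>R (Q s - Q r)" "(\<kappa> s - \<kappa> r) *\<^sub>R (Q s - E s)"]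
            by (simp only: norm_scaleR split)
        qed
        also have "\<dots> \<le> (1 - \<kappa> r) * (v * (s - r)) + \<kappa> r * (v * (s - r) - \<epsilon> * \<mu>) + (\<eta> * \<mu>) * M"
        proof (intro add_mono mult_left_mono)
          have "w * (s - r) \<le> v * (s - r)" using w rs by (intro mult_right_mono) auto
          then show "norm (E s - E r) \<le> v * (s - r)" using E_norm[of r s] rs by auto
          show "norm (Q s - Q r) \<le> v * (s - r) - \<epsilon> * \<mu>" using Qd[of r s] rs by (simp add: \<mu>_def)
          have "\<bar>\<kappa> s - \<kappa> r\<bar> = \<eta> * \<mu>"
          proof -
            have "\<kappa> s - \<kappa> r = - (\<eta> * \<mu>)" by (simp add: \<kappa>_def \<mu>_def algebra_simps)
            then show ?thesis using \<eta> \<mu> by simp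
          qed
          then show "\<bar>\<kappa> s - \<kappa> r\<bar> * norm (Q s - E s) \<le> \<eta> * \<mu> * M" using M(2)[of s] rs \<eta> \<mu> by (auto intro: mult_left_mono)
        qed (use k in auto)
        also have "\<dots> = v * (s - r) - \<mu> * (\<kappa> r * \<epsilon> - \<eta> * M)" by (simp add: algebra_simps)
        also have "\<dots> \<le> v * (s - r)"
        proof -
          have "1 / 2 * \<epsilon> \<le> \<kappa> r * \<epsilon>" using k \<epsilon> by (intro mult_right_mono) auto
          then have "0 \<le> \<mu> * (\<kappa> r * \<epsilon> - \<eta> * M)" using \<mu> \<eta> by (intro mult_nonneg_nonneg) auto
          then show ?thesis by simp
        qed
        finally show "dist (shrink E \<gamma> (\<lambda>t. \<kappa> t * ?l t) r) (shrink E \<gamma> (\<lambda>t. \<kappa> t * ?l t) s) \<le> v * dist r s"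
          unfolding sh using rs by (simp add: dist_norm norm_minus_commute)
      qed (use w in auto)
      moreover have "\<kappa> 0 * ?l 0 = 1" by (simp add: \<kappa>_def F0 lead_0)
      moreover have "0 \<le> \<kappa> t * ?l t \<and> \<kappa> t * ?l t \<le> 1" if "t \<in> {0..b}" for t
        using \<kappa>[OF that] lead_nonneg[of t] lead_le_1[of t] that by (auto intro!: mult_le_one)
      ultimately have "(\<lambda>t. \<kappa> t * ?l t) \<in> leads v E \<gamma> b" by (simp add: leads_def)
      then have le: "?l b \<le> \<kappa> b * ?l b" using lead_le b by blast
      have "?l b \<noteq> 0" using free[OF b] by (auto simp: shrink_def)
      then have "0 < ?l b" using lead_nonneg[OF b(1)] by simp
      then have "1 \<le> \<kappa> b" using le by simp
      then show False using Fpos \<eta> by (simp add: \<kappa>_def mult_le_0_iff)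
    qed
    have "AE t in lebesgue. t \<in> {0..\<tau>} \<longrightarrow> ind t = 0"
    proof (rule AE_zero_of_integral_zero[OF indi])
      fix s assume s: "s \<in> {0..\<tau>}"
      \<comment> \<open>\<open>Fb\<close> stops short of \<open>\<tau>\<close>; since
        \<open>F\<close> grows at rate at most 1, looking back by \<open>d\<close> covers the
        endpoint.\<close>
      have "F s \<le> 0"
      proof (rule field_le_epsilon)
        fix d :: real assume d: "0 < d"
        define b where "b = max 0 (s - d)"
        have "F b = 0"
          using Fb[of b] F0 s d by (cases "b = 0") (auto simp: b_def max_def split: if_splits)
        moreover have "F s - F b \<le> s - b" using s d by (intro Fmono(2)) (auto simp: b_def)
        ultimately show "F s \<le> 0 + d" by (simp add: b_def max_def split: if_splits)
      qed
      then show "integral {0..s} ind = 0" using Fmono(1)[of 0 s] F0 s by (simp add: F_def)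
    qed
    then show ?thesis by eventually_elim (auto simp: ind_def split: if_splits)
  qed
  have "AE t in lebesgue. \<forall>n. t \<in> {0..\<tau>} \<longrightarrow> v - 1 / real (Suc n) < norm (g t)"
    by (intro AE_all_countable[THEN iffD2] allI slow) simp
  then show ?thesis
  proof eventually_elim
    case (elim t)
    show ?case
    proof
      assume t: "t \<in> {0..\<tau>}"
      have "v \<le> norm (g t)"
      proof (rule field_le_epsilon)
        fix d :: real assume "0 < d"
        then obtain n where "1 / real (Suc n) < d" using nat_approx_posE by blast
        then show "v \<le> norm (g t) + d" using elim t by (smt (verit))
      qed
      then show "norm (g t) = v" using g(2)[of t] by simp
    qed
  qed
qed

text \<open>From \<open>\<tau>\<close> on both \<open>E\<close> and \<open>\<gamma>\<close> obey the
  bound \<open>w\<close>, so \<open>v - w\<close> remains for changing the factor. In the increment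
  of the path the change of the factor can be attached to the gap at either end of the interval,
  hence the minimum in the hypothesis.\<close>

lemma tail_in_leads:
  assumes \<tau>: "0 \<le> \<tau>" "\<tau> \<le> t1" and \<gamma>w: "w-lipschitz_on {\<tau>..} \<gamma>"
    and \<kappa>: "\<kappa> \<tau> = 1" "\<And>t. t \<in> {\<tau>..t1} \<Longrightarrow> 0 \<le> \<kappa> t \<and> \<kappa> t \<le> 1"
    and slope: "\<And>r s. \<tau> \<le> r \<Longrightarrow> r \<le> s \<Longrightarrow> s \<le> t1 \<Longrightarrow>
      \<bar>\<kappa> s - \<kappa> r\<bar> * min (norm (\<gamma> r - E r)) (norm (\<gamma> s - E s)) \<le> (v - w) * (s - r)"
  shows "(\<lambda>t. if t \<le> \<tau> then 1 else \<kappa> t) \<in> leads v E \<gamma> t1"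
proof -
  have "v-lipschitz_on {\<tau>..t1} (shrink E \<gamma> \<kappa>)"
  proof (rule lipschitz_on_leI)
    fix r s assume rs: "r \<in> {\<tau>..t1}" "s \<in> {\<tau>..t1}" "r \<le> s"
    have bound: "norm ((1 - k) *\<^sub>R (E s - E r) + k *\<^sub>R (\<gamma> s - \<gamma> r)) \<le> w * (s - r)" if "0 \<le> k" "k \<le> 1" for k
    proof -
      have "norm ((1 - k) *\<^sub>R (E s - E r) + k *\<^sub>R (\<gamma> s - \<gamma> r)) \<le> (1 - k) * norm (E s - E r) + k * norm (\<gamma> s - \<gamma> r)"
        using that by (intro order_trans[OF norm_triangle_ineq]) auto
      also have "\<dots> \<le> (1 - k) * (w * (s - r)) + k * (w * (s - r))"
        using that rs \<tau> E_norm[of r s] lipschitz_on_normD[OF \<gamma>w, of s r] by (intro add_mono mult_left_mono) auto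
      finally show ?thesis by (simp add: algebra_simps)
    qed
    have "norm (shrink E \<gamma> \<kappa> s - shrink E \<gamma> \<kappa> r) \<le> w * (s - r) + \<bar>\<kappa> s - \<kappa> r\<bar> * min (norm (\<gamma> r - E r)) (norm (\<gamma> s - E s))"
    proof (cases "norm (\<gamma> r - E r) \<le> norm (\<gamma> s - E s)")
      case True
      have "shrink E \<gamma> \<kappa> s - shrink E \<gamma> \<kappa> r = ((1 - \<kappa> s) *\<^sub>R (E s - E r) + \<kappa> s *\<^sub>R (\<gamma> s - \<gamma> r)) + (\<kappa> s - \<kappa> r) *\<^sub>R (\<gamma> r - E r)"
        by (simp add: shrink_def algebra_simps)
      also have "norm \<dots> \<le> w * (s - r) + \<bar>\<kappa> s - \<kappa> r\<bar> * norm (\<gamma> r - E r)"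
        using rs \<kappa>(2)[of s] by (intro order_trans[OF norm_triangle_ineq] add_mono bound) auto
      finally show ?thesis using True by (simp add: min_def)
    next
      case False
      have "shrink E \<gamma> \<kappa> s - shrink E \<gamma> \<kappa> r = ((1 - \<kappa> r) *\<^sub>R (E s - E r) + \<kappa> r *\<^sub>R (\<gamma> s - \<gamma> r)) + (\<kappa> s - \<kappa> r) *\<^sub>R (\<gamma> s - E s)"
        by (simp add: shrink_def algebra_simps)
      also have "norm \<dots> \<le> w * (s - r) + \<bar>\<kappa> s - \<kappa> r\<bar> * norm (\<gamma> s - E s)"
        using rs \<kappa>(2)[of r] by (intro order_trans[OF norm_triangle_ineq] add_mono bound) auto
      finally show ?thesis using False by (simp add: min_def)
    qed
    also have "\<dots> \<le> w * (s - r) + (v - w) * (s - r)" using slope[of r s] rs by auto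
    finally show "dist (shrink E \<gamma> \<kappa> r) (shrink E \<gamma> \<kappa> s) \<le> v * dist r s"
      using rs by (simp add: dist_norm norm_minus_commute algebra_simps)
  qed (use w in auto)
  moreover have "v-lipschitz_on {0..\<tau>} \<gamma>" using \<gamma>_lip by (rule lipschitz_on_subset) auto
  ultimately have "v-lipschitz_on {0..t1} (\<lambda>t. if t \<le> \<tau> then \<gamma> t else shrink E \<gamma> \<kappa> t)"
    by (intro lipschitz_on_concat) (auto simp: shrink_def \<kappa>(1))
  moreover have "(\<lambda>t. if t \<le> \<tau> then \<gamma> t else shrink E \<gamma> \<kappa> t) = shrink E \<gamma> (\<lambda>t. if t \<le> \<tau> then 1 else \<kappa> t)"
    by (auto simp: shrink_def)
  ultimately have "v-lipschitz_on {0..t1} (shrink E \<gamma> (\<lambda>t. if t \<le> \<tau> then 1 else \<kappa> t))" by (simp only:)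
  then show ?thesis using \<tau> \<kappa>(2) by (auto simp: leads_def)
qed

text \<open>Once the guide is no faster than the evader, a pursuer with a gap of at most \<open>W\<close> to close can decrease
  its factor at the rate \<open>(v - w) / W\<close>. For affine \<open>W\<close> this is a logarithm, which reaches any size both
  as \<open>W\<close> grows linearly and as \<open>W\<close> tends to \<open>0\<close>.\<close>

lemma captured_if_log_bound:
  assumes \<tau>: "0 \<le> \<tau>" "\<tau> < t1" and \<gamma>w: "w-lipschitz_on {\<tau>..} \<gamma>"
    and L: "0 < L"
    and W: "\<And>t. t \<in> {\<tau>..t1} \<Longrightarrow> 0 < W t" "\<And>r s. \<bar>W s - W r\<bar> = L * \<bar>s - r\<bar>"
      "\<And>t. t \<in> {\<tau>..t1} \<Longrightarrow> norm (\<gamma> t - E t) \<le> W t"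
    and end_W: "\<And>t. t \<in> {\<tau>..t1} \<Longrightarrow> (v - w) * \<bar>ln (W t) - ln (W \<tau>)\<bar> \<le> L" "(v - w) * \<bar>ln (W t1) - ln (W \<tau>)\<bar> = L"
  shows "Q t1 = E t1"
proof -
  \<comment> \<open>Over an interval the factor changes by at most \<open>c\<close> times the change
    of \<open>ln W\<close>; multiplied by the smaller gap this is at most
    \<open>c * L = v - w\<close> per unit of time.\<close>
  define c where "c = (v - w) / L"
  have c: "0 < c" "c * L = v - w" using w L by (auto simp: c_def)
  define \<kappa> where "\<kappa> t = 1 - c * \<bar>ln (W t) - ln (W \<tau>)\<bar>" for t
  have "(\<lambda>t. if t \<le> \<tau> then 1 else \<kappa> t) \<in> leads v E \<gamma> t1"
  proof (rule tail_in_leads[OF \<tau>(1) _ \<gamma>w])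
    fix t assume t: "t \<in> {\<tau>..t1}"
    have "c * \<bar>ln (W t) - ln (W \<tau>)\<bar> = ((v - w) * \<bar>ln (W t) - ln (W \<tau>)\<bar>) / L" by (simp add: c_def)
    also have "\<dots> \<le> 1" using end_W(1)[OF t] L by simp
    finally show "0 \<le> \<kappa> t \<and> \<kappa> t \<le> 1" using c by (simp add: \<kappa>_def)
  next
    fix r s assume rs: "\<tau> \<le> r" "r \<le> s" "s \<le> t1"
    have p: "0 < W r" "0 < W s" using W(1) rs by auto
    have "\<bar>\<kappa> s - \<kappa> r\<bar> \<le> c * \<bar>ln (W s) - ln (W r)\<bar>"
    proof -
      have "\<kappa> s - \<kappa> r = c * (\<bar>ln (W r) - ln (W \<tau>)\<bar> - \<bar>ln (W s) - ln (W \<tau>)\<bar>)" by (simp add: \<kappa>_def algebra_simps)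
      then have "\<bar>\<kappa> s - \<kappa> r\<bar> = c * \<bar>\<bar>ln (W r) - ln (W \<tau>)\<bar> - \<bar>ln (W s) - ln (W \<tau>)\<bar>\<bar>" using c by (simp add: abs_mult)
      also have "\<dots> \<le> c * \<bar>ln (W s) - ln (W r)\<bar>" using c by (intro mult_left_mono) auto
      finally show ?thesis .
    qed
    then have "\<bar>\<kappa> s - \<kappa> r\<bar> * min (norm (\<gamma> r - E r)) (norm (\<gamma> s - E s)) \<le> (c * \<bar>ln (W s) - ln (W r)\<bar>) * min (W s) (W r)"
      using W(3)[of r] W(3)[of s] rs by (intro mult_mono) (auto simp: min_def)
    also have "\<dots> \<le> c * \<bar>W s - W r\<bar>"
      using ln_diff_mult_min[OF p(2,1)] c(1) by (simp add: mult.assoc)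
    also have "\<dots> = (v - w) * (s - r)" using rs by (simp add: W(2) flip: c(2))
    finally show "\<bar>\<kappa> s - \<kappa> r\<bar> * min (norm (\<gamma> r - E r)) (norm (\<gamma> s - E s)) \<le> (v - w) * (s - r)" .
  qed (use \<tau> in \<open>auto simp: \<kappa>_def\<close>)
  moreover have "\<kappa> t1 = 0" using end_W(2) L by (simp add: \<kappa>_def c_def field_simps)
  ultimately show ?thesis using \<tau> by (intro Q_captured[of "\<lambda>t. if t \<le> \<tau> then 1 else \<kappa> t"]) auto
qed

lemma gap_bound:
  assumes "0 \<le> \<tau>" "w-lipschitz_on {\<tau>..} \<gamma>" "\<tau> \<le> r" "r \<le> s"
  shows "\<bar>norm (\<gamma> s - E s) - norm (\<gamma> r - E r)\<bar> \<le> 2 * w * (s - r)"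
proof -
  have "\<bar>norm (\<gamma> s - E s) - norm (\<gamma> r - E r)\<bar> \<le> norm ((\<gamma> s - E s) - (\<gamma> r - E r))" by (rule norm_triangle_ineq3)
  also have "\<dots> = norm ((\<gamma> s - \<gamma> r) - (E s - E r))" by (simp add: algebra_simps)
  also have "\<dots> \<le> norm (\<gamma> s - \<gamma> r) + norm (E s - E r)" by (rule norm_triangle_ineq4)
  also have "\<dots> \<le> w * (s - r) + w * (s - r)"
    using assms E_norm[of r s] lipschitz_on_normD[OF assms(2), of s r] by (intro add_mono) auto
  finally show ?thesis by simp
qed

text \<open>The gap grows at rate at most \<open>2 * w\<close>, so an increasing affine
  \<open>W\<close> stays above it, and its logarithm is unbounded.\<close>

lemma eventually_captured:
  assumes \<tau>: "0 \<le> \<tau>" and \<gamma>w: "w-lipschitz_on {\<tau>..} \<gamma>"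
  shows "\<exists>t\<ge>\<tau>. Q t = E t"
proof -
  \<comment> \<open>One more than the growth rate of the gap, so that \<open>L\<close> is positive
    even for \<open>w = 0\<close>; likewise \<open>b\<close> exceeds the initial gap by 1 to keep
    \<open>W\<close> positive.\<close>
  define L where "L = 2 * w + 1"
  define b where "b = norm (\<gamma> \<tau> - E \<tau>) + 1"
  define W where "W t = b + L * (t - \<tau>)" for t
  \<comment> \<open>\<open>t1\<close> is the time at which \<open>W\<close> has grown by the factor
    \<open>e\<close>, so that \<open>ln W\<close> has gained \<open>L / (v - w)\<close>.\<close>
  define e where "e = exp (L / (v - w))"
  define t1 where "t1 = \<tau> + b * (e - 1) / L"
  have L: "0 < L" and b: "0 < b" using w by (auto simp: L_def b_def add_nonneg_pos)
  have e: "1 < e" using L w by (simp add: e_def)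
  have t1: "\<tau> < t1" using L b e by (simp add: t1_def)
  have W1: "W t1 = b * e" using L by (simp add: W_def t1_def field_simps)
  have Wt: "W \<tau> = b" by (simp add: W_def)
  have Wpos: "b \<le> W t" if "\<tau> \<le> t" for t using that L by (simp add: W_def)
  have le1: "ln (W t1) - ln (W \<tau>) = L / (v - w)" using b e by (simp add: W1 Wt ln_mult) (simp add: e_def)
  have "Q t1 = E t1"
  proof (rule captured_if_log_bound[OF \<tau> t1 \<gamma>w L])
    show "0 < W t" if "t \<in> {\<tau>..t1}" for t using Wpos[of t] b that by auto
    show "\<bar>W s - W r\<bar> = L * \<bar>s - r\<bar>" for r s
    proof -
      have "W s - W r = L * (s - r)" by (simp add: W_def algebra_simps)
      then show ?thesis using L by (simp add: abs_mult)
    qed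
    show "norm (\<gamma> t - E t) \<le> W t" if "t \<in> {\<tau>..t1}" for t
    proof -
      have "2 * w * (t - \<tau>) \<le> L * (t - \<tau>)" using that by (intro mult_right_mono) (auto simp: L_def)
      then show ?thesis using gap_bound[OF \<tau> \<gamma>w, of \<tau> t] that by (simp add: W_def b_def)
    qed
    show "(v - w) * \<bar>ln (W t1) - ln (W \<tau>)\<bar> = L" unfolding le1 using w L by simp
    show "(v - w) * \<bar>ln (W t) - ln (W \<tau>)\<bar> \<le> L" if t: "t \<in> {\<tau>..t1}" for t
    proof -
      have "W t \<le> W t1" using t L by (simp add: W_def)
      then have "ln (W t) \<le> ln (W t1)" using Wpos[of t] t b by simp
      moreover have "ln (W \<tau>) \<le> ln (W t)" using Wpos[of t] t b by (simp add: Wt)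
      ultimately have "\<bar>ln (W t) - ln (W \<tau>)\<bar> \<le> L / (v - w)" using le1 by simp
      then show ?thesis using w by (simp add: field_simps)
    qed
  qed
  then show ?thesis using t1 by (intro exI[of _ t1]) auto
qed

text \<open>The source of strictness. If the guide meets the evader at \<open>t0\<close>, the gap is
  at most a multiple of \<open>t0 - t\<close>, whose logarithm falls without bound as
  \<open>t\<close> approaches \<open>t0\<close>; the factor is therefore used up earlier.\<close>

lemma captured_before_meeting:
  assumes \<tau>: "0 \<le> \<tau>" "\<tau> < t0" and \<gamma>w: "w-lipschitz_on {\<tau>..} \<gamma>" and meet: "\<gamma> t0 = E t0"
  shows "\<exists>t. \<tau> \<le> t \<and> t < t0 \<and> Q t = E t"
proof -
  define L where "L = 2 * w + 1"
  define W where "W t = L * (t0 - t)" for t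
  define e where "e = exp (- (L / (v - w)))"
  define t1 where "t1 = t0 - (t0 - \<tau>) * e"
  have L: "0 < L" using w by (auto simp: L_def)
  have e: "0 < e" "e < 1" using L w by (auto simp: e_def)
  have t1: "\<tau> < t1" "t1 < t0"
  proof -
    have "(t0 - \<tau>) * e < (t0 - \<tau>) * 1" using e \<tau> by (intro mult_strict_left_mono) auto
    then show "\<tau> < t1" by (simp add: t1_def)
    show "t1 < t0" using e \<tau> by (simp add: t1_def)
  qed
  have Wpos: "0 < W t" if "t \<le> t1" for t using that L t1 by (simp add: W_def)
  have W1: "W t1 = W \<tau> * e" by (simp add: W_def t1_def)
  have le1: "ln (W \<tau>) - ln (W t1) = L / (v - w)" using Wpos[of \<tau>] t1 e by (simp add: W1 ln_mult) (simp add: e_def)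
  have "Q t1 = E t1"
  proof (rule captured_if_log_bound[OF \<tau>(1) t1(1) \<gamma>w L])
    show "0 < W t" if "t \<in> {\<tau>..t1}" for t using Wpos[of t] that by auto
    show "\<bar>W s - W r\<bar> = L * \<bar>s - r\<bar>" for r s
    proof -
      have "W s - W r = L * (r - s)" by (simp add: W_def algebra_simps)
      then show ?thesis using L by (simp add: abs_mult abs_minus_commute)
    qed
    show "norm (\<gamma> t - E t) \<le> W t" if "t \<in> {\<tau>..t1}" for t
    proof -
      have "2 * w * (t0 - t) \<le> L * (t0 - t)" using that t1 by (intro mult_right_mono) (auto simp: L_def)
      moreover have "norm (\<gamma> t - E t) \<le> 2 * w * (t0 - t)"
        using gap_bound[OF \<tau>(1) \<gamma>w, of t t0] that t1 meet by simp
      ultimately show ?thesis by (simp add: W_def del: mult_le_cancel_right)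
    qed
    show "(v - w) * \<bar>ln (W t1) - ln (W \<tau>)\<bar> = L" using le1 w L by (subst abs_minus_commute) simp
    show "(v - w) * \<bar>ln (W t) - ln (W \<tau>)\<bar> \<le> L" if t: "t \<in> {\<tau>..t1}" for t
    proof -
      have "W t1 \<le> W t" using t L by (simp add: W_def)
      then have "ln (W t1) \<le> ln (W t)" using Wpos[of t] Wpos[of t1] t by simp
      moreover have "W t \<le> W \<tau>" using t L by (simp add: W_def)
      then have "ln (W t) \<le> ln (W \<tau>)" using Wpos[of t] t by simp
      ultimately have "\<bar>ln (W t) - ln (W \<tau>)\<bar> \<le> L / (v - w)" using le1 by simp
      then show ?thesis using w by (simp add: field_simps)
    qed
  qed
  then show ?thesis using t1 by (intro exI[of _ t1]) auto
qed

end

section \<open>A single pursuer\<close>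

text \<open>The rate at which the line of sight, with direction \<open>e\<close> from evader to
  pursuer, shortens in parallel pursuit against the control \<open>u\<close>: for unit vectors, the
  positive root \<open>k\<close> of
  \<open>norm (vE *\<^sub>R u - k *\<^sub>R e) = vP\<close>.\<close>

definition closing_speed :: "real \<Rightarrow> real \<Rightarrow> 'a::euclidean_space \<Rightarrow> 'a \<Rightarrow> real" where
  "closing_speed vP vE e u = vE * (u \<bullet> e) + sqrt (vP\<^sup>2 - vE\<^sup>2 + (vE * (u \<bullet> e))\<^sup>2)"

lemma closing_speed_eq:
  assumes "0 < vE" "vE < vP"
  shows "(closing_speed vP vE e u)\<^sup>2 = vP\<^sup>2 - vE\<^sup>2 + 2 * vE * closing_speed vP vE e u * (u \<bullet> e)"
proof -
  have "vE\<^sup>2 \<le> vP\<^sup>2" using assms by (intro power_mono) auto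
  then have "(sqrt (vP\<^sup>2 - vE\<^sup>2 + (vE * (u \<bullet> e))\<^sup>2))\<^sup>2 = vP\<^sup>2 - vE\<^sup>2 + (vE * (u \<bullet> e))\<^sup>2" by simp
  then show ?thesis unfolding closing_speed_def power2_sum by (simp add: algebra_simps power2_eq_square)
qed

lemma closing_speed_pos:
  assumes "0 < vE" "vE < vP"
  shows "0 < closing_speed vP vE e u"
proof -
  have "vE\<^sup>2 < vP\<^sup>2" using assms by (intro power_strict_mono) auto
  then have "sqrt ((vE * (u \<bullet> e))\<^sup>2) < sqrt (vP\<^sup>2 - vE\<^sup>2 + (vE * (u \<bullet> e))\<^sup>2)"
    by (intro real_sqrt_less_mono) simp
  then show ?thesis unfolding closing_speed_def real_sqrt_abs by linarith
qed

lemma norm_pursuer_velocity: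
  assumes v: "0 < vE" "vE < vP" and n: "norm e = 1" "norm u = 1"
  shows "norm (vE *\<^sub>R u - closing_speed vP vE e u *\<^sub>R e) = vP"
proof -
  define k where "k = closing_speed vP vE e u"
  have uu: "u \<bullet> u = 1" "e \<bullet> e = 1" using n by (simp_all add: dot_square_norm)
  have "(norm (vE *\<^sub>R u - k *\<^sub>R e))\<^sup>2 = vE\<^sup>2 - 2 * vE * k * (u \<bullet> e) + k\<^sup>2"
    unfolding power2_norm_eq_inner using uu
    by (simp add: inner_diff_left inner_diff_right inner_commute power2_eq_square algebra_simps)
  also have "\<dots> = vP\<^sup>2" using closing_speed_eq[OF v, of e u] by (simp add: k_def)
  finally show ?thesis using v by (simp add: k_def power2_eq_iff_nonneg)
qed

text \<open>The left side is the speed of the centre of the Apollonius disc, the right side the rate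
  at which its radius shrinks. Their equality makes the discs nested.\<close>

lemma norm_apollonius_velocity:
  assumes v: "0 < vE" "vE < vP" and n: "norm e = 1" "norm u = 1" and \<alpha>: "\<alpha> = vE / vP"
  shows "norm (vE *\<^sub>R u + (\<alpha>\<^sup>2 / (1 - \<alpha>\<^sup>2) * closing_speed vP vE e u) *\<^sub>R e) = \<alpha> / (1 - \<alpha>\<^sup>2) * closing_speed vP vE e u"
proof -
  define k where "k = closing_speed vP vE e u"
  define b where "b = 1 - \<alpha>\<^sup>2"
  have k: "0 < k" "k\<^sup>2 = vP\<^sup>2 - vE\<^sup>2 + 2 * vE * k * (u \<bullet> e)"
    using closing_speed_pos[OF v] closing_speed_eq[OF v] by (simp_all add: k_def)
  have a: "0 < \<alpha>" "\<alpha> < 1" and vE: "vE = \<alpha> * vP" using v \<alpha> by auto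
  have b: "0 < b" using a by (simp add: b_def power_less_one_iff)
  have uu: "u \<bullet> u = 1" "e \<bullet> e = 1" using n by (simp_all add: dot_square_norm)
  have "(norm (vE *\<^sub>R u + (\<alpha>\<^sup>2 / b * k) *\<^sub>R e))\<^sup>2 = vE\<^sup>2 + \<alpha>\<^sup>2 / b * (2 * vE * k * (u \<bullet> e)) + (\<alpha>\<^sup>2 / b * k)\<^sup>2"
    unfolding power2_norm_eq_inner using uu
    by (simp add: inner_add_left inner_add_right inner_commute power2_eq_square algebra_simps)
  also have "2 * vE * k * (u \<bullet> e) = k\<^sup>2 - (vP\<^sup>2 - vE\<^sup>2)" using k(2) by simp
  also have "vP\<^sup>2 - vE\<^sup>2 = b * vP\<^sup>2" by (simp add: vE b_def algebra_simps power_mult_distrib)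
  also have "vE\<^sup>2 + \<alpha>\<^sup>2 / b * (k\<^sup>2 - b * vP\<^sup>2) + (\<alpha>\<^sup>2 / b * k)\<^sup>2 = \<alpha>\<^sup>2 * k\<^sup>2 / b * (1 + \<alpha>\<^sup>2 / b)"
    using b by (simp add: vE power2_eq_square field_simps)
  also have "1 + \<alpha>\<^sup>2 / b = 1 / b" using b by (simp add: field_simps) (simp add: b_def)
  also have "\<alpha>\<^sup>2 * k\<^sup>2 / b * (1 / b) = (\<alpha> / b * k)\<^sup>2" by (simp add: power2_eq_square)
  finally have "(norm (vE *\<^sub>R u + (\<alpha>\<^sup>2 / b * k) *\<^sub>R e))\<^sup>2 = (\<alpha> / b * k)\<^sup>2" .
  moreover have "0 \<le> \<alpha> / b * k" using a b k by simp
  ultimately show ?thesis by (simp add: k_def b_def power2_eq_iff_nonneg)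
qed

text \<open>The centre and radius of the Apollonius disc, seen from the evader.\<close>

lemma apollonius_identity:
  fixes y d :: "'a::euclidean_space"
  assumes \<alpha>: "0 < \<alpha>" "\<alpha> < 1"
  shows "(norm y)\<^sup>2 - (\<alpha> * norm (y + \<rho> *\<^sub>R d))\<^sup>2 =
     (1 - \<alpha>\<^sup>2) * ((norm (y - (\<alpha>\<^sup>2 / (1 - \<alpha>\<^sup>2) * \<rho>) *\<^sub>R d))\<^sup>2 - (\<alpha> / (1 - \<alpha>\<^sup>2) * (\<rho> * norm d))\<^sup>2)"
proof -
  define b where "b = 1 - \<alpha>\<^sup>2"
  have b: "0 < b" "\<alpha>\<^sup>2 = 1 - b" using \<alpha> by (auto simp: b_def power_less_one_iff)
  have "(norm y)\<^sup>2 - (\<alpha> * norm (y + \<rho> *\<^sub>R d))\<^sup>2 = y \<bullet> y - \<alpha>\<^sup>2 * (y \<bullet> y + 2 * \<rho> * (y \<bullet> d) + \<rho>\<^sup>2 * (d \<bullet> d))"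
    unfolding power_mult_distrib power2_norm_eq_inner
    by (simp add: inner_add_left inner_add_right inner_commute power2_eq_square algebra_simps)
  moreover have "(norm (y - (\<alpha>\<^sup>2 / b * \<rho>) *\<^sub>R d))\<^sup>2 - (\<alpha> / b * (\<rho> * norm d))\<^sup>2 =
     y \<bullet> y - 2 * (\<alpha>\<^sup>2 / b * \<rho>) * (y \<bullet> d) + (\<alpha>\<^sup>2 / b * \<rho>)\<^sup>2 * (d \<bullet> d) - \<alpha>\<^sup>2 / b\<^sup>2 * \<rho>\<^sup>2 * (d \<bullet> d)"
    unfolding power_mult_distrib power_divide power2_norm_eq_inner
    by (simp add: inner_diff_left inner_diff_right inner_commute power2_eq_square algebra_simps)
  moreover have "y \<bullet> y - \<alpha>\<^sup>2 * (y \<bullet> y + 2 * \<rho> * (y \<bullet> d) + \<rho>\<^sup>2 * (d \<bullet> d)) =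
     b * (y \<bullet> y - 2 * (\<alpha>\<^sup>2 / b * \<rho>) * (y \<bullet> d) + (\<alpha>\<^sup>2 / b * \<rho>)\<^sup>2 * (d \<bullet> d) - \<alpha>\<^sup>2 / b\<^sup>2 * \<rho>\<^sup>2 * (d \<bullet> d))"
    unfolding b(2) using b(1) by (simp add: field_simps power2_eq_square)
  ultimately show ?thesis by (simp add: b_def)
qed

lemma apollonius_iff:
  fixes y d :: "'a::euclidean_space"
  assumes \<alpha>: "0 < \<alpha>" "\<alpha> < 1" and \<rho>: "0 \<le> \<rho>"
  shows "\<alpha> * norm (y + \<rho> *\<^sub>R d) \<le> norm y \<longleftrightarrow>
      \<alpha> / (1 - \<alpha>\<^sup>2) * (\<rho> * norm d) \<le> norm (y - (\<alpha>\<^sup>2 / (1 - \<alpha>\<^sup>2) * \<rho>) *\<^sub>R d)" (is ?le)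
    and "\<alpha> * norm (y + \<rho> *\<^sub>R d) < norm y \<longleftrightarrow>
      \<alpha> / (1 - \<alpha>\<^sup>2) * (\<rho> * norm d) < norm (y - (\<alpha>\<^sup>2 / (1 - \<alpha>\<^sup>2) * \<rho>) *\<^sub>R d)" (is ?less)
proof -
  have b: "0 < 1 - \<alpha>\<^sup>2" using \<alpha> by (auto simp: power_less_one_iff)
  have sq: "p \<le> q \<longleftrightarrow> 0 \<le> q\<^sup>2 - p\<^sup>2" "p < q \<longleftrightarrow> 0 < q\<^sup>2 - p\<^sup>2" if "0 \<le> p" "0 \<le> q" for p q :: real
    using that power2_less_imp_less[of p q] power2_le_imp_le[of p q] power_mono[of p q 2] power_strict_mono[of p q 2] by auto
  have nn: "0 \<le> \<alpha> * norm (y + \<rho> *\<^sub>R d)" "0 \<le> \<alpha> / (1 - \<alpha>\<^sup>2) * (\<rho> * norm d)" using \<alpha> b \<rho> by auto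
  show ?le unfolding sq(1)[OF nn(1) norm_ge_zero] sq(1)[OF nn(2) norm_ge_zero] apollonius_identity[OF \<alpha>]
    using b by (simp add: zero_le_mult_iff)
  show ?less unfolding sq(2)[OF nn(1) norm_ge_zero] sq(2)[OF nn(2) norm_ge_zero] apollonius_identity[OF \<alpha>]
    using b by (simp add: zero_less_mult_iff)
qed

text \<open>The coefficient is the remaining fraction of the line of sight; \<open>max 0\<close>
  makes the pursuer stay with the evader once it is used up.\<close>

definition parallel :: "real \<Rightarrow> real \<Rightarrow> real^2 \<Rightarrow> real^2 \<Rightarrow> (real \<Rightarrow> real^2) \<Rightarrow> real \<Rightarrow> real^2" where
  "parallel vP vE X z a t = traj vE z a t +
     max 0 (1 - integral {0..t} (\<lambda>s. closing_speed vP vE (sgn (X - z)) (a s)) / norm (X - z)) *\<^sub>R (X - z)"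

lemma parallel_0: "parallel vP vE X z a 0 = X"
  by (simp add: parallel_def)

lemma parallel_cong_AE:
  assumes "AE r in lebesgue. r \<in> {0..t} \<longrightarrow> a r = a' r" "s \<le> t"
  shows "parallel vP vE X z a s = parallel vP vE X z a' s"
proof -
  obtain N where N: "negligible N" "{r. \<not> (r \<in> {0..t} \<longrightarrow> a r = a' r)} \<subseteq> N"
    using assms(1) unfolding eventually_ae_filter_negligible by blast
  have "integral {0..s} (\<lambda>s. closing_speed vP vE (sgn (X - z)) (a s)) = integral {0..s} (\<lambda>s. closing_speed vP vE (sgn (X - z)) (a' s))"
    by (rule integral_spike[OF N(1)]) (use N(2) assms(2) in force)
  then show ?thesis using traj_cong_AE[OF assms] by (simp add: parallel_def)
qed

text \<open>A point outside the initial Apollonius disc stays outside the later ones, because the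
  centre never moves by more than the radius loses. The strict form holds up to
  \<open>\<tau>\<close>, when the disc has shrunk to the evader's position; afterwards only
  \<open>\<alpha> < 1\<close> is left.\<close>

lemma parallel_pursuit:
  fixes X z :: "real^2"
  assumes v: "0 < vE" "vE < vP" and a: "a \<in> borel_measurable lebesgue" "\<And>t. norm (a t) = 1" and \<alpha>: "\<alpha> = vE / vP"
  shows "vP-lipschitz_on {0..} (parallel vP vE X z a) \<and>
    (\<exists>\<tau>\<ge>0. (\<forall>t\<ge>\<tau>. parallel vP vE X z a t = traj vE z a t) \<and>
      (\<forall>q t. 0 \<le> t \<longrightarrow> \<alpha> * norm (X - q) \<le> norm (z - q) \<longrightarrow> \<alpha> * norm (parallel vP vE X z a t - q) \<le> norm (traj vE z a t - q)) \<and>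
      (\<forall>q t. 0 \<le> t \<longrightarrow> t \<le> \<tau> \<longrightarrow> \<alpha> * norm (X - q) < norm (z - q) \<longrightarrow> \<alpha> * norm (parallel vP vE X z a t - q) < norm (traj vE z a t - q)))"
proof (cases "X = z")
  case True
  have P: "parallel vP vE X z a = traj vE z a" by (rule ext) (simp add: parallel_def True)
  have L: "vE-lipschitz_on {0..} (traj vE z a)" using traj_lipschitz[OF a] v by simp
  have "\<alpha> * norm (traj vE z a t - q) \<le> norm (traj vE z a t - q)" for q t
    using v \<alpha> by (intro mult_left_le_one_le) auto
  then show ?thesis unfolding P using lipschitz_on_mono[OF L order_refl, of vP] v True
    by (intro conjI exI[of _ 0]) auto
next
  case False
  define d where "d = X - z"
  define e where "e = sgn d"
  define k where "k s = closing_speed vP vE e (a s)" for s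
  define E where "E = traj vE z a"
  have d: "0 < norm d" using False by (simp add: d_def)
  have e: "norm e = 1" "norm d *\<^sub>R e = d" using d by (auto simp: e_def norm_sgn sgn_div_norm)
  have \<alpha>01: "0 < \<alpha>" "\<alpha> < 1" using v \<alpha> by auto
  have b: "0 < 1 - \<alpha>\<^sup>2" using \<alpha>01 by (auto simp: power_less_one_iff)
  have ai: "a integrable_on {r..s}" for r s using a by (rule integrable_on_unit_control)
  have kpos: "vP - vE \<le> k s" and kle: "k s \<le> vP + vE" for s
  proof -
    have 1: "norm (k s *\<^sub>R e) = k s" using closing_speed_pos[OF v, of e "a s"] e by (simp add: k_def)
    have 2: "norm (vE *\<^sub>R a s - k s *\<^sub>R e) = vP" using norm_pursuer_velocity[OF v e(1) a(2)] by (simp add: k_def)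
    have 3: "norm (vE *\<^sub>R a s) = vE" using a v by simp
    show "vP - vE \<le> k s" using norm_triangle_ineq4[of "vE *\<^sub>R a s" "k s *\<^sub>R e"] 1 2 3 by simp
    show "k s \<le> vP + vE" using norm_triangle_ineq2[of "k s *\<^sub>R e" "vE *\<^sub>R a s"] 1 2 3 by (simp add: norm_minus_commute)
  qed
  have km: "k \<in> borel_measurable lebesgue"
  proof -
    have "closing_speed vP vE e \<in> borel_measurable borel" unfolding closing_speed_def by measurable
    from measurable_compose[OF a(1) this] show ?thesis by (simp add: k_def[abs_def])
  qed
  have ki: "k integrable_on {r..s}" for r s
  proof (rule measurable_bounded_by_integrable_imp_integrable[where g = "\<lambda>_. vP + vE"])
    show "norm (k x) \<le> vP + vE" for x using kpos[of x] kle[of x] v by simp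
  qed (use km in \<open>auto simp: measurable_restrict_space1\<close>)
  define K where "K t = integral {0..t} k" for t
  have Kd: "K t - K s = integral {s..t} k" if "0 \<le> s" "s \<le> t" for s t
    using Henstock_Kurzweil_Integration.integral_combine[OF that ki] by (simp add: K_def)
  have Kge: "(vP - vE) * (t - s) \<le> K t - K s" if "0 \<le> s" "s \<le> t" for s t
  proof -
    have "integral {s..t} (\<lambda>_. vP - vE) \<le> integral {s..t} k" by (rule integral_le[OF integrable_const_ivl ki]) (rule kpos)
    then show ?thesis unfolding Kd[OF that] using that by (simp add: mult.commute)
  qed
  have Kmono: "K s \<le> K t" if "0 \<le> s" "s \<le> t" for s t
  proof -
    have "0 \<le> (vP - vE) * (t - s)" using v that by simp
    then show ?thesis using Kge[OF that] by linarith
  qed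
  have K0: "K 0 = 0" by (simp add: K_def)
  obtain \<tau> where \<tau>: "0 \<le> \<tau>" "K \<tau> = norm d"
  proof -
    define t1 where "t1 = norm d / (vP - vE)"
    have t1: "0 \<le> t1" using v by (simp add: t1_def)
    have "norm d \<le> K t1" using Kge[of 0 t1] t1 K0 v by (simp add: t1_def)
    moreover have "continuous_on {0..t1} K" unfolding K_def by (rule indefinite_integral_continuous_1[OF ki])
    ultimately show ?thesis using IVT'[of K 0 "norm d" t1] t1 d K0 that by auto
  qed
  define \<rho> where "\<rho> t = 1 - K t / norm d" for t
  define P where "P = parallel vP vE X z a"
  have P: "P t = E t + max 0 (\<rho> t) *\<^sub>R d" for t
    by (simp add: P_def parallel_def E_def \<rho>_def K_def k_def[abs_def] e_def d_def)
  have \<rho>0: "0 \<le> \<rho> t" if "0 \<le> t" "t \<le> \<tau>" for t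
    using Kmono[OF that] \<tau> d by (simp add: \<rho>_def)
  have Pb: "P t = E t + \<rho> t *\<^sub>R d" if "0 \<le> t" "t \<le> \<tau>" for t using \<rho>0[OF that] by (simp add: P max_absorb2)
  have Pa: "P t = E t" if "\<tau> \<le> t" for t
  proof -
    have "norm d \<le> K t" using Kmono[of \<tau> t] \<tau> that by simp
    then have "\<rho> t \<le> 0" using d by (simp add: \<rho>_def)
    then show ?thesis by (simp add: P max_absorb1)
  qed
  have E_lip: "vE-lipschitz_on {0..} E" unfolding E_def using traj_lipschitz[OF a] v by simp
  have Ed: "E t - E s = vE *\<^sub>R integral {s..t} a" if "0 \<le> s" "s \<le> t" for s t
    unfolding E_def by (rule traj_diff[OF ai that])
  have \<rho>d: "\<rho> t *\<^sub>R d - \<rho> s *\<^sub>R d = - (integral {s..t} k *\<^sub>R e)" if "0 \<le> s" "s \<le> t" for s t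
  proof -
    have "\<rho> t *\<^sub>R d - \<rho> s *\<^sub>R d = (\<rho> t - \<rho> s) *\<^sub>R d" by (simp add: scaleR_diff_left)
    moreover have "\<rho> t - \<rho> s = - ((K t - K s) * inverse (norm d))" by (simp add: \<rho>_def divide_inverse left_diff_distrib)
    moreover have "inverse (norm d) *\<^sub>R d = e" by (simp add: e_def sgn_div_norm)
    ultimately show ?thesis using Kd[OF that] by (simp flip: scaleR_scaleR)
  qed
  have P_before: "norm (P t - P s) \<le> vP * (t - s)" if "0 \<le> s" "s \<le> t" "t \<le> \<tau>" for s t
  proof -
    have h: "((\<lambda>r. vE *\<^sub>R a r - k r *\<^sub>R e) has_integral (vE *\<^sub>R integral {s..t} a - integral {s..t} k *\<^sub>R e)) {s..t}"
      by (intro has_integral_diff has_integral_cmul has_integral_scaleR_left integrable_integral ai ki)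
    have "P t - P s = (E t - E s) + (\<rho> t *\<^sub>R d - \<rho> s *\<^sub>R d)" using that by (simp add: Pb)
    also have "\<dots> = vE *\<^sub>R integral {s..t} a - integral {s..t} k *\<^sub>R e" using that by (simp add: Ed \<rho>d)
    also have "\<dots> = integral {s..t} (\<lambda>r. vE *\<^sub>R a r - k r *\<^sub>R e)" using h by (simp add: integral_unique)
    also have "norm \<dots> \<le> integral {s..t} (\<lambda>_. vP)"
    proof (rule integral_norm_bound_integral)
      show "(\<lambda>r. vE *\<^sub>R a r - k r *\<^sub>R e) integrable_on {s..t}" using h by blast
      show "norm (vE *\<^sub>R a x - k x *\<^sub>R e) \<le> vP" for x using norm_pursuer_velocity[OF v e(1) a(2)] by (simp add: k_def)
    qed auto
    finally show ?thesis using that by (simp add: mult.commute)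
  qed
  have P_after: "norm (P t - P s) \<le> vP * (t - s)" if "\<tau> \<le> s" "s \<le> t" for s t
  proof -
    have "norm (E t - E s) \<le> vE * (t - s)" using lipschitz_on_normD[OF E_lip, of t s] that \<tau> by simp
    also have "\<dots> \<le> vP * (t - s)" using v that by (intro mult_right_mono) auto
    finally show ?thesis using that by (simp add: Pa)
  qed
  have P_lip: "vP-lipschitz_on {0..} P"
  proof (rule lipschitz_on_leI)
    fix s t :: real assume st: "s \<in> {0..}" "t \<in> {0..}" "s \<le> t"
    have "norm (P t - P s) \<le> vP * (t - s)"
    proof -
      consider "t \<le> \<tau>" | "\<tau> \<le> s" | "s \<le> \<tau>" "\<tau> \<le> t" by linarith
      then show ?thesis
      proof cases
        case 3
        have "norm (P t - P s) \<le> norm (P t - P \<tau>) + norm (P \<tau> - P s)"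
          using norm_triangle_ineq[of "P t - P \<tau>" "P \<tau> - P s"] by simp
        also have "\<dots> \<le> vP * (t - \<tau>) + vP * (\<tau> - s)" using P_after[of \<tau> t] P_before[of s \<tau>] 3 st by auto
        finally show ?thesis by (simp add: algebra_simps)
      qed (use P_before P_after st in auto)
    qed
    then show "dist (P s) (P t) \<le> vP * dist s t" using st by (simp add: dist_norm norm_minus_commute)
  qed (use v in auto)
  \<comment> \<open>The left side is the loss of radius, the right side the loss of distance between
    \<open>q\<close> and the centre; the latter is at most the way of the centre, which is bounded
    by the loss of radius.\<close>
  have nest: "\<alpha> / (1 - \<alpha>\<^sup>2) * (1 * norm d) - \<alpha> / (1 - \<alpha>\<^sup>2) * (\<rho> t * norm d) \<ge>
     norm ((z - q) - (\<alpha>\<^sup>2 / (1 - \<alpha>\<^sup>2) * 1) *\<^sub>R d) - norm ((E t - q) - (\<alpha>\<^sup>2 / (1 - \<alpha>\<^sup>2) * \<rho> t) *\<^sub>R d)" if t: "0 \<le> t" for t q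
  proof -
    let ?c = "\<alpha>\<^sup>2 / (1 - \<alpha>\<^sup>2)" and ?r = "\<alpha> / (1 - \<alpha>\<^sup>2)"
    have \<rho>00: "\<rho> 0 = 1" and E0: "E 0 = z" by (simp_all add: \<rho>_def K0 E_def)
    have h: "((\<lambda>r. vE *\<^sub>R a r + (?c * k r) *\<^sub>R e) has_integral (vE *\<^sub>R integral {0..t} a + (?c * integral {0..t} k) *\<^sub>R e)) {0..t}"
      by (intro has_integral_add has_integral_cmul has_integral_scaleR_left has_integral_mult_right integrable_integral ai ki)
    have "((E t - q) - (?c * \<rho> t) *\<^sub>R d) - ((z - q) - (?c * 1) *\<^sub>R d) = (E t - E 0) - ?c *\<^sub>R (\<rho> t *\<^sub>R d - \<rho> 0 *\<^sub>R d)"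
      by (simp add: \<rho>00 E0 algebra_simps)
    also have "\<dots> = vE *\<^sub>R integral {0..t} a + (?c * integral {0..t} k) *\<^sub>R e"
      unfolding \<rho>d[OF order_refl t] Ed[OF order_refl t] by simp
    also have "\<dots> = integral {0..t} (\<lambda>r. vE *\<^sub>R a r + (?c * k r) *\<^sub>R e)" using h by (simp add: integral_unique)
    also have "norm \<dots> \<le> integral {0..t} (\<lambda>r. ?r * k r)"
    proof (rule integral_norm_bound_integral)
      show "(\<lambda>r. vE *\<^sub>R a r + (?c * k r) *\<^sub>R e) integrable_on {0..t}" using h by blast
      show "(\<lambda>r. ?r * k r) integrable_on {0..t}" using integrable_cmul[OF ki, of ?r 0 t] by simp
      show "norm (vE *\<^sub>R a x + (?c * k x) *\<^sub>R e) \<le> ?r * k x" for x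
        using norm_apollonius_velocity[OF v e(1) a(2) \<alpha>] by (simp add: k_def)
    qed
    finally have A: "norm (((E t - q) - (?c * \<rho> t) *\<^sub>R d) - ((z - q) - (?c * 1) *\<^sub>R d)) \<le> ?r * K t" by (simp add: K_def)
    have "norm ((z - q) - (?c * 1) *\<^sub>R d) - norm ((E t - q) - (?c * \<rho> t) *\<^sub>R d) \<le> ?r * K t"
      using norm_triangle_ineq2[of "(z - q) - (?c * 1) *\<^sub>R d" "(E t - q) - (?c * \<rho> t) *\<^sub>R d"] A
      unfolding norm_minus_commute[of "(z - q) - (?c * 1) *\<^sub>R d"] by linarith
    moreover have "K t = 1 * norm d - \<rho> t * norm d" using d by (simp add: \<rho>_def left_diff_distrib)
    ultimately show ?thesis by (simp only: right_diff_distrib)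
  qed
  have X: "X - q = (z - q) + 1 *\<^sub>R d" for q by (simp add: d_def)
  have PE: "P t - q = (E t - q) + \<rho> t *\<^sub>R d" if "0 \<le> t" "t \<le> \<tau>" for t q using Pb[OF that] by simp
  have weak: "\<alpha> * norm (P t - q) \<le> norm (E t - q)" if "0 \<le> t" "\<alpha> * norm (X - q) \<le> norm (z - q)" for q t
  proof (cases "t \<le> \<tau>")
    case True
    have "\<alpha> / (1 - \<alpha>\<^sup>2) * (1 * norm d) \<le> norm ((z - q) - (\<alpha>\<^sup>2 / (1 - \<alpha>\<^sup>2) * 1) *\<^sub>R d)"
      using that(2) unfolding X using apollonius_iff(1)[OF \<alpha>01, of 1 "z - q" d] by simp
    then show ?thesis unfolding PE[OF that(1) True]
      using apollonius_iff(1)[OF \<alpha>01 \<rho>0[OF that(1) True], of "E t - q" d] nest[OF that(1), of q] by linarith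
  next
    case False
    then show ?thesis using \<alpha>01 by (simp add: Pa mult_left_le_one_le)
  qed
  have strict: "\<alpha> * norm (P t - q) < norm (E t - q)" if "0 \<le> t" "t \<le> \<tau>" "\<alpha> * norm (X - q) < norm (z - q)" for q t
  proof -
    have "\<alpha> / (1 - \<alpha>\<^sup>2) * (1 * norm d) < norm ((z - q) - (\<alpha>\<^sup>2 / (1 - \<alpha>\<^sup>2) * 1) *\<^sub>R d)"
      using that(3) unfolding X using apollonius_iff(2)[OF \<alpha>01, of 1 "z - q" d] by simp
    then show ?thesis unfolding PE[OF that(1,2)]
      using apollonius_iff(2)[OF \<alpha>01 \<rho>0[OF that(1,2)], of "E t - q" d] nest[OF that(1), of q] by linarith
  qed
  show ?thesis
    using P_lip \<tau>(1) Pa weak strict unfolding P_def E_def by (intro conjI exI[of _ \<tau>]) auto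
qed


section \<open>Capture times and the strategy of one pursuer\<close>

definition capture_time :: "(real \<Rightarrow> 'a) \<Rightarrow> (real \<Rightarrow> 'a) \<Rightarrow> real" where
  "capture_time P E = Inf {t. 0 \<le> t \<and> P t = E t}"

lemma capture_time:
  fixes P E :: "real \<Rightarrow> 'a::euclidean_space"
  assumes c: "continuous_on {0..} P" "continuous_on {0..} E" and t: "0 \<le> t" "P t = E t"
  shows "0 \<le> capture_time P E" "P (capture_time P E) = E (capture_time P E)" "capture_time P E \<le> t"
proof -
  let ?S = "{t. 0 \<le> t \<and> P t = E t}"
  have ne: "?S \<noteq> {}" using t by blast
  have bd: "bdd_below ?S" by (rule bdd_belowI[of _ 0]) auto
  have "closed {s \<in> {0..}. P s - E s = 0}"
    by (intro continuous_closed_preimage_constant continuous_on_diff c) auto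
  moreover have "{s \<in> {0..}. P s - E s = 0} = ?S" by auto
  ultimately have "closed ?S" by simp
  then have "Inf ?S \<in> ?S" using ne bd by (intro closed_contains_Inf)
  then show "0 \<le> capture_time P E" "P (capture_time P E) = E (capture_time P E)" by (auto simp: capture_time_def)
  show "capture_time P E \<le> t" unfolding capture_time_def using bd t by (intro cInf_lower) auto
qed

text \<open>Whether capture has occurred is decided by the past, so a non-anticipative strategy may
  switch its control at that time.\<close>

lemma capture_time_cong:
  fixes P E P' E' :: "real \<Rightarrow> 'a::euclidean_space"
  assumes c: "continuous_on {0..} P" "continuous_on {0..} E" "continuous_on {0..} P'" "continuous_on {0..} E'"
    and ex: "\<exists>t\<ge>0. P t = E t" "\<exists>t\<ge>0. P' t = E' t"
    and eq: "\<And>s. 0 \<le> s \<Longrightarrow> s \<le> t \<Longrightarrow> P s = P' s" "\<And>s. 0 \<le> s \<Longrightarrow> s \<le> t \<Longrightarrow> E s = E' s"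
    and le: "capture_time P E \<le> t"
  shows "capture_time P' E' = capture_time P E"
proof (rule antisym)
  obtain r where r: "0 \<le> r" "P r = E r" using ex by blast
  obtain r' where r': "0 \<le> r'" "P' r' = E' r'" using ex by blast
  note C = capture_time[OF c(1,2) r] and C' = capture_time[OF c(3,4) r']
  show 1: "capture_time P' E' \<le> capture_time P E"
    using C le eq by (intro capture_time(3)[OF c(3,4)]) auto
  show "capture_time P E \<le> capture_time P' E'"
    using C' le 1 eq by (intro capture_time(3)[OF c(1,2)]) auto
qed

text \<open>The last two clauses serve the two winning regions: capture no later than arrival denies
  the evader its win, capture strictly before arrival is a win of the pursuer. \<open>e0\<close> and
  \<open>e1\<close> guarantee room to keep moving after the capture.\<close>

lemma pursuer_strategy:
  fixes D T :: "(real^2) set" and X z :: "real^2"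
  assumes D: "convex D" and T: "T \<subseteq> D" "compact T" and e: "e0 \<in> D" "e1 \<in> D" "e0 \<noteq> e1"
    and X: "X \<in> D" and v: "0 < vE" "vE < vP" and \<alpha>: "\<alpha> = vE / vP"
  shows "\<exists>\<beta>. (\<forall>a\<in>admissible D vE z. \<beta> a \<in> admissible D vP X) \<and>
    (\<forall>a\<in>admissible D vE z. \<forall>a'\<in>admissible D vE z. \<forall>t\<ge>0.
       (AE s in lebesgue. s \<in> {0..t} \<longrightarrow> a s = a' s) \<longrightarrow> (AE s in lebesgue. s \<in> {0..t} \<longrightarrow> \<beta> a s = \<beta> a' s)) \<and>
    (\<forall>a\<in>admissible D vE z. \<exists>tc\<ge>0. traj vP X (\<beta> a) tc = traj vE z a tc \<and>
       (\<forall>t\<ge>0. \<forall>q\<in>T. traj vE z a t = q \<longrightarrow> \<alpha> * norm (X - q) \<le> norm (z - q) \<longrightarrow> tc \<le> t) \<and>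
       (\<forall>t\<ge>0. \<forall>q\<in>T. traj vE z a t = q \<longrightarrow> \<alpha> * norm (X - q) < norm (z - q) \<longrightarrow> tc < t))"
proof -
  define C where "C = convex hull (insert X T)"
  have C: "convex C" "closed C" "X \<in> C" "T \<subseteq> C" "C \<subseteq> D"
  proof -
    show "closed C" unfolding C_def using T(2) by (intro compact_imp_closed compact_convex_hull compact_insert)
    show "X \<in> C" "T \<subseteq> C" unfolding C_def by (auto intro: hull_inc)
    show "C \<subseteq> D" unfolding C_def using X T D by (intro hull_minimal) auto
  qed (simp add: C_def)
  have Cne: "C \<noteq> {}" using C by auto
  have \<alpha>pos: "0 < \<alpha>" using v \<alpha> by simp
  define E where "E = traj vE z"
  define PP where "PP = parallel vP vE X z"
  define \<gamma> where "\<gamma> a t = closest_point C (PP a t)" for a t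
  define Q where "Q a = shrink (E a) (\<gamma> a) (lead vP (E a) (\<gamma> a))" for a
  define tc where "tc a = capture_time (Q a) (E a)" for a
  \<comment> \<open>Chosen for each \<open>a\<close> separately, so nothing links the choices for
    controls with a common past; \<open>AE_eq_of_traj_eq\<close> restores the link below.\<close>
  define ctrl where "ctrl a = (SOME u. u \<in> borel_measurable lebesgue \<and> (\<forall>t. norm (u t) = 1) \<and> (\<forall>t\<in>{0..tc a}. traj vP X u t = Q a t))" for a
  \<comment> \<open>Depends on the place of capture only, hence agrees for controls that agree up to
    the capture.\<close>
  define rest where "rest y = (SOME c. c \<in> admissible D vP y)" for y
  define \<beta> where "\<beta> a = splice (tc a) (ctrl a) (rest (E a (tc a)))" for a
  have cp: "norm (closest_point C x - closest_point C y) \<le> norm (x - y)" for x y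
    using closest_point_lipschitz[OF C(1,2) Cne, of x y] by (simp add: dist_norm)
  have adm: "a \<in> borel_measurable lebesgue" "\<And>t. norm (a t) = 1" "\<And>t. 0 \<le> t \<Longrightarrow> E a t \<in> D"
    if "a \<in> admissible D vE z" for a
    using that by (auto simp: admissible_def E_def)
  have track: "tracking (E a) (\<gamma> a) vE vP" if a: "a \<in> admissible D vE z" for a
  proof
    show "vE-lipschitz_on {0..} (E a)" unfolding E_def using traj_lipschitz[OF adm(1,2)[OF a]] v by simp
    have P: "vP-lipschitz_on {0..} (PP a)" unfolding PP_def using parallel_pursuit[OF v adm(1,2)[OF a] \<alpha>] by blast
    show "vP-lipschitz_on {0..} (\<gamma> a)"
    proof (rule lipschitz_onI)
      fix s t :: real assume st: "s \<in> {0..}" "t \<in> {0..}"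
      have "dist (\<gamma> a s) (\<gamma> a t) \<le> dist (PP a s) (PP a t)" unfolding \<gamma>_def dist_norm by (rule cp)
      also have "\<dots> \<le> vP * dist s t" using lipschitz_onD[OF P] st by blast
      finally show "dist (\<gamma> a s) (\<gamma> a t) \<le> vP * dist s t" .
    qed (use v in auto)
  qed (use v in auto)
  have Q0: "Q a 0 = X" if a: "a \<in> admissible D vE z" for a
    using tracking.Q_0[OF track[OF a]] C by (simp add: Q_def \<gamma>_def PP_def parallel_0 closest_point_self)
  have QD: "Q a t \<in> D" if a: "a \<in> admissible D vE z" and t: "0 \<le> t" for a t
  proof -
    have "\<gamma> a t \<in> D" using closest_point_in_set[OF C(2) Cne] C by (auto simp: \<gamma>_def)
    moreover have "Q a t = (1 - lead vP (E a) (\<gamma> a) t) *\<^sub>R E a t + lead vP (E a) (\<gamma> a) t *\<^sub>R \<gamma> a t"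
      by (simp add: Q_def shrink_def algebra_simps)
    ultimately show ?thesis
      using D adm(3)[OF a t] tracking.lead_nonneg[OF track[OF a] t] tracking.lead_le_1[OF track[OF a] t]
      by (simp add: convex_alt)
  qed
  have cont: "continuous_on {0..} (Q a)" "continuous_on {0..} (E a)" if a: "a \<in> admissible D vE z" for a
    using tracking.Q_lip[OF track[OF a]] tracking.E_lip[OF track[OF a]]
    by (auto simp: Q_def intro: lipschitz_on_continuous_on)
  obtain \<tau> where \<tau>: "\<And>a. a \<in> admissible D vE z \<Longrightarrow> 0 \<le> \<tau> a"
    "\<And>a t. a \<in> admissible D vE z \<Longrightarrow> \<tau> a \<le> t \<Longrightarrow> PP a t = E a t"
    "\<And>a q t. a \<in> admissible D vE z \<Longrightarrow> 0 \<le> t \<Longrightarrow> \<alpha> * norm (X - q) \<le> norm (z - q) \<Longrightarrow> \<alpha> * norm (PP a t - q) \<le> norm (E a t - q)"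
    "\<And>a q t. a \<in> admissible D vE z \<Longrightarrow> 0 \<le> t \<Longrightarrow> t \<le> \<tau> a \<Longrightarrow> \<alpha> * norm (X - q) < norm (z - q) \<Longrightarrow> \<alpha> * norm (PP a t - q) < norm (E a t - q)"
  proof -
    have "\<forall>a\<in>admissible D vE z. \<exists>\<tau>\<ge>0. (\<forall>t\<ge>\<tau>. PP a t = E a t) \<and>
      (\<forall>q t. 0 \<le> t \<longrightarrow> \<alpha> * norm (X - q) \<le> norm (z - q) \<longrightarrow> \<alpha> * norm (PP a t - q) \<le> norm (E a t - q)) \<and>
      (\<forall>q t. 0 \<le> t \<longrightarrow> t \<le> \<tau> \<longrightarrow> \<alpha> * norm (X - q) < norm (z - q) \<longrightarrow> \<alpha> * norm (PP a t - q) < norm (E a t - q))"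
      unfolding PP_def E_def by (intro ballI conjunct2[OF parallel_pursuit[OF v _ _ \<alpha>]] adm(1,2))
    from bchoice[OF this] obtain \<tau> where h: "\<forall>a\<in>admissible D vE z. 0 \<le> \<tau> a \<and> (\<forall>t\<ge>\<tau> a. PP a t = E a t) \<and>
      (\<forall>q t. 0 \<le> t \<longrightarrow> \<alpha> * norm (X - q) \<le> norm (z - q) \<longrightarrow> \<alpha> * norm (PP a t - q) \<le> norm (E a t - q)) \<and>
      (\<forall>q t. 0 \<le> t \<longrightarrow> t \<le> \<tau> a \<longrightarrow> \<alpha> * norm (X - q) < norm (z - q) \<longrightarrow> \<alpha> * norm (PP a t - q) < norm (E a t - q))" ..
    show ?thesis by (rule that[of \<tau>]) (simp_all add: h)
  qed
  \<comment> \<open>After \<open>\<tau> a\<close> parallel pursuit has caught the evader, but the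
    evader may be outside \<open>C\<close>. The guide, its projection, can then still differ from
    it, but is no faster.\<close>
  have \<gamma>w: "vE-lipschitz_on {\<tau> a..} (\<gamma> a)" if a: "a \<in> admissible D vE z" for a
  proof (rule lipschitz_onI)
    fix s t assume st: "s \<in> {\<tau> a..}" "t \<in> {\<tau> a..}"
    have "dist (\<gamma> a s) (\<gamma> a t) \<le> dist (E a s) (E a t)"
      unfolding \<gamma>_def dist_norm using cp \<tau>(2)[OF a] st by simp
    also have "\<dots> \<le> vE * dist s t"
      using lipschitz_onD[OF tracking.E_lip[OF track[OF a]], of s t] st \<tau>(1)[OF a] by auto
    finally show "dist (\<gamma> a s) (\<gamma> a t) \<le> vE * dist s t" .
  qed (use v in auto)
  have ex: "\<exists>t\<ge>0. Q a t = E a t" if a: "a \<in> admissible D vE z" for a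
    using tracking.eventually_captured[OF track[OF a] \<tau>(1)[OF a] \<gamma>w[OF a]] \<tau>(1)[OF a] unfolding Q_def
    by (meson order_trans)
  have tc: "0 \<le> tc a" "Q a (tc a) = E a (tc a)" "\<And>t. 0 \<le> t \<Longrightarrow> Q a t = E a t \<Longrightarrow> tc a \<le> t"
    if a: "a \<in> admissible D vE z" for a
    using ex[OF a] capture_time[OF cont[OF a]] unfolding tc_def by blast+
  have ctrl: "ctrl a \<in> borel_measurable lebesgue" "\<And>t. norm (ctrl a t) = 1"
     "\<And>t. t \<in> {0..tc a} \<Longrightarrow> traj vP X (ctrl a) t = Q a t" if a: "a \<in> admissible D vE z" for a
  proof -
    interpret tracking "E a" "\<gamma> a" vE vP by (rule track[OF a])
    obtain g where g: "g \<in> borel_measurable borel" "\<And>t. norm (g t) \<le> vP"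
      "\<And>s t. 0 \<le> s \<Longrightarrow> s \<le> t \<Longrightarrow> (g has_integral (Q a t - Q a s)) {s..t}"
      using lipschitz_density[OF Q_lip] unfolding Q_def by blast
    have "AE t in lebesgue. t \<in> {0..tc a} \<longrightarrow> norm (g t) = vP"
      using tc(3)[OF a] g by (intro Q_speed) (force simp: Q_def)+
    then have "\<exists>u. u \<in> borel_measurable lebesgue \<and> (\<forall>t. norm (u t) = 1) \<and> (\<forall>t\<in>{0..tc a}. traj vP (Q a 0) u t = Q a t)"
      using g v by (intro realize_unit_speed[of g]) auto
    then have "\<exists>u. u \<in> borel_measurable lebesgue \<and> (\<forall>t. norm (u t) = 1) \<and> (\<forall>t\<in>{0..tc a}. traj vP X u t = Q a t)"
      by (simp add: Q0[OF a])
    from someI_ex[OF this] show "ctrl a \<in> borel_measurable lebesgue" "\<And>t. norm (ctrl a t) = 1"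
      "\<And>t. t \<in> {0..tc a} \<Longrightarrow> traj vP X (ctrl a) t = Q a t" unfolding ctrl_def by blast+
  qed
  have rest: "rest y \<in> admissible D vP y" if "y \<in> D" for y
  proof -
    have "\<exists>c. c \<in> admissible D vP y" using keep_moving[OF D e that, of vP] v by simp
    then show ?thesis unfolding rest_def by (rule someI_ex)
  qed
  have 1: "\<beta> a \<in> admissible D vP X" if a: "a \<in> admissible D vE z" for a
    unfolding \<beta>_def
  proof (rule splice_admissible)
    show "rest (E a (tc a)) \<in> admissible D vP (traj vP X (ctrl a) (tc a))"
      using ctrl(3)[OF a, of "tc a"] tc(1,2)[OF a] rest adm(3)[OF a] by simp
  qed (use ctrl[OF a] QD[OF a] tc[OF a] in auto)
  have 2: "AE s in lebesgue. s \<in> {0..t} \<longrightarrow> \<beta> a s = \<beta> a' s"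
    if a: "a \<in> admissible D vE z" and a': "a' \<in> admissible D vE z" and t: "0 \<le> t"
      and ae: "AE s in lebesgue. s \<in> {0..t} \<longrightarrow> a s = a' s" for a a' t
  proof -
    have Eeq: "E a s = E a' s" if "s \<le> t" for s unfolding E_def by (rule traj_cong_AE[OF ae that])
    have \<gamma>eq: "\<gamma> a s = \<gamma> a' s" if "s \<le> t" for s
      unfolding \<gamma>_def PP_def by (simp add: parallel_cong_AE[OF ae that])
    have Qeq: "Q a s = Q a' s" if "s \<le> t" for s
    proof -
      have "lead vP (E a) (\<gamma> a) s = lead vP (E a') (\<gamma> a') s" using that by (intro lead_cong Eeq \<gamma>eq) auto
      then show ?thesis by (simp add: Q_def shrink_def Eeq \<gamma>eq that)
    qed
    have ctrl_eq: "AE s in lebesgue. s \<in> {0..r} \<longrightarrow> ctrl a s = ctrl a' s" if "r \<le> t" "r \<le> tc a" "r \<le> tc a'" for r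
    proof (rule AE_eq_of_traj_eq[of _ r _ vP X])
      fix s assume s: "s \<in> {0..r}"
      then show "traj vP X (ctrl a) s = traj vP X (ctrl a') s"
        using ctrl(3)[OF a, of s] ctrl(3)[OF a', of s] Qeq[of s] that by simp
    qed (use v ctrl a a' in \<open>auto intro: integrable_on_unit_control\<close>)
    show ?thesis
    \<comment> \<open>If one of the captures happens by time \<open>t\<close>, both happen at the
      same time and place and the same \<open>rest\<close> follows; otherwise only the first phases
      matter.\<close>
    proof (cases "tc a \<le> t \<or> tc a' \<le> t")
      case True
      have eq: "tc a' = tc a"
        using True
      proof
        assume "tc a \<le> t"
        then show ?thesis unfolding tc_def
          using cont[OF a] cont[OF a'] ex[OF a] ex[OF a'] Qeq Eeq by (intro capture_time_cong[where t = t]) auto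
      next
        assume "tc a' \<le> t"
        then show ?thesis unfolding tc_def
          using cont[OF a] cont[OF a'] ex[OF a] ex[OF a'] Qeq Eeq
          by (intro capture_time_cong[where t = t, symmetric]) (auto dest: sym)
      qed
      then have "tc a \<le> t" using True by simp
      then have "AE s in lebesgue. s \<in> {0..tc a} \<longrightarrow> ctrl a s = ctrl a' s" using ctrl_eq[of "tc a"] eq by simp
      then show ?thesis
        by eventually_elim (auto simp: \<beta>_def splice_def eq Eeq[OF \<open>tc a \<le> t\<close>])
    next
      case False
      then have "AE s in lebesgue. s \<in> {0..t} \<longrightarrow> ctrl a s = ctrl a' s" using ctrl_eq[of t] by simp
      then show ?thesis
        by eventually_elim (use False in \<open>auto simp: \<beta>_def splice_def\<close>)
    qed
  qed
  have 3: "traj vP X (\<beta> a) (tc a) = E a (tc a)" if a: "a \<in> admissible D vE z" for a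
    unfolding \<beta>_def using ctrl(3)[OF a, of "tc a"] tc(1,2)[OF a] by (simp add: traj_splice_before)
  have meet: "\<gamma> a t = q" if "PP a t = q" "q \<in> T" for a t q
    using that C by (auto simp: \<gamma>_def closest_point_self)
  have 4: "tc a \<le> t" if a: "a \<in> admissible D vE z" and t: "0 \<le> t" and q: "q \<in> T" "E a t = q"
      and le: "\<alpha> * norm (X - q) \<le> norm (z - q)" for a t q
  proof -
    have "\<alpha> * norm (PP a t - q) \<le> 0" using \<tau>(3)[OF a t le] q by simp
    then have "PP a t = q" using \<alpha>pos by (simp add: mult_le_0_iff)
    then have "\<gamma> a t = E a t" using meet q by simp
    then show ?thesis using tc(3)[OF a t] by (simp add: Q_def shrink_def)
  qed
  have 5: "tc a < t" if a: "a \<in> admissible D vE z" and t: "0 \<le> t" and q: "q \<in> T" "E a t = q"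
      and less: "\<alpha> * norm (X - q) < norm (z - q)" for a t q
  proof -
    \<comment> \<open>Strictness keeps the evader away from \<open>q\<close> until parallel pursuit
      is over, which leaves a period before the arrival in which the reserve of speed is
      available.\<close>
    have late: "\<tau> a < t"
    proof (rule ccontr)
      assume "\<not> \<tau> a < t"
      then have "\<alpha> * norm (PP a t - q) < 0" using \<tau>(4)[OF a t _ less] q by simp
      then show False using \<alpha>pos by (simp add: mult_less_0_iff)
    qed
    then have "\<gamma> a t = E a t" using \<tau>(2)[OF a, of t] meet q by simp
    then obtain s where "\<tau> a \<le> s" "s < t" "Q a s = E a s"
      using tracking.captured_before_meeting[OF track[OF a] \<tau>(1)[OF a] late \<gamma>w[OF a]] unfolding Q_def by blast
    then show ?thesis using tc(3)[OF a, of s] \<tau>(1)[OF a] by simp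
  qed
  show ?thesis
    using 1 2 tc(1) 3 4 5 unfolding E_def by (intro exI[of _ \<beta>] conjI ballI allI impI; blast)
qed

section \<open>The winning regions of a coalition\<close>

text \<open>Common frame for the bounded game and the game in the plane. By \<open>entry\<close> the
  evader gets into \<open>R\<close> only across \<open>T\<close>, so only points of \<open>T\<close>
  have to be guarded; \<open>two\<close> leaves every player room to move.\<close>

locale reach_avoid =
  fixes D R T :: "(real^2) set" and vP vE \<alpha> :: real and K :: "nat set" and X :: "nat \<Rightarrow> real^2"
  assumes D: "convex D" and T: "T \<subseteq> D" "T \<subseteq> R" "compact T" and two: "\<exists>e0\<in>T. \<exists>e1\<in>T. e0 \<noteq> e1"
    and R: "closed R" and v: "0 < vE" "vE < vP" and \<alpha>: "\<alpha> = vE / vP"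
    and K: "finite K" "K \<noteq> {}" and X: "\<And>i. i \<in> K \<Longrightarrow> X i \<in> D"
    and entry: "\<And>(c :: real \<Rightarrow> real^2) t. 0 \<le> t \<Longrightarrow> continuous_on {0..t} c \<Longrightarrow> (\<And>s. s \<in> {0..t} \<Longrightarrow> c s \<in> D) \<Longrightarrow>
       c 0 \<notin> R \<Longrightarrow> c t \<in> R \<Longrightarrow> \<exists>s\<in>{0..t}. c s \<in> T"
begin

lemma le_alpha_iff: "p \<le> \<alpha> * r \<longleftrightarrow> vP * p \<le> vE * r" "p < \<alpha> * r \<longleftrightarrow> vP * p < vE * r"
  using v by (simp_all add: \<alpha> pos_le_divide_eq pos_less_divide_eq mult.commute)

lemma evader_lip: "a \<in> admissible D vE z \<Longrightarrow> vE-lipschitz_on {0..} (traj vE z a)"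
  using v by (intro traj_lipschitz) (auto simp: admissible_def)

lemma pursuer_lip: "u \<in> admissible D vP x \<Longrightarrow> vP-lipschitz_on {0..} (traj vP x u)"
  using v by (intro traj_lipschitz) (auto simp: admissible_def)

lemma strategy_admissible:
  "\<beta> \<in> coalition_strategies D vP vE K X z \<Longrightarrow> a \<in> admissible D vE z \<Longrightarrow> i \<in> K \<Longrightarrow> \<beta> a i \<in> admissible D vP (X i)"
  by (auto simp: coalition_strategies_def)

lemma move_on: "y \<in> D \<Longrightarrow> 0 < w \<Longrightarrow> \<exists>c. c \<in> admissible D w y"
  using two T(1) keep_moving[OF D, of _ _ y w] by blast

text \<open>The last clause speaks of any control that agrees almost everywhere with the heading,
  because a feedback law determines the control only in this sense.\<close>

lemma run_straight:
  assumes z: "z \<in> D - R" and q: "q \<in> T"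
  defines "c \<equiv> sgn (q - z)" and "t1 \<equiv> norm (q - z) / vE"
  shows "norm c = 1" "0 < t1" "z + (vE * t1) *\<^sub>R c = q"
    and "\<exists>a\<in>admissible D vE z. \<forall>t<t1. a t = c"
    and "\<And>a t. 0 \<le> t \<Longrightarrow> AE s in lebesgue. s \<in> {0..t} \<longrightarrow> a s = c \<Longrightarrow> traj vE z a t = z + (vE * t) *\<^sub>R c"
proof -
  have ne: "q \<noteq> z" using z q T by auto
  show c: "norm c = 1" using ne by (simp add: c_def norm_sgn)
  show t1: "0 < t1" using ne v by (simp add: t1_def)
  show qe: "z + (vE * t1) *\<^sub>R c = q" using ne v by (simp add: t1_def c_def sgn_div_norm)
  show tr: "traj vE z a t = z + (vE * t) *\<^sub>R c" if "0 \<le> t" "AE s in lebesgue. s \<in> {0..t} \<longrightarrow> a s = c" for a t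
  proof -
    have "traj vE z a t = traj vE z (\<lambda>_. c) t" by (rule traj_cong_AE[OF that(2)]) simp
    then show ?thesis using that(1) by (simp add: traj_def)
  qed
  \<comment> \<open>An admissible control does not end at \<open>q\<close>, so some further motion
    in \<open>D\<close> is appended.\<close>
  obtain r where r: "r \<in> admissible D vE q" using move_on[of q vE] v q T by blast
  have "splice t1 (\<lambda>_. c) r \<in> admissible D vE z"
  proof (rule splice_admissible)
    fix t assume t: "t \<in> {0..t1}"
    have "traj vE z (\<lambda>_. c) t = z + (vE * t) *\<^sub>R c" using t by (intro tr) auto
    also have "\<dots> = (1 - t / t1) *\<^sub>R z + (t / t1) *\<^sub>R q" using t1 by (simp add: qe[symmetric] algebra_simps)
    also have "\<dots> \<in> D" using D z q T t t1 by (intro convexD_alt) auto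
    finally show "traj vE z (\<lambda>_. c) t \<in> D" .
  next
    have "traj vE z (\<lambda>_. c) t1 = q" using tr[of t1 "\<lambda>_. c"] t1 qe by simp
    then show "r \<in> admissible D vE (traj vE z (\<lambda>_. c) t1)" using r by simp
  qed (use c t1 in auto)
  then show "\<exists>a\<in>admissible D vE z. \<forall>t<t1. a t = c" by (intro bexI[of _ "splice t1 (\<lambda>_. c) r"]) (auto simp: splice_def)
qed

text \<open>A pursuer that meets the evader on the way to \<open>q\<close> could reach \<open>q\<close> no later than the evader.\<close>

lemma too_late:
  assumes z: "z \<in> D - R" and q: "q \<in> T" and u: "u \<in> admissible D vP x" and t: "0 \<le> t" "t \<le> norm (q - z) / vE"
    and far: "norm (z - q) \<le> \<alpha> * norm (x - q)" and strict: "t < norm (q - z) / vE \<or> norm (z - q) < \<alpha> * norm (x - q)"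
  shows "traj vP x u t \<noteq> z + (vE * t) *\<^sub>R sgn (q - z)"
proof
  define t1 where "t1 = norm (q - z) / vE"
  assume eq: "traj vP x u t = z + (vE * t) *\<^sub>R sgn (q - z)"
  have nq: "norm (z - q) = vE * t1" using v by (simp add: t1_def norm_minus_commute)
  have "traj vP x u t - q = - ((vE * (t1 - t)) *\<^sub>R sgn (q - z))"
    unfolding eq using run_straight(3)[OF z q] by (simp add: t1_def algebra_simps)
  then have 1: "norm (traj vP x u t - q) = vE * (t1 - t)"
    using run_straight(1)[OF z q] v t by (simp add: t1_def)
  have 2: "norm (x - traj vP x u t) \<le> vP * t"
    using lipschitz_on_normD[OF pursuer_lip[OF u], of 0 t] t by (simp add: norm_minus_commute)
  have "norm (x - q) \<le> vP * t + vE * (t1 - t)"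
    using norm_triangle_ineq[of "x - traj vP x u t" "traj vP x u t - q"] 1 2 by simp
  also have "\<dots> = vP * t1 - (vP - vE) * (t1 - t)" by (simp add: algebra_simps)
  finally have le: "norm (x - q) \<le> vP * t1 - (vP - vE) * (t1 - t)" .
  have m: "0 \<le> (vP - vE) * (t1 - t)" using v t by (simp add: t1_def)
  have "vP * (vE * t1) \<le> vE * norm (x - q)" using far nq le_alpha_iff(1) by simp
  then have ge: "vP * t1 \<le> norm (x - q)" using v by (simp add: mult.left_commute[of vP vE])
  from strict show False
  proof
    assume "t < norm (q - z) / vE"
    then have "0 < (vP - vE) * (t1 - t)" using v by (simp add: t1_def)
    then show False using le ge by linarith
  next
    assume "norm (z - q) < \<alpha> * norm (x - q)"
    then have "vP * (vE * t1) < vE * norm (x - q)" using nq le_alpha_iff(2) by simp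
    then have "vP * t1 < norm (x - q)" using v by (simp add: mult.left_commute[of vP vE])
    then show False using le m by linarith
  qed
qed

text \<open>The members do not coordinate: each runs \<open>pursuer_strategy\<close> for itself, and
  a point of \<open>T\<close> is guarded as soon as one member guards it.\<close>

lemma coalition_strategy:
  shows "\<exists>\<beta>\<in>coalition_strategies D vP vE K X z. \<forall>a\<in>admissible D vE z. \<exists>tc. (\<forall>i\<in>K. 0 \<le> tc i) \<and>
    (\<forall>i\<in>K. traj vP (X i) (\<beta> a i) (tc i) = traj vE z a (tc i)) \<and>
    (\<forall>i\<in>K. \<forall>t\<ge>0. traj vE z a t \<in> T \<longrightarrow> \<alpha> * norm (X i - traj vE z a t) \<le> norm (z - traj vE z a t) \<longrightarrow> tc i \<le> t) \<and>
    (\<forall>i\<in>K. \<forall>t\<ge>0. traj vE z a t \<in> T \<longrightarrow> \<alpha> * norm (X i - traj vE z a t) < norm (z - traj vE z a t) \<longrightarrow> tc i < t)"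
proof -
  obtain e0 e1 where e: "e0 \<in> D" "e1 \<in> D" "e0 \<noteq> e1" using two T(1) by blast
  have "\<forall>i\<in>K. \<exists>\<beta>. (\<forall>a\<in>admissible D vE z. \<beta> a \<in> admissible D vP (X i)) \<and>
    (\<forall>a\<in>admissible D vE z. \<forall>a'\<in>admissible D vE z. \<forall>t\<ge>0.
       (AE s in lebesgue. s \<in> {0..t} \<longrightarrow> a s = a' s) \<longrightarrow> (AE s in lebesgue. s \<in> {0..t} \<longrightarrow> \<beta> a s = \<beta> a' s)) \<and>
    (\<forall>a\<in>admissible D vE z. \<exists>tc\<ge>0. traj vP (X i) (\<beta> a) tc = traj vE z a tc \<and>
       (\<forall>t\<ge>0. \<forall>q\<in>T. traj vE z a t = q \<longrightarrow> \<alpha> * norm (X i - q) \<le> norm (z - q) \<longrightarrow> tc \<le> t) \<and>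
       (\<forall>t\<ge>0. \<forall>q\<in>T. traj vE z a t = q \<longrightarrow> \<alpha> * norm (X i - q) < norm (z - q) \<longrightarrow> tc < t))"
    by (intro ballI pursuer_strategy[OF D T(1,3) e X v \<alpha>])
  from bchoice[OF this] obtain b where b: "\<forall>i\<in>K. (\<forall>a\<in>admissible D vE z. b i a \<in> admissible D vP (X i)) \<and>
    (\<forall>a\<in>admissible D vE z. \<forall>a'\<in>admissible D vE z. \<forall>t\<ge>0.
       (AE s in lebesgue. s \<in> {0..t} \<longrightarrow> a s = a' s) \<longrightarrow> (AE s in lebesgue. s \<in> {0..t} \<longrightarrow> b i a s = b i a' s)) \<and>
    (\<forall>a\<in>admissible D vE z. \<exists>tc\<ge>0. traj vP (X i) (b i a) tc = traj vE z a tc \<and>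
       (\<forall>t\<ge>0. \<forall>q\<in>T. traj vE z a t = q \<longrightarrow> \<alpha> * norm (X i - q) \<le> norm (z - q) \<longrightarrow> tc \<le> t) \<and>
       (\<forall>t\<ge>0. \<forall>q\<in>T. traj vE z a t = q \<longrightarrow> \<alpha> * norm (X i - q) < norm (z - q) \<longrightarrow> tc < t))" ..
  define \<beta> where "\<beta> a i = b i a" for a i
  have "\<beta> \<in> coalition_strategies D vP vE K X z"
    unfolding coalition_strategies_def \<beta>_def using b by simp
  moreover have "\<exists>tc. \<forall>i\<in>K. 0 \<le> tc i \<and>
    traj vP (X i) (\<beta> a i) (tc i) = traj vE z a (tc i) \<and>
    (\<forall>t\<ge>0. \<forall>q\<in>T. traj vE z a t = q \<longrightarrow> \<alpha> * norm (X i - q) \<le> norm (z - q) \<longrightarrow> tc i \<le> t) \<and>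
    (\<forall>t\<ge>0. \<forall>q\<in>T. traj vE z a t = q \<longrightarrow> \<alpha> * norm (X i - q) < norm (z - q) \<longrightarrow> tc i < t)"
    if a: "a \<in> admissible D vE z" for a
    unfolding \<beta>_def by (rule bchoice) (use b a in simp)
  ultimately show ?thesis
  proof (intro bexI[of _ \<beta>] ballI)
    fix a assume h: "\<And>a. a \<in> admissible D vE z \<Longrightarrow> \<exists>tc. \<forall>i\<in>K. 0 \<le> tc i \<and>
    traj vP (X i) (\<beta> a i) (tc i) = traj vE z a (tc i) \<and>
    (\<forall>t\<ge>0. \<forall>q\<in>T. traj vE z a t = q \<longrightarrow> \<alpha> * norm (X i - q) \<le> norm (z - q) \<longrightarrow> tc i \<le> t) \<and>
    (\<forall>t\<ge>0. \<forall>q\<in>T. traj vE z a t = q \<longrightarrow> \<alpha> * norm (X i - q) < norm (z - q) \<longrightarrow> tc i < t)" and a: "a \<in> admissible D vE z"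
    from h[OF a] obtain tc where "\<forall>i\<in>K. 0 \<le> tc i \<and>
    traj vP (X i) (\<beta> a i) (tc i) = traj vE z a (tc i) \<and>
    (\<forall>t\<ge>0. \<forall>q\<in>T. traj vE z a t = q \<longrightarrow> \<alpha> * norm (X i - q) \<le> norm (z - q) \<longrightarrow> tc i \<le> t) \<and>
    (\<forall>t\<ge>0. \<forall>q\<in>T. traj vE z a t = q \<longrightarrow> \<alpha> * norm (X i - q) < norm (z - q) \<longrightarrow> tc i < t)" ..
    then show "\<exists>tc. (\<forall>i\<in>K. 0 \<le> tc i) \<and>
    (\<forall>i\<in>K. traj vP (X i) (\<beta> a i) (tc i) = traj vE z a (tc i)) \<and>
    (\<forall>i\<in>K. \<forall>t\<ge>0. traj vE z a t \<in> T \<longrightarrow> \<alpha> * norm (X i - traj vE z a t) \<le> norm (z - traj vE z a t) \<longrightarrow> tc i \<le> t) \<and>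
    (\<forall>i\<in>K. \<forall>t\<ge>0. traj vE z a t \<in> T \<longrightarrow> \<alpha> * norm (X i - traj vE z a t) < norm (z - traj vE z a t) \<longrightarrow> tc i < t)"
      by (intro exI[of _ tc] conjI) simp_all
  qed
qed

lemma enters_through_T:
  assumes z: "z \<in> D - R" and a: "a \<in> admissible D vE z" and t: "0 \<le> t" "traj vE z a t \<in> R"
  shows "\<exists>s\<in>{0..t}. traj vE z a s \<in> T"
proof (rule entry[OF t(1)])
  show "continuous_on {0..t} (traj vE z a)"
    by (rule continuous_on_subset[OF lipschitz_on_continuous_on[OF evader_lip[OF a]]]) auto
qed (use z a t in \<open>auto simp: admissible_def\<close>)

text \<open>If nobody guards \<open>q\<close> strictly, the straight run to \<open>q\<close> meets
  nobody before it arrives. Otherwise the earliest capture wins: an entry by that time would cross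
  \<open>T\<close> at a guarded point, whose guard has met the evader even before.\<close>

lemma pursuit_region:
  "pursuit_winning_region D R vP vE K X = {z \<in> D - R. \<forall>q\<in>T. \<exists>i\<in>K. \<alpha> * norm (X i - q) < norm (z - q)}"
proof (intro set_eqI iffI)
  fix z assume "z \<in> pursuit_winning_region D R vP vE K X"
  then obtain \<beta> where z: "z \<in> D - R" and \<beta>: "\<beta> \<in> coalition_strategies D vP vE K X z"
    and win: "\<And>a. a \<in> admissible D vE z \<Longrightarrow> pursuers_win D R K (\<lambda>i. traj vP (X i) (\<beta> a i)) (traj vE z a)"
    unfolding pursuit_winning_region_def by blast
  have "\<exists>i\<in>K. \<alpha> * norm (X i - q) < norm (z - q)" if q: "q \<in> T" for q
  proof (rule ccontr)
    assume "\<not> (\<exists>i\<in>K. \<alpha> * norm (X i - q) < norm (z - q))"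
    then have far: "norm (z - q) \<le> \<alpha> * norm (X i - q)" if "i \<in> K" for i using that by force
    define t1 where "t1 = norm (q - z) / vE"
    note run = run_straight[OF z q, folded t1_def]
    obtain a where a: "a \<in> admissible D vE z" "\<And>t. t < t1 \<Longrightarrow> a t = sgn (q - z)" using run(4) by blast
    have pos: "traj vE z a t = z + (vE * t) *\<^sub>R sgn (q - z)" if "0 \<le> t" "t \<le> t1" for t
    proof (rule run(5)[OF that(1)])
      have "AE s in lebesgue. s \<notin> {t1}" by (rule AE_not_in) (simp flip: negligible_iff_null_sets)
      then show "AE s in lebesgue. s \<in> {0..t} \<longrightarrow> a s = sgn (q - z)"
        by eventually_elim (use a(2) that in auto)
    qed
    obtain t i where t: "0 \<le> t" "\<And>s. s \<in> {0..t} \<Longrightarrow> traj vE z a s \<in> D - R" and i: "i \<in> K"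
      and meet: "traj vP (X i) (\<beta> a i) t = traj vE z a t"
      using win[OF a(1)] unfolding pursuers_win_def caught_at_def by blast
    have "t < t1"
    proof (rule ccontr)
      assume "\<not> t < t1"
      then have "traj vE z a t1 \<in> D - R" using t run(2) by simp
      then show False using pos[of t1] run(2,3) q T by auto
    qed
    moreover have "traj vP (X i) (\<beta> a i) t = z + (vE * t) *\<^sub>R sgn (q - z)" using meet pos t \<open>t < t1\<close> by simp
    ultimately show False
      using too_late[OF z q strategy_admissible[OF \<beta> a(1) i] t(1) _ far[OF i]] by (simp add: t1_def)
  qed
  then show "z \<in> {z \<in> D - R. \<forall>q\<in>T. \<exists>i\<in>K. \<alpha> * norm (X i - q) < norm (z - q)}" using z by simp
next
  fix z assume z': "z \<in> {z \<in> D - R. \<forall>q\<in>T. \<exists>i\<in>K. \<alpha> * norm (X i - q) < norm (z - q)}"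
  then have z: "z \<in> D - R" and near: "\<And>q. q \<in> T \<Longrightarrow> \<exists>i\<in>K. \<alpha> * norm (X i - q) < norm (z - q)" by auto
  obtain \<beta> where \<beta>: "\<beta> \<in> coalition_strategies D vP vE K X z" and tcs: "\<forall>a\<in>admissible D vE z. \<exists>tc. (\<forall>i\<in>K. 0 \<le> tc i) \<and>
    (\<forall>i\<in>K. traj vP (X i) (\<beta> a i) (tc i) = traj vE z a (tc i)) \<and>
    (\<forall>i\<in>K. \<forall>t\<ge>0. traj vE z a t \<in> T \<longrightarrow> \<alpha> * norm (X i - traj vE z a t) \<le> norm (z - traj vE z a t) \<longrightarrow> tc i \<le> t) \<and>
    (\<forall>i\<in>K. \<forall>t\<ge>0. traj vE z a t \<in> T \<longrightarrow> \<alpha> * norm (X i - traj vE z a t) < norm (z - traj vE z a t) \<longrightarrow> tc i < t)"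
    using coalition_strategy[of z] by blast
  have "pursuers_win D R K (\<lambda>i. traj vP (X i) (\<beta> a i)) (traj vE z a)" if a: "a \<in> admissible D vE z" for a
  proof -
    obtain tc where tcK: "\<forall>i\<in>K. 0 \<le> tc i" "\<forall>i\<in>K. traj vP (X i) (\<beta> a i) (tc i) = traj vE z a (tc i)"
      "\<forall>i\<in>K. \<forall>t\<ge>0. traj vE z a t \<in> T \<longrightarrow> \<alpha> * norm (X i - traj vE z a t) < norm (z - traj vE z a t) \<longrightarrow> tc i < t"
      using bspec[OF tcs a] by (elim exE conjE) (rule that)
    note tc = tcK[rule_format]
    define \<tau> where "\<tau> = Min (tc ` K)"
    have \<tau>: "\<tau> \<in> tc ` K" "\<And>i. i \<in> K \<Longrightarrow> \<tau> \<le> tc i" using K by (auto simp: \<tau>_def)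
    then obtain i where i: "i \<in> K" "\<tau> = tc i" by blast
    have "caught_at K (\<lambda>i. traj vP (X i) (\<beta> a i)) (traj vE z a) \<tau>"
      using i tc(2) by (auto simp: caught_at_def)
    moreover have "traj vE z a s \<in> D - R" if s: "s \<in> {0..\<tau>}" for s
    proof -
      have "traj vE z a s \<notin> R"
      proof
        assume "traj vE z a s \<in> R"
        then obtain r where r: "r \<in> {0..s}" "traj vE z a r \<in> T" using enters_through_T[OF z a, of s] s by auto
        obtain j where j: "j \<in> K" "\<alpha> * norm (X j - traj vE z a r) < norm (z - traj vE z a r)" using near[OF r(2)] by blast
        have "tc j < r" using tc(3)[OF j(1) _ r(2) j(2)] r by simp
        then show False using \<tau>(2)[OF j(1)] r s by simp
      qed
      then show ?thesis using a s by (auto simp: admissible_def)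
    qed
    ultimately show ?thesis unfolding pursuers_win_def using i tc(1) by blast
  qed
  then show "z \<in> pursuit_winning_region D R vP vE K X"
    unfolding pursuit_winning_region_def using z \<beta> by blast
qed

text \<open>The law prescribes \<open>a\<close> only while the game runs, so the argument looks at
  the first time in the closed set \<open>S\<close> of end events. Until then the run is straight,
  and \<open>too_late\<close> excludes capture, so the event is the arrival.\<close>

lemma straight_run_wins:
  assumes z: "z \<in> D - R" and q: "q \<in> T" and near: "\<And>i. i \<in> K \<Longrightarrow> norm (z - q) < \<alpha> * norm (X i - q)"
    and \<beta>: "\<beta> \<in> coalition_strategies D vP vE K X z" and a: "a \<in> admissible D vE z"
    and ff: "follows_feedback R K (\<lambda>_ _. sgn (q - z)) (\<lambda>i. traj vP (X i) (\<beta> a i)) (traj vE z a) a"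
  shows "evader_wins R K (\<lambda>i. traj vP (X i) (\<beta> a i)) (traj vE z a)"
proof -
  define t1 where "t1 = norm (q - z) / vE"
  note run = run_straight[OF z q, folded t1_def]
  let ?E = "traj vE z a" and ?P = "\<lambda>i. traj vP (X i) (\<beta> a i)"
  define S where "S = {t. 0 \<le> t \<and> (?E t \<in> R \<or> caught_at K ?P ?E t)}"
  have contE: "continuous_on {0..} ?E" using evader_lip[OF a] by (rule lipschitz_on_continuous_on)
  have contP: "continuous_on {0..} (?P i)" if "i \<in> K" for i
    using pursuer_lip[OF strategy_admissible[OF \<beta> a that]] by (rule lipschitz_on_continuous_on)
  have "closed S"
  proof -
    have "S = ({0..} \<inter> ?E -` R) \<union> (\<Union>i\<in>K. {t \<in> {0..}. ?P i t - ?E t = 0})"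
      by (auto simp: S_def caught_at_def)
    moreover have "closed ({0..} \<inter> ?E -` R)" by (rule continuous_closed_preimage[OF contE _ R]) simp
    moreover have "closed (\<Union>i\<in>K. {t \<in> {0..}. ?P i t - ?E t = 0})"
    proof (intro closed_UN K ballI)
      fix i assume "i \<in> K"
      then show "closed {t \<in> {0..}. ?P i t - ?E t = 0}"
        by (intro continuous_closed_preimage_constant continuous_on_diff contE contP) simp_all
    qed
    ultimately show ?thesis by (simp only: closed_Un)
  qed
  have pos: "?E t = z + (vE * t) *\<^sub>R sgn (q - z)" if t: "0 \<le> t" and none: "\<And>s. s < t \<Longrightarrow> s \<notin> S" for t
  proof (rule run(5)[OF t])
    \<comment> \<open>At time \<open>t\<close> itself the game may be over; this single time is
      discarded as a null set.\<close>
    have "AE s in lebesgue. s \<notin> {t}" by (rule AE_not_in) (simp flip: negligible_iff_null_sets)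
    then show "AE s in lebesgue. s \<in> {0..t} \<longrightarrow> a s = sgn (q - z)"
      using ff unfolding follows_feedback_def
    proof eventually_elim
      case (elim s)
      show ?case
      proof
        assume s: "s \<in> {0..t}"
        have "?E r \<notin> R \<and> \<not> caught_at K ?P ?E r" if "r \<in> {0..s}" for r
          using none[of r] that s elim(1) by (auto simp: S_def)
        then show "a s = sgn (q - z)" using elim(2) s by simp
      qed
    qed
  qed
  have ne: "S \<noteq> {}"
  proof
    assume "S = {}"
    then have "?E t1 \<in> R" using pos[of t1] run(2,3) q T by auto
    then show False using \<open>S = {}\<close> run(2) by (auto simp: S_def)
  qed
  have bdd: "bdd_below S" by (rule bdd_belowI[of _ 0]) (auto simp: S_def)
  define \<tau> where "\<tau> = Inf S"
  have \<tau>S: "\<tau> \<in> S" unfolding \<tau>_def using ne bdd \<open>closed S\<close> by (rule closed_contains_Inf)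
  have first: "s \<notin> S" if "s < \<tau>" for s using that bdd cInf_lower[of s S] by (auto simp: \<tau>_def)
  have \<tau>0: "0 \<le> \<tau>" using \<tau>S by (simp add: S_def)
  have "\<tau> \<le> t1"
  proof (rule ccontr)
    assume "\<not> \<tau> \<le> t1"
    then have "?E t1 \<in> R" using pos[of t1] first run(2,3) q T by auto
    then show False using first[of t1] \<open>\<not> \<tau> \<le> t1\<close> run(2) by (auto simp: S_def)
  qed
  have free: "\<not> caught_at K ?P ?E \<tau>"
  proof
    assume "caught_at K ?P ?E \<tau>"
    then obtain i where i: "i \<in> K" "?P i \<tau> = ?E \<tau>" by (auto simp: caught_at_def)
    then show False
      using too_late[OF z q strategy_admissible[OF \<beta> a i(1)] \<tau>0 _ less_imp_le[OF near[OF i(1)]]] near[OF i(1)]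
        \<open>\<tau> \<le> t1\<close> pos[OF \<tau>0 first] by (simp add: t1_def)
  qed
  then have "?E \<tau> \<in> R" using \<tau>S by (simp add: S_def)
  moreover have "\<not> caught_at K ?P ?E s" if "s \<in> {0..\<tau>}" for s
    using that first[of s] free by (cases "s = \<tau>") (auto simp: S_def)
  ultimately show ?thesis unfolding evader_wins_def using \<tau>0 by blast
qed

text \<open>A guard that meets the evader exactly on arrival already spoils
  \<open>evader_wins\<close>, so weak guarding of all points refutes a win. Conversely the constant
  heading towards an unguarded \<open>q\<close> is a winning feedback law.\<close>

lemma evasion_region:
  "evasion_winning_region D R vP vE K X = {z \<in> D - R. \<exists>q\<in>T. \<forall>i\<in>K. norm (z - q) < \<alpha> * norm (X i - q)}"
proof (intro set_eqI iffI)
  fix z assume "z \<in> evasion_winning_region D R vP vE K X"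
  \<comment> \<open>Existence of a closed-loop solution, combined with the win of every solution,
    gives one winning control.\<close>
  then have z: "z \<in> D - R" and win: "\<And>\<beta>. \<beta> \<in> coalition_strategies D vP vE K X z \<Longrightarrow>
     \<exists>a\<in>admissible D vE z. evader_wins R K (\<lambda>i. traj vP (X i) (\<beta> a i)) (traj vE z a)"
    unfolding evasion_winning_region_def by blast+
  have "\<exists>q\<in>T. \<forall>i\<in>K. norm (z - q) < \<alpha> * norm (X i - q)"
  proof (rule ccontr)
    assume "\<not> (\<exists>q\<in>T. \<forall>i\<in>K. norm (z - q) < \<alpha> * norm (X i - q))"
    then have guard: "\<exists>i\<in>K. \<alpha> * norm (X i - q) \<le> norm (z - q)" if "q \<in> T" for q using that by force
    obtain \<beta> where \<beta>: "\<beta> \<in> coalition_strategies D vP vE K X z" and tcs: "\<forall>a\<in>admissible D vE z. \<exists>tc. (\<forall>i\<in>K. 0 \<le> tc i) \<and>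
    (\<forall>i\<in>K. traj vP (X i) (\<beta> a i) (tc i) = traj vE z a (tc i)) \<and>
    (\<forall>i\<in>K. \<forall>t\<ge>0. traj vE z a t \<in> T \<longrightarrow> \<alpha> * norm (X i - traj vE z a t) \<le> norm (z - traj vE z a t) \<longrightarrow> tc i \<le> t) \<and>
    (\<forall>i\<in>K. \<forall>t\<ge>0. traj vE z a t \<in> T \<longrightarrow> \<alpha> * norm (X i - traj vE z a t) < norm (z - traj vE z a t) \<longrightarrow> tc i < t)"
      using coalition_strategy[of z] by blast
    obtain a where a: "a \<in> admissible D vE z" and ew: "evader_wins R K (\<lambda>i. traj vP (X i) (\<beta> a i)) (traj vE z a)"
      using win[OF \<beta>] by blast
    obtain tc where tcK: "\<forall>i\<in>K. 0 \<le> tc i" "\<forall>i\<in>K. traj vP (X i) (\<beta> a i) (tc i) = traj vE z a (tc i)"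
      "\<forall>i\<in>K. \<forall>t\<ge>0. traj vE z a t \<in> T \<longrightarrow> \<alpha> * norm (X i - traj vE z a t) \<le> norm (z - traj vE z a t) \<longrightarrow> tc i \<le> t"
      using bspec[OF tcs a] by (elim exE conjE) (rule that)
    note tc = tcK[rule_format]
    obtain t where t: "0 \<le> t" "traj vE z a t \<in> R"
      and free: "\<And>s. s \<in> {0..t} \<Longrightarrow> \<not> caught_at K (\<lambda>i. traj vP (X i) (\<beta> a i)) (traj vE z a) s"
      using ew unfolding evader_wins_def by blast
    obtain r where r: "r \<in> {0..t}" "traj vE z a r \<in> T" using enters_through_T[OF z a t] by blast
    obtain i where i: "i \<in> K" "\<alpha> * norm (X i - traj vE z a r) \<le> norm (z - traj vE z a r)" using guard[OF r(2)] by blast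
    have "tc i \<le> r" using tc(3)[OF i(1) _ r(2) i(2)] r by simp
    then show False using free[of "tc i"] tc(1,2)[OF i(1)] i(1) r by (auto simp: caught_at_def)
  qed
  then show "z \<in> {z \<in> D - R. \<exists>q\<in>T. \<forall>i\<in>K. norm (z - q) < \<alpha> * norm (X i - q)}" using z by simp
next
  fix z assume "z \<in> {z \<in> D - R. \<exists>q\<in>T. \<forall>i\<in>K. norm (z - q) < \<alpha> * norm (X i - q)}"
  then obtain q where z: "z \<in> D - R" and q: "q \<in> T" and near: "\<And>i. i \<in> K \<Longrightarrow> norm (z - q) < \<alpha> * norm (X i - q)" by blast
  define t1 where "t1 = norm (q - z) / vE"
  note run = run_straight[OF z q, folded t1_def]
  obtain a where a: "a \<in> admissible D vE z" "\<And>t. t < t1 \<Longrightarrow> a t = sgn (q - z)" using run(4) by blast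
  have "traj vE z a t1 = q"
  proof -
    have "AE s in lebesgue. s \<notin> {t1}" by (rule AE_not_in) (simp flip: negligible_iff_null_sets)
    then have "AE s in lebesgue. s \<in> {0..t1} \<longrightarrow> a s = sgn (q - z)" by eventually_elim (use a(2) in auto)
    then show ?thesis using run(2,3) run(5)[of t1 a] by simp
  qed
  \<comment> \<open>From \<open>t1\<close> on the evader has been in \<open>R\<close> and the law
    imposes nothing, so \<open>a\<close> follows it whatever the pursuers do.\<close>
  then have "follows_feedback R K (\<lambda>_ _. sgn (q - z)) xP (traj vE z a) a" for xP
    unfolding follows_feedback_def using a(2) run(2) q T(2)
    by (intro AE_I2) (metis atLeastAtMost_iff less_imp_le not_less subsetD)
  then show "z \<in> evasion_winning_region D R vP vE K X"
    unfolding evasion_winning_region_def using z a(1) run(1) straight_run_wins[OF z q near]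
    by (intro CollectI conjI exI[of _ "\<lambda>_ _. sgn (q - z)"]) blast+
qed

lemma neither_wins:
  "(D - R) - (pursuit_winning_region D R vP vE K X \<union> evasion_winning_region D R vP vE K X) =
    {z \<in> D - R. (\<exists>q\<in>T. \<forall>i\<in>K. norm (z - q) \<le> \<alpha> * norm (X i - q)) \<and> (\<forall>q\<in>T. \<exists>i\<in>K. \<alpha> * norm (X i - q) \<le> norm (z - q))}"
proof (rule set_eqI)
  fix z
  have "(\<not> (\<forall>q\<in>T. \<exists>i\<in>K. \<alpha> * norm (X i - q) < norm (z - q))) = (\<exists>q\<in>T. \<forall>i\<in>K. norm (z - q) \<le> \<alpha> * norm (X i - q))"
    and "(\<not> (\<exists>q\<in>T. \<forall>i\<in>K. norm (z - q) < \<alpha> * norm (X i - q))) = (\<forall>q\<in>T. \<exists>i\<in>K. \<alpha> * norm (X i - q) \<le> norm (z - q))"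
    by (simp_all add: not_less)
  then show "z \<in> (D - R) - (pursuit_winning_region D R vP vE K X \<union> evasion_winning_region D R vP vE K X) \<longleftrightarrow>
    z \<in> {z \<in> D - R. (\<exists>q\<in>T. \<forall>i\<in>K. norm (z - q) \<le> \<alpha> * norm (X i - q)) \<and> (\<forall>q\<in>T. \<exists>i\<in>K. \<alpha> * norm (X i - q) \<le> norm (z - q))}"
    unfolding pursuit_region evasion_region by (simp, blast)
qed

end

section \<open>The shape of the barrier\<close>

lemma pt_nth [simp]: "pt x y $ 1 = x" "pt x y $ 2 = y"
  by (simp_all add: pt_def)

lemma norm_axis_sq: "(norm (z - pt s 0))\<^sup>2 = (z $ 1 - s)\<^sup>2 + (z $ 2)\<^sup>2"
  by (simp add: norm_vec_def L2_set_def sum_2)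

lemma target_line_eq:
  assumes "0 < l"
  shows "target_line l = (\<lambda>s. pt s 0) ` {0..l}"
proof -
  have "target_line l = {pt (u * l) 0 | u. 0 \<le> u \<and> u \<le> 1}"
    unfolding target_line_def closed_segment_def by (auto simp: vec_eq_iff forall_2)
  also have "\<dots> = (\<lambda>s. pt s 0) ` {0..l}"
  proof (intro set_eqI iffI)
    fix q assume "q \<in> (\<lambda>s. pt s 0) ` {0..l}"
    then obtain s where "q = pt s 0" "0 \<le> s" "s \<le> l" by auto
    then show "q \<in> {pt (u * l) 0 | u. 0 \<le> u \<and> u \<le> 1}"
      using assms by (intro CollectI exI[of _ "s / l"]) auto
  qed (use assms in \<open>auto simp: mult_le_cancel_right2\<close>)
  finally show ?thesis .
qed

text \<open>The difference of the squared distances is affine in \<open>s\<close>, so the points of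
  the axis nearer to \<open>a\<close> form a half-line ending at the equidistant point.\<close>

lemma axis_equidist_order:
  fixes a b :: "real^2"
  assumes ab: "a $ 1 < b $ 1"
  shows "norm (a - pt s 0) \<le> norm (b - pt s 0) \<longleftrightarrow> s \<le> axis_equidist a b" (is ?le)
    and "norm (a - pt s 0) < norm (b - pt s 0) \<longleftrightarrow> s < axis_equidist a b" (is ?less)
proof -
  define c where "c = ((b $ 1)\<^sup>2 + (b $ 2)\<^sup>2 - (a $ 1)\<^sup>2 - (a $ 2)\<^sup>2) / (2 * (b $ 1 - a $ 1))"
  have c: "2 * (b $ 1 - a $ 1) * c = (b $ 1)\<^sup>2 + (b $ 2)\<^sup>2 - (a $ 1)\<^sup>2 - (a $ 2)\<^sup>2" using ab by (simp add: c_def)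
  have d: "(norm (b - pt s 0))\<^sup>2 - (norm (a - pt s 0))\<^sup>2 = 2 * (b $ 1 - a $ 1) * (c - s)" for s
    unfolding norm_axis_sq using c by (simp add: power2_eq_square algebra_simps)
  have le: "norm (a - pt s 0) \<le> norm (b - pt s 0) \<longleftrightarrow> s \<le> c" for s
  proof -
    have "norm (a - pt s 0) \<le> norm (b - pt s 0) \<longleftrightarrow> 0 \<le> (norm (b - pt s 0))\<^sup>2 - (norm (a - pt s 0))\<^sup>2" by simp
    then show ?thesis unfolding d using ab by (simp add: zero_le_mult_iff)
  qed
  have ge: "norm (b - pt s 0) \<le> norm (a - pt s 0) \<longleftrightarrow> c \<le> s" for s
  proof -
    have "norm (b - pt s 0) \<le> norm (a - pt s 0) \<longleftrightarrow> (norm (b - pt s 0))\<^sup>2 - (norm (a - pt s 0))\<^sup>2 \<le> 0" by simp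
    then show ?thesis unfolding d using ab by (simp add: mult_le_0_iff)
  qed
  have "axis_equidist a b = c" unfolding axis_equidist_def
  proof (rule the_equality)
    show "norm (pt c 0 - a) = norm (pt c 0 - b)" using le[of c] ge[of c] by (simp add: norm_minus_commute)
    show "x = c" if "norm (pt x 0 - a) = norm (pt x 0 - b)" for x
      using that le[of x] ge[of x] by (simp add: norm_minus_commute)
  qed
  then show ?le ?less using le[of s] ge[of s] by auto
qed

locale active_line =
  fixes h :: "nat \<Rightarrow> real^2" and n :: nat and l \<alpha> :: real
  assumes n: "1 \<le> n" and l: "0 < l" and \<alpha>: "0 < \<alpha>" "\<alpha> < 1"
    and incr: "\<And>i j. 1 \<le> i \<Longrightarrow> i < j \<Longrightarrow> j \<le> n \<Longrightarrow> h i $ 1 < h j $ 1"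
    and active: "\<And>i. 1 \<le> i \<Longrightarrow> i \<le> n \<Longrightarrow>
      \<exists>s\<in>{0..l}. \<forall>j\<in>{1..n} - {i}. norm (h i - pt s 0) < norm (h j - pt s 0)"
begin

text \<open>The Voronoi cell of \<open>h i\<close> on the target line is the interval from
  \<open>cut (i - 1)\<close> to \<open>cut i\<close>. Counting the ends of the line as cuts lets one
  formula cover all conic arcs.\<close>

definition cut :: "nat \<Rightarrow> real" where
  "cut i = (if i = 0 then 0 else if i = n then l else axis_equidist (h i) (h (i + 1)))"

lemma cut_0 [simp]: "cut 0 = 0" and cut_n [simp]: "cut n = l"
  using n by (auto simp: cut_def)

lemma cut_between: "1 \<le> i \<Longrightarrow> i < n \<Longrightarrow> cut i = axis_equidist (h i) (h (i + 1))"
  by (simp add: cut_def)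

lemma nearer_iff:
  assumes "1 \<le> i" "i < n"
  shows "norm (h i - pt s 0) \<le> norm (h (i + 1) - pt s 0) \<longleftrightarrow> s \<le> cut i"
    and "norm (h i - pt s 0) < norm (h (i + 1) - pt s 0) \<longleftrightarrow> s < cut i"
  using axis_equidist_order[OF incr[of i "i + 1"], of s] assms by (simp_all add: cut_between)

text \<open>A point witnessing that \<open>h i\<close> is active lies strictly on its side of the
  equidistant points with both neighbours; where a neighbour is missing, the end of the target line
  takes over.\<close>

lemma cut_less:
  assumes "1 \<le> i" "i \<le> n"
  shows "cut (i - 1) < cut i"
proof -
  obtain s where s: "0 \<le> s" "s \<le> l" "\<And>j. j \<in> {1..n} - {i} \<Longrightarrow> norm (h i - pt s 0) < norm (h j - pt s 0)"
    using active[OF assms] by auto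
  have left: "cut (i - 1) < s" if "1 < i"
  proof -
    have "1 \<le> i - 1" "i - 1 < n" "i - 1 + 1 = i" "i - 1 \<in> {1..n} - {i}" using that assms by auto
    then show ?thesis using nearer_iff(1)[of "i - 1" s] s(3)[of "i - 1"] by (metis not_le)
  qed
  have right: "s < cut i" if "i < n"
    using nearer_iff(2)[of i s] s(3)[of "i + 1"] that assms by auto
  show ?thesis
  proof (cases "i = 1")
    case True
    then have "cut (i - 1) = 0" by simp
    moreover have "0 < cut i"
    proof (cases "i = n")
      case True
      then have "cut i = l" by (simp only: cut_n)
      then show ?thesis using l by simp
    next
      case False
      then show ?thesis using right s(1) assms(2) by simp
    qed
    ultimately show ?thesis by simp
  next
    case False
    then show ?thesis using left right s assms by (cases "i = n") auto
  qed
qed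

lemma cut_mono: "i \<le> j \<Longrightarrow> j \<le> n \<Longrightarrow> cut i \<le> cut j"
proof (induction j rule: dec_induct)
  case (step k)
  then show ?case using cut_less[of "Suc k"] by simp
qed simp

text \<open>Since the cuts increase, for \<open>s\<close> in this cell every comparison of
  neighbours favours the one closer to \<open>i\<close> in the list, and the comparisons
  chain.\<close>

lemma nearest:
  assumes i: "1 \<le> i" "i \<le> n" and s: "cut (i - 1) \<le> s" "s \<le> cut i" and j: "1 \<le> j" "j \<le> n"
  shows "norm (h i - pt s 0) \<le> norm (h j - pt s 0)"
proof (cases "i \<le> j")
  case True
  then show ?thesis using j(2)
  proof (induction j rule: dec_induct)
    case (step k)
    then have "s \<le> cut k" using cut_mono[of i k] s by simp
    then have "norm (h k - pt s 0) \<le> norm (h (k + 1) - pt s 0)" using nearer_iff(1)[of k s] step i by simp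
    then show ?case using step by simp
  qed simp
next
  case False
  then have "j \<le> i" by simp
  then show ?thesis using j(1)
  proof (induction j rule: inc_induct)
    case (step k)
    then have "k \<le> i - 1" "i - 1 \<le> n" using i by arith+
    then have "cut k \<le> s" using cut_mono[of k "i - 1"] s by simp
    then have "norm (h (k + 1) - pt s 0) \<le> norm (h k - pt s 0)" using nearer_iff(2)[of k s] step i by (simp add: not_less[symmetric])
    then show ?case using step by simp
  qed simp
qed

lemma in_cell:
  assumes "0 \<le> s" "s \<le> l"
  obtains i where "1 \<le> i" "i \<le> n" "cut (i - 1) \<le> s" "s \<le> cut i"
proof (cases "s = 0")
  case True
  then show ?thesis using that[of 1] cut_less[of 1] n by simp
next
  case False
  define i where "i = (LEAST i. s \<le> cut i)"
  have i: "s \<le> cut i" unfolding i_def by (rule LeastI[of _ n]) (use assms in simp)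
  have min: "cut k < s" if "k < i" for k using not_less_Least[of k "\<lambda>i. s \<le> cut i"] that by (simp add: i_def not_le)
  have "i \<le> n" unfolding i_def by (rule Least_le) (use assms in simp)
  moreover have "i \<noteq> 0" using i False assms by (cases "i = 0") auto
  ultimately show ?thesis using that[of i] i min[of "i - 1"] by simp
qed

section \<open>Differences of squared distances as parabolas over the target line\<close>

definition gap :: "real^2 \<Rightarrow> nat \<Rightarrow> real \<Rightarrow> real" where
  "gap z i s = (norm (z - pt s 0))\<^sup>2 - \<alpha>\<^sup>2 * (norm (h i - pt s 0))\<^sup>2"

definition apex :: "real^2 \<Rightarrow> nat \<Rightarrow> real" where
  "apex z i = (z $ 1 - \<alpha>\<^sup>2 * h i $ 1) / (1 - \<alpha>\<^sup>2)"

definition conic :: "real^2 \<Rightarrow> nat \<Rightarrow> real" where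
  "conic z i = (z $ 1 - h i $ 1)\<^sup>2 + (1 - 1 / \<alpha>\<^sup>2) * (z $ 2)\<^sup>2 + (1 - \<alpha>\<^sup>2) * (h i $ 2)\<^sup>2"

lemma b_pos: "0 < 1 - \<alpha>\<^sup>2"
  using \<alpha> by (simp add: power_less_one_iff)

text \<open>Completing the square: \<open>apex\<close> is the vertex of the parabola, and its
  minimum is a negative multiple of \<open>conic\<close>. The equation of the conic arcs thus says
  that this minimum is 0.\<close>

lemma gap_vertex_form: "gap z i s = (1 - \<alpha>\<^sup>2) * (s - apex z i)\<^sup>2 - \<alpha>\<^sup>2 / (1 - \<alpha>\<^sup>2) * conic z i"
proof -
  define b where "b = 1 - \<alpha>\<^sup>2"
  have b: "0 < b" "\<alpha>\<^sup>2 = 1 - b" using b_pos by (auto simp: b_def)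
  have a: "0 < \<alpha>\<^sup>2" using \<alpha> by simp
  have "b * gap z i s = b * ((z $ 1 - s)\<^sup>2 + (z $ 2)\<^sup>2 - \<alpha>\<^sup>2 * ((h i $ 1 - s)\<^sup>2 + (h i $ 2)\<^sup>2))"
    by (simp add: gap_def norm_axis_sq)
  moreover have "b * ((1 - \<alpha>\<^sup>2) * (s - apex z i)\<^sup>2 - \<alpha>\<^sup>2 / (1 - \<alpha>\<^sup>2) * conic z i) = (b * s - b * apex z i)\<^sup>2 - \<alpha>\<^sup>2 * conic z i"
    unfolding b_def[symmetric] using b(1) by (simp add: field_simps power2_eq_square)
  moreover have "b * apex z i = z $ 1 - \<alpha>\<^sup>2 * h i $ 1" using b by (simp add: apex_def b_def[symmetric])
  moreover have "\<alpha>\<^sup>2 * conic z i = \<alpha>\<^sup>2 * (z $ 1 - h i $ 1)\<^sup>2 + (\<alpha>\<^sup>2 - 1) * (z $ 2)\<^sup>2 + \<alpha>\<^sup>2 * b * (h i $ 2)\<^sup>2"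
    using a by (simp add: conic_def b_def field_simps)
  ultimately have "b * gap z i s = b * ((1 - \<alpha>\<^sup>2) * (s - apex z i)\<^sup>2 - \<alpha>\<^sup>2 / (1 - \<alpha>\<^sup>2) * conic z i)"
    unfolding b(2) by (simp add: power2_eq_square algebra_simps)
  then show ?thesis using b by simp
qed

lemma gap_le_iff: "gap z i s \<le> 0 \<longleftrightarrow> norm (z - pt s 0) \<le> \<alpha> * norm (h i - pt s 0)"
  and gap_ge_iff: "0 \<le> gap z i s \<longleftrightarrow> \<alpha> * norm (h i - pt s 0) \<le> norm (z - pt s 0)"
  and gap_eq_iff: "gap z i s = 0 \<longleftrightarrow> norm (z - pt s 0) = \<alpha> * norm (h i - pt s 0)"
proof -
  have g: "gap z i s = (norm (z - pt s 0))\<^sup>2 - (\<alpha> * norm (h i - pt s 0))\<^sup>2" by (simp add: gap_def power_mult_distrib)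
  have nn: "0 \<le> norm (z - pt s 0)" "0 \<le> \<alpha> * norm (h i - pt s 0)" using \<alpha> by auto
  show "gap z i s \<le> 0 \<longleftrightarrow> norm (z - pt s 0) \<le> \<alpha> * norm (h i - pt s 0)"
    unfolding g using power_mono_iff[OF nn, of 2] by simp
  show "0 \<le> gap z i s \<longleftrightarrow> \<alpha> * norm (h i - pt s 0) \<le> norm (z - pt s 0)"
    unfolding g using power_mono_iff[OF nn(2,1), of 2] by simp
  show "gap z i s = 0 \<longleftrightarrow> norm (z - pt s 0) = \<alpha> * norm (h i - pt s 0)"
    unfolding g using power2_eq_iff_nonneg[OF nn] by simp
qed

lemma gap_closer: "\<bar>r - apex z i\<bar> < \<bar>s - apex z i\<bar> \<Longrightarrow> gap z i r < gap z i s"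
  and gap_closer_le: "\<bar>r - apex z i\<bar> \<le> \<bar>s - apex z i\<bar> \<Longrightarrow> gap z i r \<le> gap z i s"
proof -
  show "gap z i r < gap z i s" if "\<bar>r - apex z i\<bar> < \<bar>s - apex z i\<bar>"
    using power_strict_mono[OF that, of 2] b_pos unfolding gap_vertex_form by simp
  show "gap z i r \<le> gap z i s" if "\<bar>r - apex z i\<bar> \<le> \<bar>s - apex z i\<bar>"
    using that b_pos unfolding gap_vertex_form by (simp add: abs_le_square_iff)
qed

text \<open>To the right of its vertex the parabola increases strictly, so a zero there would be
  preceded by negative values.\<close>

lemma apex_right:
  assumes "gap z i s = 0" "a < s" "\<And>r. a \<le> r \<Longrightarrow> r \<le> s \<Longrightarrow> 0 \<le> gap z i r"
  shows "s \<le> apex z i"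
proof (rule ccontr)
  assume "\<not> s \<le> apex z i"
  \<comment> \<open>The point of \<open>{a..s}\<close> nearest to the vertex.\<close>
  then have "gap z i (max a (apex z i)) < gap z i s" using assms(2) by (intro gap_closer) auto
  then show False using assms(3)[of "max a (apex z i)"] assms(1,2) \<open>\<not> s \<le> apex z i\<close> by auto
qed

lemma apex_left:
  assumes "gap z i s = 0" "s < a" "\<And>r. s \<le> r \<Longrightarrow> r \<le> a \<Longrightarrow> 0 \<le> gap z i r"
  shows "apex z i \<le> s"
proof (rule ccontr)
  assume "\<not> apex z i \<le> s"
  then have "gap z i (min a (apex z i)) < gap z i s" using assms(2) by (intro gap_closer) auto
  then show False using assms(3)[of "min a (apex z i)"] assms(1,2) \<open>\<not> apex z i \<le> s\<close> by auto
qed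

text \<open>The bounds on the abscissa in the base curves are conditions on the position of the
  vertex.\<close>

lemma apex_le_iff: "apex z i \<le> s \<longleftrightarrow> z $ 1 \<le> (1 - \<alpha>\<^sup>2) * s + \<alpha>\<^sup>2 * h i $ 1"
  and le_apex_iff: "s \<le> apex z i \<longleftrightarrow> (1 - \<alpha>\<^sup>2) * s + \<alpha>\<^sup>2 * h i $ 1 \<le> z $ 1"
  and apex_less_iff: "apex z i < s \<longleftrightarrow> z $ 1 < (1 - \<alpha>\<^sup>2) * s + \<alpha>\<^sup>2 * h i $ 1"
  and less_apex_iff: "s < apex z i \<longleftrightarrow> (1 - \<alpha>\<^sup>2) * s + \<alpha>\<^sup>2 * h i $ 1 < z $ 1"
  unfolding apex_def using b_pos
  by (auto simp: pos_divide_le_eq pos_le_divide_eq pos_divide_less_eq pos_less_divide_eq mult.commute algebra_simps)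

definition critical :: "(real^2) set" where
  "critical = {z. z $ 2 < 0 \<and> (\<exists>s\<in>{0..l}. \<forall>i\<in>{1..n}. gap z i s \<le> 0) \<and> (\<forall>s\<in>{0..l}. \<exists>i\<in>{1..n}. 0 \<le> gap z i s)}"

text \<open>The pursuer's distance enters with a minus sign, so the nearest pursuer has the largest
  gap and decides the maximum on its cell.\<close>

lemma gap_dominates:
  assumes "1 \<le> i" "i \<le> n" "cut (i - 1) \<le> s" "s \<le> cut i" "1 \<le> j" "j \<le> n"
  shows "gap z j s \<le> gap z i s"
proof -
  have "(norm (h i - pt s 0))\<^sup>2 \<le> (norm (h j - pt s 0))\<^sup>2" using nearest[OF assms] by (intro power_mono) auto
  then show ?thesis using \<alpha> by (simp add: gap_def mult_left_mono)
qed

lemma gap_at_cut: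
  assumes "1 \<le> i" "i < n"
  shows "gap z (i + 1) (cut i) = gap z i (cut i)"
  using gap_dominates[of i "cut i" "i + 1" z] gap_dominates[of "i + 1" "cut i" i z] assms
    cut_less[of i] cut_less[of "i + 1"] by auto

lemma cut_range: "i \<le> n \<Longrightarrow> 0 \<le> cut i \<and> cut i \<le> l"
  using cut_mono[of 0 i] cut_mono[of i n] by simp

lemma cell_range: "1 \<le> i \<Longrightarrow> i \<le> n \<Longrightarrow> cut (i - 1) \<le> s \<Longrightarrow> s \<le> cut i \<Longrightarrow> s \<in> {0..l}"
  using cut_range[of i] cut_range[OF order_trans[OF diff_le_self, of i n 1]] by simp

text \<open>One expression for every number of pursuers: a conic arc for each cell and a circular
  arc for each cut, the ends of the target line included.\<close>

definition curve :: "(real^2) set" where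
  "curve = F1_1 \<alpha> (h 1) \<union>
    (\<Union>i\<in>{1..n}. conic_arc \<alpha> (h i) {(1 - \<alpha>\<^sup>2) * cut (i - 1) + \<alpha>\<^sup>2 * h i $ 1 <..< (1 - \<alpha>\<^sup>2) * cut i + \<alpha>\<^sup>2 * h i $ 1}) \<union>
    (\<Union>i\<in>{1..<n}. F2_3 \<alpha> (h i) (h (i + 1))) \<union> F1_3 \<alpha> l (h n)"

text \<open>This and the next three lemmas express each arc by the vanishing of a parabola at a
  point, or of its minimum, and by the position of the vertex, which tells on which side that zero
  is a minimum.\<close>

lemma F1_1_iff: "z \<in> F1_1 \<alpha> (h 1) \<longleftrightarrow> z $ 2 < 0 \<and> gap z 1 0 = 0 \<and> apex z 1 \<le> 0"
  unfolding F1_1_def circ_arc_def gap_eq_iff apex_le_iff by auto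

lemma F1_3_iff: "z \<in> F1_3 \<alpha> l (h n) \<longleftrightarrow> z $ 2 < 0 \<and> gap z n l = 0 \<and> l \<le> apex z n"
  unfolding F1_3_def circ_arc_def gap_eq_iff le_apex_iff by auto

lemma conic_arc_iff: "z \<in> conic_arc \<alpha> (h i) {(1 - \<alpha>\<^sup>2) * a + \<alpha>\<^sup>2 * h i $ 1 <..< (1 - \<alpha>\<^sup>2) * b + \<alpha>\<^sup>2 * h i $ 1} \<longleftrightarrow>
    z $ 2 < 0 \<and> conic z i = 0 \<and> a < apex z i \<and> apex z i < b"
  unfolding conic_arc_def conic_def apex_less_iff less_apex_iff by auto

lemma F2_3_iff:
  assumes "1 \<le> i" "i < n"
  shows "z \<in> F2_3 \<alpha> (h i) (h (i + 1)) \<longleftrightarrow> z $ 2 < 0 \<and> gap z i (cut i) = 0 \<and> cut i \<le> apex z i \<and> apex z (i + 1) \<le> cut i"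
  unfolding F2_3_def circ_arc_def gap_eq_iff le_apex_iff apex_le_iff cut_between[OF assms] by auto

lemma gap_apex: "gap z i (apex z i) = 0 \<longleftrightarrow> conic z i = 0"
  unfolding gap_vertex_form using b_pos \<alpha> by auto

lemma criticalI:
  assumes z: "z $ 2 < 0" and i: "1 \<le> i" "i \<le> n" "cut (i - 1) \<le> s" "s \<le> cut i" "gap z i s = 0"
    and nonneg: "\<And>r. 0 \<le> r \<Longrightarrow> r \<le> l \<Longrightarrow> \<exists>j\<in>{1..n}. 0 \<le> gap z j r"
  shows "z \<in> critical"
proof -
  have le: "gap z j s \<le> 0" if "j \<in> {1..n}" for j using gap_dominates[OF i(1-4), of j z] that i(5) by simp
  have s: "s \<in> {0..l}" using cell_range i by blast
  show ?thesis unfolding critical_def mem_Collect_eq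
    by (intro conjI z bexI[OF _ s] ballI) (use le nonneg in simp_all)
qed

text \<open>The vertex is placed so that one or two parabolas stay nonnegative where they are used:
  for an end of the target line it lies at or beyond that end, and for an inner cut each parabola is
  used on its own side.\<close>

lemma curve_subset: "curve \<subseteq> critical"
proof
  fix z assume "z \<in> curve"
  then consider "z \<in> F1_1 \<alpha> (h 1)"
    | i where "i \<in> {1..n}" "z \<in> conic_arc \<alpha> (h i) {(1 - \<alpha>\<^sup>2) * cut (i - 1) + \<alpha>\<^sup>2 * h i $ 1 <..< (1 - \<alpha>\<^sup>2) * cut i + \<alpha>\<^sup>2 * h i $ 1}"
    | i where "i \<in> {1..<n}" "z \<in> F2_3 \<alpha> (h i) (h (i + 1))" | "z \<in> F1_3 \<alpha> l (h n)"
    unfolding curve_def by blast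
  then show "z \<in> critical"
  proof cases
    case 1
    then have z: "z $ 2 < 0" "gap z 1 0 = 0" "apex z 1 \<le> 0" unfolding F1_1_iff by blast+
    have "0 \<le> gap z 1 r" if "0 \<le> r" for r
      using gap_closer_le[of 0 z 1 r] z that by simp
    then show ?thesis using z n cut_less[of 1] by (intro criticalI[of z 1 0] bexI[of _ 1]) auto
  next
    case (2 i)
    then have z: "z $ 2 < 0" "gap z i (apex z i) = 0" "cut (i - 1) < apex z i" "apex z i < cut i"
      by (auto simp: conic_arc_iff gap_apex)
    have "0 \<le> gap z i r" for r using gap_closer_le[of "apex z i" z i r] z by simp
    then show ?thesis using z 2 by (intro criticalI[of z i "apex z i"] bexI[of _ i]) auto
  next
    case (3 i)
    then have i: "1 \<le> i" "i < n" by auto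
    have z: "z $ 2 < 0" "gap z i (cut i) = 0" "cut i \<le> apex z i" "apex z (i + 1) \<le> cut i"
      using 3(2) F2_3_iff[OF i] by auto
    have "\<exists>j\<in>{1..n}. 0 \<le> gap z j r" for r
    proof (cases "r \<le> cut i")
      case True
      then have "0 \<le> gap z i r" using gap_closer_le[of "cut i" z i r] z by simp
      then show ?thesis using i by (intro bexI[of _ i]) auto
    next
      case False
      then have "0 \<le> gap z (i + 1) r" using gap_closer_le[of "cut i" z "i + 1" r] gap_at_cut[OF i, of z] z by simp
      then show ?thesis using i by (intro bexI[of _ "i + 1"]) auto
    qed
    then show ?thesis using z i cut_less[of i] by (intro criticalI[of z i "cut i"]) auto
  next
    case 4
    then have z: "z $ 2 < 0" "gap z n l = 0" "l \<le> apex z n" by (auto simp: F1_3_iff)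
    have "0 \<le> gap z n r" if "r \<le> l" for r
      using gap_closer_le[of l z n r] z that by simp
    then show ?thesis using z n cut_less[of n] by (intro criticalI[of z n l] bexI[of _ n]) auto
  qed
qed

text \<open>At \<open>s\<close> the largest gap attains its minimum 0. Inside a cell this forces the
  vertex to be \<open>s\<close>. At a cut each adjacent parabola is known to be nonnegative on one
  side only, so its vertex may lie beyond the cut; this freedom produces the circular arcs.\<close>

lemma critical_subset: "critical \<subseteq> curve"
proof
  fix z assume zc: "z \<in> critical"
  then obtain s where z: "z $ 2 < 0" and s: "0 \<le> s" "s \<le> l" "\<And>i. i \<in> {1..n} \<Longrightarrow> gap z i s \<le> 0"
    unfolding critical_def by auto
  have nonneg: "0 \<le> gap z i r" if i: "1 \<le> i" "i \<le> n" "cut (i - 1) \<le> r" "r \<le> cut i" for i r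
  proof -
    have "r \<in> {0..l}" using cell_range i by blast
    then obtain j where "j \<in> {1..n}" "0 \<le> gap z j r" using zc unfolding critical_def by blast
    then show ?thesis using gap_dominates[OF i, of j z] by simp
  qed
  have at_cut: "z \<in> curve" if i: "i \<le> n" and si: "s = cut i" for i
  proof -
    have lo: "gap z i s = 0 \<and> s \<le> apex z i" if "1 \<le> i"
    proof -
      have "gap z i s = 0" using s(3)[of i] nonneg[of i s] cut_less[of i] si that i by force
      moreover have "s \<le> apex z i"
        using cut_less[of i] nonneg[of i] that i si by (intro apex_right[OF calculation, of "cut (i - 1)"]) auto
      ultimately show ?thesis by simp
    qed
    have hi: "gap z (i + 1) s = 0 \<and> apex z (i + 1) \<le> s" if "i < n"
    proof -
      have "gap z (i + 1) s = 0" using s(3)[of "i + 1"] nonneg[of "i + 1" s] cut_less[of "i + 1"] si that by force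
      moreover have "apex z (i + 1) \<le> s"
        using cut_less[of "i + 1"] nonneg[of "i + 1"] that si by (intro apex_left[OF calculation, of "cut (i + 1)"]) auto
      ultimately show ?thesis by simp
    qed
    consider "i = 0" | "1 \<le> i" "i < n" | "i = n" "1 \<le> i" using i by linarith
    then show ?thesis
    proof cases
      case 1
      then have "z \<in> F1_1 \<alpha> (h 1)" unfolding F1_1_iff using hi n z si by auto
      then show ?thesis by (simp add: curve_def)
    next
      case 2
      then have "z \<in> F2_3 \<alpha> (h i) (h (i + 1))" unfolding F2_3_iff[OF 2] using lo hi z si 2 by simp
      then show ?thesis using 2 unfolding curve_def by auto
    next
      case 3
      then have "z \<in> F1_3 \<alpha> l (h n)" using lo z si by (auto simp: F1_3_iff)
      then show ?thesis by (simp add: curve_def)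
    qed
  qed
  obtain i where i: "1 \<le> i" "i \<le> n" "cut (i - 1) \<le> s" "s \<le> cut i" using in_cell[OF s(1,2)] .
  show "z \<in> curve"
  proof (cases "s = cut (i - 1) \<or> s = cut i")
    case True
    then show ?thesis using at_cut[of i] at_cut[of "i - 1"] i by auto
  next
    case False
    then have str: "cut (i - 1) < s" "s < cut i" using i by auto
    have g0: "gap z i s = 0" using s(3)[of i] nonneg[OF i] i by simp
    have "s \<le> apex z i" using nonneg[of i] i str by (intro apex_right[OF g0 str(1)]) auto
    moreover have "apex z i \<le> s" using nonneg[of i] i str by (intro apex_left[OF g0 str(2)]) auto
    ultimately have "apex z i = s" by simp
    then have "z \<in> conic_arc \<alpha> (h i) {(1 - \<alpha>\<^sup>2) * cut (i - 1) + \<alpha>\<^sup>2 * h i $ 1 <..< (1 - \<alpha>\<^sup>2) * cut i + \<alpha>\<^sup>2 * h i $ 1}"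
      using z g0 str gap_apex[of z i] by (simp add: conic_arc_iff)
    then show ?thesis using i unfolding curve_def by auto
  qed
qed

lemma critical_eq: "critical = curve"
  using curve_subset critical_subset by blast

end

section \<open>The two games as instances of \<open>reach_avoid\<close>, and the base curves\<close>

lemma reach_avoid_free:
  assumes "0 < l" "0 < vE" "vE < vP" "\<alpha> = vE / vP" "finite K" "K \<noteq> {}"
  shows "reach_avoid UNIV (target_line l) (target_line l) vP vE \<alpha> K X"
proof
  show "\<exists>e0\<in>target_line l. \<exists>e1\<in>target_line l. e0 \<noteq> e1"
    unfolding target_line_def using assms(1)
    by (intro bexI[of _ "pt 0 0"] bexI[of _ "pt l 0"]) (auto simp: vec_eq_iff forall_2)
  show "\<exists>s\<in>{0..t}. c s \<in> target_line l" if "0 \<le> t" "c t \<in> target_line l" for c :: "real \<Rightarrow> real^2" and t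
    using that by (intro bexI[of _ t]) auto
qed (use assms in \<open>auto simp: target_line_def intro: compact_imp_closed\<close>)

lemma reach_avoid_domain:
  assumes "convex \<Omega>" "target_line l \<subseteq> \<Omega>" "\<Omega> \<inter> {z. z $ 2 = 0} = target_line l" "compact (tar_region \<Omega>)"
    and "0 < l" "0 < vE" "vE < vP" "\<alpha> = vE / vP" "finite K" "K \<noteq> {}"
    and X: "\<And>i. i \<in> K \<Longrightarrow> X i \<in> \<Omega>"
  shows "reach_avoid \<Omega> (tar_region \<Omega>) (target_line l) vP vE \<alpha> K X"
proof
  show "\<exists>e0\<in>target_line l. \<exists>e1\<in>target_line l. e0 \<noteq> e1"
    unfolding target_line_def using assms(5)
    by (intro bexI[of _ "pt 0 0"] bexI[of _ "pt l 0"]) (auto simp: vec_eq_iff forall_2)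
  show "target_line l \<subseteq> tar_region \<Omega>" unfolding assms(3)[symmetric] by (auto simp: tar_region_def)
  show "\<exists>s\<in>{0..t}. c s \<in> target_line l"
    if t: "0 \<le> t" and c: "continuous_on {0..t} c" "\<And>s. s \<in> {0..t} \<Longrightarrow> c s \<in> \<Omega>" "c 0 \<notin> tar_region \<Omega>" "c t \<in> tar_region \<Omega>"
    for c :: "real \<Rightarrow> real^2" and t
  proof -
    \<comment> \<open>A path into the target region crosses the axis, and inside
      \<open>\<Omega>\<close> the axis is the target line.\<close>
    have "continuous_on {0..t} (\<lambda>s. c s $ 2)" using c(1) by (intro continuous_intros)
    moreover have "c 0 $ 2 \<le> 0" "0 \<le> c t $ 2" using c(2)[of 0] c(3,4) t by (auto simp: tar_region_def)
    ultimately obtain s where "0 \<le> s" "s \<le> t" "c s $ 2 = 0" using IVT'[of "\<lambda>s. c s $ 2" 0 0 t] t by auto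
    then show ?thesis using c(2)[of s] assms(3) by (intro bexI[of _ s]) auto
  qed
qed (use assms in \<open>auto simp: target_line_def intro: compact_imp_closed\<close>)

context active_line
begin

lemma critical_iff:
  assumes K: "K = m ` {1..n}" and h: "\<And>j. j \<in> {1..n} \<Longrightarrow> h j = X (m j)"
  shows "z \<in> critical \<longleftrightarrow> z $ 2 < 0 \<and> (\<exists>q\<in>target_line l. \<forall>i\<in>K. norm (z - q) \<le> \<alpha> * norm (X i - q)) \<and>
    (\<forall>q\<in>target_line l. \<exists>i\<in>K. \<alpha> * norm (X i - q) \<le> norm (z - q))"
  unfolding critical_def K target_line_eq[OF l] gap_le_iff gap_ge_iff using h by simp

lemma curve_1:
  assumes "n = 1"
  shows "curve = F1_1 \<alpha> (h 1) \<union> F1_2 \<alpha> l (h 1) \<union> F1_3 \<alpha> l (h 1)"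
proof -
  have e: "{1..n} = {1}" "{1..<n} = {}" "h n = h 1" using assms by auto
  have c: "cut 1 = l" "cut (1 - 1) = 0" using cut_n cut_0 unfolding assms by simp_all
  show ?thesis unfolding curve_def F1_2_def e UN_insert UN_empty c by simp
qed

text \<open>The first and the last cell are split off the union of conic arcs. For
  \<open>n = 2\<close> no inner cell remains, so the same formula serves coalitions of two and of
  more.\<close>

lemma curve_ge_2:
  assumes "2 \<le> n"
  shows "curve = F2_1 \<alpha> (h 1) (h 2) \<union> F2_2 \<alpha> (h 1) (h 2)
          \<union> (\<Union>i\<in>{1..n - 1}. F2_3 \<alpha> (h i) (h (i + 1)))
          \<union> (\<Union>i\<in>{2..n - 1}. F3 \<alpha> (h (i - 1)) (h i) (h (i + 1)))
          \<union> F2_4 \<alpha> l (h (n - 1)) (h n) \<union> F2_5 \<alpha> l (h (n - 1)) (h n)"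
proof -
  let ?A = "\<lambda>i. conic_arc \<alpha> (h i) {(1 - \<alpha>\<^sup>2) * cut (i - 1) + \<alpha>\<^sup>2 * h i $ 1 <..< (1 - \<alpha>\<^sup>2) * cut i + \<alpha>\<^sup>2 * h i $ 1}"
  have "{1..n} = insert 1 (insert n {2..n - 1})" using assms by auto
  then have split: "(\<Union>i\<in>{1..n}. ?A i) = ?A 1 \<union> (\<Union>i\<in>{2..n - 1}. ?A i) \<union> ?A n" by auto
  have first: "?A 1 = F2_2 \<alpha> (h 1) (h 2)"
    using cut_between[of 1] assms by (simp add: F2_2_def numeral_2_eq_2)
  have last: "?A n = F2_4 \<alpha> l (h (n - 1)) (h n)"
    using cut_between[of "n - 1"] assms by (simp add: F2_4_def)
  have mid: "(\<Union>i\<in>{2..n - 1}. ?A i) = (\<Union>i\<in>{2..n - 1}. F3 \<alpha> (h (i - 1)) (h i) (h (i + 1)))"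
  proof (rule SUP_cong[OF refl])
    fix i assume "i \<in> {2..n - 1}"
    then have i: "1 \<le> i - 1" "i - 1 < n" "i - 1 + 1 = i" "1 \<le> i" "i < n" by auto
    show "?A i = F3 \<alpha> (h (i - 1)) (h i) (h (i + 1))"
      unfolding F3_def cut_between[OF i(1,2)] cut_between[OF i(4,5)] i(3) ..
  qed
  have "{1..<n} = {1..n - 1}" using assms by auto
  then show ?thesis
    unfolding curve_def F2_1_def F2_5_def split first last mid by (simp only: Un_ac)
qed

end

theorem theorem3:
  fixes \<Omega> :: "(real^2) set" and l \<alpha> vP vE :: real
    and Np Ne :: nat and xP xE :: "nat \<Rightarrow> real^2"
    and K :: "nat set" and m :: "nat \<Rightarrow> nat"
  assumes domain: "convex \<Omega>" "bounded \<Omega>"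
    and target: "0 < l" "target_line l \<subseteq> \<Omega>" "pt 0 0 \<in> frontier \<Omega>" "pt l 0 \<in> frontier \<Omega>"
      "\<Omega> \<inter> {z. z $ 2 = 0} = target_line l" "compact (tar_region \<Omega>)"
    and speeds: "0 < vP" "0 < vE" "\<alpha> = vE / vP" "0 < \<alpha>" "\<alpha> < 1"
    and distinct_positions: "inj_on xP {1..Np}" "inj_on xE {1..Ne}" "xP ` {1..Np} \<inter> xE ` {1..Ne} = {}"
    and pursuers: "\<forall>i\<in>{1..Np}. xP i \<in> play_region \<Omega> \<union> target_line l"
    and evaders: "\<forall>j\<in>{1..Ne}. xE j \<in> play_region \<Omega>"
    and coalition: "K \<noteq> {}" "K \<subseteq> {1..Np}" "full_active l K xP"
    and listing: "bij_betw m {1..card K} K" "strict_mono_on {1..card K} (\<lambda>i. xP (m i) $ 1)"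
  shows "barrier \<Omega> vP vE K xP = free_barrier l vP vE K xP \<inter> play_region \<Omega>
    \<and> (card K = 1 \<longrightarrow> free_barrier l vP vE K xP =
          F1_1 \<alpha> (xP (m 1)) \<union> F1_2 \<alpha> l (xP (m 1)) \<union> F1_3 \<alpha> l (xP (m 1)))
    \<and> (card K = 2 \<longrightarrow> free_barrier l vP vE K xP =
          F2_1 \<alpha> (xP (m 1)) (xP (m 2)) \<union> F2_2 \<alpha> (xP (m 1)) (xP (m 2))
          \<union> F2_3 \<alpha> (xP (m 1)) (xP (m 2))
          \<union> F2_4 \<alpha> l (xP (m 1)) (xP (m 2)) \<union> F2_5 \<alpha> l (xP (m 1)) (xP (m 2)))
    \<and> (3 \<le> card K \<and> card K \<le> Np \<longrightarrow> free_barrier l vP vE K xP =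
          F2_1 \<alpha> (xP (m 1)) (xP (m 2)) \<union> F2_2 \<alpha> (xP (m 1)) (xP (m 2))
          \<union> (\<Union>i\<in>{1..card K - 1}. F2_3 \<alpha> (xP (m i)) (xP (m (i + 1))))
          \<union> (\<Union>i\<in>{2..card K - 1}. F3 \<alpha> (xP (m (i - 1))) (xP (m i)) (xP (m (i + 1))))
          \<union> F2_4 \<alpha> l (xP (m (card K - 1))) (xP (m (card K)))
          \<union> F2_5 \<alpha> l (xP (m (card K - 1))) (xP (m (card K))))"
proof -
  define n where "n = card K"
  define h where "h j = xP (m j)" for j
  have finK: "finite K" using coalition(2) by (rule finite_subset) simp
  have n: "1 \<le> n" using coalition(1) finK by (simp add: n_def Suc_le_eq card_gt_0_iff)
  have Km: "K = m ` {1..n}" and inj: "inj_on m {1..n}" using listing(1) by (auto simp: bij_betw_def n_def)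
  have v: "vE < vP" using speeds by simp
  have XD: "xP i \<in> \<Omega>" if "i \<in> K" for i
    using pursuers coalition(2) target(2) that by (auto simp: play_region_def)
  interpret active_line h n l \<alpha>
  proof
    show "h i $ 1 < h j $ 1" if "1 \<le> i" "i < j" "j \<le> n" for i j
      unfolding h_def using strict_mono_onD[OF listing(2), of i j] that by (simp add: n_def)
    show "\<exists>s\<in>{0..l}. \<forall>j\<in>{1..n} - {i}. norm (h i - pt s 0) < norm (h j - pt s 0)" if i: "1 \<le> i" "i \<le> n" for i
    proof -
      have "m i \<in> K" using i Km by auto
      then obtain p where "p \<in> target_line l" and p: "\<forall>k\<in>K - {m i}. norm (xP (m i) - p) < norm (xP k - p)"
        using coalition(3) unfolding full_active_def by blast
      then obtain s where s: "s \<in> {0..l}" "p = pt s 0" using target_line_eq[OF target(1)] by blast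
      have "m j \<in> K - {m i}" if "j \<in> {1..n} - {i}" for j
        using that i Km inj_on_eq_iff[OF inj, of j i] by auto
      then show ?thesis using p s unfolding h_def by blast
    qed
  qed (use n target speeds in auto)
  interpret free: reach_avoid UNIV "target_line l" "target_line l" vP vE \<alpha> K xP
    using target(1) speeds(2) v speeds(3) finK coalition(1) by (rule reach_avoid_free)
  interpret dom: reach_avoid \<Omega> "tar_region \<Omega>" "target_line l" vP vE \<alpha> K xP
    using domain(1) target(2,5,6,1) speeds(2) v speeds(3) finK coalition(1) XD by (rule reach_avoid_domain)
  have hX: "h j = xP (m j)" for j by (simp add: h_def)
  have crit: "z \<in> critical \<longleftrightarrow> z $ 2 < 0 \<and> (\<exists>q\<in>target_line l. \<forall>i\<in>K. norm (z - q) \<le> \<alpha> * norm (xP i - q)) \<and>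
    (\<forall>q\<in>target_line l. \<exists>i\<in>K. \<alpha> * norm (xP i - q) \<le> norm (z - q))" for z
    by (rule critical_iff[OF Km hX])
  have off: "z \<notin> target_line l" if "z $ 2 < 0" for z
    using that by (auto simp: target_line_eq[OF target(1)])
  \<comment> \<open>The free game also has starting points on and above the axis; only those below
    it enter the comparison.\<close>
  have free: "free_barrier l vP vE K xP = critical"
  proof -
    have "free_barrier l vP vE K xP = {z. z $ 2 < 0} \<inter> ((UNIV - target_line l) -
      (pursuit_winning_region UNIV (target_line l) vP vE K xP \<union> evasion_winning_region UNIV (target_line l) vP vE K xP))"
      unfolding free_barrier_def using off by blast
    also have "\<dots> = critical"
    proof (rule set_eqI)
      fix z show "z \<in> {z. z $ 2 < 0} \<inter> ((UNIV - target_line l) -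
        (pursuit_winning_region UNIV (target_line l) vP vE K xP \<union> evasion_winning_region UNIV (target_line l) vP vE K xP))
        \<longleftrightarrow> z \<in> critical"
        unfolding free.neither_wins crit using off[of z] by (cases "z $ 2 < 0") simp_all
    qed
    finally show ?thesis .
  qed
  \<comment> \<open>\<open>neither_wins\<close> gives the same inequalities over the target line in
    both games, so the barriers differ only by the intersection with the play region.\<close>
  have dom: "barrier \<Omega> vP vE K xP = critical \<inter> play_region \<Omega>"
  proof (rule set_eqI)
    fix z
    have "z \<notin> tar_region \<Omega> \<longleftrightarrow> z $ 2 < 0" if "z \<in> \<Omega>" using that by (auto simp: tar_region_def)
    then show "z \<in> barrier \<Omega> vP vE K xP \<longleftrightarrow> z \<in> critical \<inter> play_region \<Omega>"
      unfolding barrier_def play_region_def dom.neither_wins Int_iff crit by (cases "z \<in> \<Omega>"; cases "z $ 2 < 0") simp_all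
  qed
  have one: "free_barrier l vP vE K xP = F1_1 \<alpha> (xP (m 1)) \<union> F1_2 \<alpha> l (xP (m 1)) \<union> F1_3 \<alpha> l (xP (m 1))" if "card K = 1"
  proof -
    have "n = 1" using that by (simp add: n_def)
    from curve_1[OF this] show ?thesis unfolding free critical_eq unfolding h_def .
  qed
  have two: "free_barrier l vP vE K xP = F2_1 \<alpha> (xP (m 1)) (xP (m 2)) \<union> F2_2 \<alpha> (xP (m 1)) (xP (m 2))
          \<union> (\<Union>i\<in>{1..card K - 1}. F2_3 \<alpha> (xP (m i)) (xP (m (i + 1))))
          \<union> (\<Union>i\<in>{2..card K - 1}. F3 \<alpha> (xP (m (i - 1))) (xP (m i)) (xP (m (i + 1))))
          \<union> F2_4 \<alpha> l (xP (m (card K - 1))) (xP (m (card K)))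
          \<union> F2_5 \<alpha> l (xP (m (card K - 1))) (xP (m (card K)))" if "2 \<le> card K"
  proof -
    have "2 \<le> n" using that by (simp add: n_def)
    from curve_ge_2[OF this] show ?thesis unfolding free critical_eq unfolding h_def n_def .
  qed
  \<comment> \<open>Two pursuers have one inner cut and no inner cell.\<close>
  have "free_barrier l vP vE K xP = F2_1 \<alpha> (xP (m 1)) (xP (m 2)) \<union> F2_2 \<alpha> (xP (m 1)) (xP (m 2))
          \<union> F2_3 \<alpha> (xP (m 1)) (xP (m 2))
          \<union> F2_4 \<alpha> l (xP (m 1)) (xP (m 2)) \<union> F2_5 \<alpha> l (xP (m 1)) (xP (m 2))" if "card K = 2"
    using two that by (simp add: numeral_2_eq_2)
  then show ?thesis using one two dom free by simp
qed

end
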